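(* The Dominating Set problem can be solved in time $O^*(3^{dk+o(dk)})$ on undirected graphs of degeneracy $d$.
   Context: Dominating Set: given an undirected graph $G=(V,E)$ and an integer $k$, decide whether there is $S\subseteq V$ with $|S|\le k$ such that every vertex of $G$ is in $S$ or adjacent to a vertex of $S$. The degeneracy of $G$ is the least $d$ such that every subgraph of $G$ has a vertex of degree at most $d$. $O^*(\cdot)$ suppresses factors polynomial in the input size. *)

theory Defs
  imports Complex_Main "HOL-Library.Landau_Symbols" "HOL-Library.Log_Nat"
    "HOL-Computational_Algebra.Polynomial"
begin

subsection \<open>Graphs, degeneracy, dominating sets\<close>

definition simple_graph :: "'a set \<Rightarrow> 'a set set \<Rightarrow> bool" where
  "simple_graph V E \<longleftrightarrow> finite V \<and> (\<forall>e\<in>E. e \<subseteq> V \<and> card e = 2)"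

definition subgraph :: "'a set \<Rightarrow> 'a set set \<Rightarrow> 'a set \<Rightarrow> 'a set set \<Rightarrow> bool" where
  "subgraph V' E' V E \<longleftrightarrow> simple_graph V' E' \<and> V' \<subseteq> V \<and> E' \<subseteq> E"

definition vertex_degree :: "'a set set \<Rightarrow> 'a \<Rightarrow> nat" where
  "vertex_degree E v = card {e \<in> E. v \<in> e}"

text \<open>The empty subgraph has no vertex at all and is therefore excluded.\<close>

definition degeneracy :: "'a set \<Rightarrow> 'a set set \<Rightarrow> nat" where
  "degeneracy V E = (LEAST d. \<forall>V' E'. subgraph V' E' V E \<and> V' \<noteq> {} \<longrightarrow>
     (\<exists>v\<in>V'. vertex_degree E' v \<le> d))"

definition dominating_set :: "'a set \<Rightarrow> 'a set set \<Rightarrow> 'a set \<Rightarrow> bool" where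
  "dominating_set V E S \<longleftrightarrow> S \<subseteq> V \<and> (\<forall>v\<in>V. v \<in> S \<or> (\<exists>u\<in>S. {u, v} \<in> E))"

definition Dominating_Set :: "'a set \<Rightarrow> 'a set set \<Rightarrow> nat \<Rightarrow> bool" where
  "Dominating_Set V E k \<longleftrightarrow> (\<exists>S. dominating_set V E S \<and> card S \<le> k)"

subsection \<open>Random access machine with logarithmic cost\<close>

text \<open>
  Programs of a random access machine, with structured control flow instead of jumps. A program
  mentions finitely many registers; a separate memory is accessed indirectly through registers.
  Registers and memory cells hold arbitrary natural numbers. Every step is charged, besides
  one unit, the binary length of all register and memory contents it reads, including those used
  as addresses. (Register indices and constants are part of the fixed program.)
\<close>

datatype ram =
    Skip
  | Const nat nat        \<comment> \<open>\<open>r\<^sub>i := c\<close>\<close>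
  | Add nat nat nat      \<comment> \<open>\<open>r\<^sub>i := r\<^sub>j + r\<^sub>l\<close>\<close>
  | Sub nat nat nat      \<comment> \<open>\<open>r\<^sub>i := r\<^sub>j - r\<^sub>l\<close>, truncated at 0\<close>
  | Load nat nat         \<comment> \<open>\<open>r\<^sub>i := mem[r\<^sub>j]\<close>\<close>
  | Store nat nat        \<comment> \<open>\<open>mem[r\<^sub>i] := r\<^sub>j\<close>\<close>
  | Seq ram ram
  | If nat ram ram       \<comment> \<open>first branch iff \<open>r\<^sub>i \<noteq> 0\<close>\<close>
  | While nat ram        \<comment> \<open>loop while \<open>r\<^sub>i \<noteq> 0\<close>\<close>

abbreviation len :: "nat \<Rightarrow> nat" where
  "len x \<equiv> floorlog 2 x"

type_synonym config = "(nat \<Rightarrow> nat) \<times> (nat \<Rightarrow> nat)"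

text \<open>\<open>exec P s t s'\<close>: started in \<open>s = (registers, memory)\<close>, program \<open>P\<close> halts in \<open>s'\<close> after
  time \<open>t\<close>.\<close>

inductive exec :: "ram \<Rightarrow> config \<Rightarrow> nat \<Rightarrow> config \<Rightarrow> bool" where
  Skip: "exec Skip s 1 s"
| Const: "exec (Const i c) (r, m) 1 (r(i := c), m)"
| Add: "exec (Add i j l) (r, m) (1 + len (r j) + len (r l)) (r(i := r j + r l), m)"
| Sub: "exec (Sub i j l) (r, m) (1 + len (r j) + len (r l)) (r(i := r j - r l), m)"
| Load: "exec (Load i j) (r, m) (1 + len (r j) + len (m (r j))) (r(i := m (r j)), m)"
| Store: "exec (Store i j) (r, m) (1 + len (r i) + len (r j)) (r, m(r i := r j))"
| Seq: "exec P s t s' \<Longrightarrow> exec Q s' t' s'' \<Longrightarrow> exec (Seq P Q) s (t + t') s''"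
| IfTrue: "r i \<noteq> 0 \<Longrightarrow> exec P (r, m) t s' \<Longrightarrow> exec (If i P Q) (r, m) (1 + len (r i) + t) s'"
| IfFalse: "r i = 0 \<Longrightarrow> exec Q (r, m) t s' \<Longrightarrow> exec (If i P Q) (r, m) (1 + len (r i) + t) s'"
| WhileFalse: "r i = 0 \<Longrightarrow> exec (While i P) (r, m) (1 + len (r i)) (r, m)"
| WhileTrue: "r i \<noteq> 0 \<Longrightarrow> exec P (r, m) t s' \<Longrightarrow> exec (While i P) s' t' s'' \<Longrightarrow>
    exec (While i P) (r, m) (1 + len (r i) + t + t') s''"

inductive_cases exec_elims:
  "exec Skip s t s'" "exec (Const i c) s t s'" "exec (Add i j l) s t s'"
  "exec (Sub i j l) s t s'" "exec (Load i j) s t s'" "exec (Store i j) s t s'"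
  "exec (Seq P Q) s t s'" "exec (If i P Q) s t s'"

lemma exec_deterministic:
  "exec P s t s' \<Longrightarrow> exec P s u s'' \<Longrightarrow> t = u \<and> s' = s''"
proof (induction arbitrary: u s'' rule: exec.induct)
  case Seq
  from Seq.prems show ?case by (elim exec_elims) (use Seq.IH in blast)
next
  case IfTrue
  from IfTrue.prems show ?case by (elim exec_elims) (use IfTrue.hyps IfTrue.IH in fastforce)+
next
  case IfFalse
  from IfFalse.prems show ?case by (elim exec_elims) (use IfFalse.hyps IfFalse.IH in fastforce)+
next
  case WhileFalse
  from WhileFalse.prems show ?case by (cases rule: exec.cases) (use WhileFalse.hyps in simp_all)
next
  case (WhileTrue r i P m t s' t' s1)
  have *: "\<And>a s2. exec P (r, m) a s2 \<Longrightarrow> t = a \<and> s' = s2"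
    and **: "\<And>b s2. exec (While i P) s' b s2 \<Longrightarrow> t' = b \<and> s1 = s2"
    using WhileTrue.IH by blast+
  from WhileTrue.prems show ?case
  proof (cases rule: exec.cases)
    case WhileFalse
    then show ?thesis using WhileTrue.hyps by simp
  next
    case (WhileTrue a s2 b)
    then show ?thesis using *[of a s2] **[of b s''] by simp
  qed
qed (elim exec_elims; simp)+

definition initial :: "nat list \<Rightarrow> config" where
  "initial xs = ((\<lambda>_. 0), (\<lambda>a. if a < length xs then xs ! a else 0))"

text \<open>The answer is read off register 0.\<close>

definition decides_in_time :: "ram \<Rightarrow> nat list \<Rightarrow> bool \<Rightarrow> real \<Rightarrow> bool" where
  "decides_in_time P xs answer T \<longleftrightarrow>
     (\<exists>t s. exec P (initial xs) t s \<and> real t \<le> T \<and> (fst s 0 \<noteq> 0 \<longleftrightarrow> answer))"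

definition input_size :: "nat list \<Rightarrow> nat" where
  "input_size xs = (\<Sum>x\<leftarrow>xs. 1 + len x)"

text \<open>An instance on vertex set \<open>{0, \<dots>, n - 1}\<close>: \<open>k\<close>, \<open>n\<close> and the adjacency matrix by rows.\<close>

definition encode_instance :: "nat \<Rightarrow> nat set set \<Rightarrow> nat \<Rightarrow> nat list" where
  "encode_instance n E k =
     k # n # concat (map (\<lambda>i. map (\<lambda>j. if {i, j} \<in> E then 1 else 0) [0..<n]) [0..<n])"

text \<open>\<open>P\<close> solves Dominating Set in time \<open>O\<^sup>*(f d k)\<close> on graphs of degeneracy \<open>d\<close>.\<close>

definition solves_Dominating_Set_in_O_star :: "ram \<Rightarrow> (nat \<Rightarrow> nat \<Rightarrow> real) \<Rightarrow> bool" where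
  "solves_Dominating_Set_in_O_star P f \<longleftrightarrow>
     (\<exists>p :: real poly. \<forall>n E k d. simple_graph {..<n} E \<and> degeneracy {..<n} E = d \<longrightarrow>
        decides_in_time P (encode_instance n E k) (Dominating_Set {..<n} E k)
          (poly p (real (input_size (encode_instance n E k))) * f d k))"

end

theory Submission
  imports Defs
begin

text \<open>
  Order the vertices by repeatedly removing one of minimum degree, so that every vertex has at most \<open>d\<close> later
  neighbours. Process the vertices in this order and look at the first undominated vertex \<open>v\<close>. Either some vertex
  of the solution among \<open>v\<close> and its later neighbours is picked, or \<open>v\<close> is marked: it must then be dominated by an
  earlier neighbour. Picks made later come after all marked vertices, so the marked ones are left to the \<open>k\<close>
  solution vertices not yet picked, and there are at most \<open>d * k\<close> of them. If \<open>v\<close> has exactly one later neighbour \<open>u\<close>, picking \<open>u\<close> is as good as picking \<open>v\<close>, hence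
  there are at most \<open>3 ^ (d - 1)\<close> candidates for \<open>d \<ge> 1\<close>. At a leaf the \<open>k\<close>-tuples of vertices covering the
  marked set are counted by inclusion-exclusion, and the choice of the subset is merged into the branching: marking
  becomes two branches that lower the budget \<open>b = d * k - #marked\<close> by one, each pick lowers it by \<open>d\<close>, and
  \<open>2 * 3 ^ (b - 1) + 3 ^ (d - 1) * 3 ^ (b - d) = 3 ^ b\<close>. So there are at most \<open>(n + 1) * 3 ^ (d * k)\<close> states, and
  the error term in the exponent is zero.
\<close>

subsection \<open>Branching with inclusion-exclusion at the leaves\<close>

text \<open>The exception for a single later neighbour is forced by the base 3: \<open>d + 1\<close>
  candidates fit into \<open>3 ^ (d - 1)\<close> as soon as \<open>d \<ge> 2\<close>, but
  \<open>d = 1\<close> leaves room for one candidate only. Counting \<open>k\<close>-tuples with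
  repetitions instead of sets makes the number of choices avoiding a given set a plain power, and on
  a nonempty graph a covering tuple exists exactly if there is a covering set of at most
  \<open>k\<close> vertices. The machine has no recursion, so the branching becomes a queue of
  states, and processed states are not reclaimed. This is affordable under logarithmic cost because
  addresses and partial sums have polynomially many bits. Answering \<open>k \<ge> n\<close> at once
  keeps all exponents polynomial in \<open>n\<close>. The degeneracy is not part of the input: the
  program works with the largest number of later neighbours that its own order produces, and the
  greedy choice keeps that number below the degeneracy.\<close>

lemma sum_list_pos_iff:
  fixes f :: "'a \<Rightarrow> nat"
  shows "0 < (\<Sum>x\<leftarrow>xs. f x) \<longleftrightarrow> (\<exists>x\<in>set xs. 0 < f x)"
  by (induction xs) auto

text \<open>
  A state \<open>(v, k, b, D, A)\<close>: vertices below \<open>v\<close> are processed, \<open>k\<close> picks are left, \<open>D\<close> is dominated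
  by the picks made, \<open>A\<close> is the part of the marked vertices chosen in the inclusion-exclusion sum, and
  \<open>b\<close> is \<open>d * k\<close> minus the number of marked vertices. Each future pick dominates at most \<open>d\<close> marked
  vertices, so branches in which \<open>b\<close> would become negative are cut.
\<close>

type_synonym state = "nat \<times> nat \<times> nat \<times> nat set \<times> nat set"

text \<open>Vertices are identified with their positions in the order. The relation \<open>a\<close>
  is closed adjacency; reflexivity lets \<open>a u x\<close> express domination without a separate
  case for \<open>u = x\<close>.\<close>

locale ordered_graph =
  fixes n d :: nat and a :: "nat \<Rightarrow> nat \<Rightarrow> bool"
  assumes sym: "a u v \<Longrightarrow> a v u"
    and refl: "a v v"
    and later_degree: "v < n \<Longrightarrow> card {u. v < u \<and> u < n \<and> a v u} \<le> d"
begin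

definition later :: "nat \<Rightarrow> nat set" where
  "later v = {u. v < u \<and> u < n \<and> a v u}"

text \<open>If \<open>u\<close> is the only later neighbour of \<open>v\<close>, then
  \<open>v\<close> dominates nothing at or after position \<open>v\<close> except \<open>v\<close>
  and \<open>u\<close>, and \<open>u\<close> dominates both. Starting the range at
  \<open>Suc v\<close> drops exactly the candidate \<open>v\<close>.\<close>

definition first_cand :: "nat \<Rightarrow> nat" where
  "first_cand v = (if card (later v) = 1 then Suc v else v)"

definition cands :: "nat \<Rightarrow> nat list" where
  "cands v = filter (a v) [first_cand v..<n]"

definition pick :: "state \<Rightarrow> nat \<Rightarrow> state" where
  "pick = (\<lambda>(v, k, b, D, A) u. (Suc v, k - 1, b - d, D \<union> {x. a u x}, A))"

fun children :: "state \<Rightarrow> state list" where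
  "children (v, k, b, D, A) =
    (if v \<in> D then [(Suc v, k, b, D, A)]
     else (if 0 < b then [(Suc v, k, b - 1, D, A), (Suc v, k, b - 1, D, insert v A)] else [])
       @ (if 0 < k \<and> d \<le> b then map (pick (v, k, b, D, A)) (cands v) else []))"

definition avoiders :: "nat set \<Rightarrow> nat set" where
  "avoiders A = {w. w < n \<and> (\<forall>x\<in>A. \<not> a w x)}"

text \<open>The first argument is the number of vertices still to be processed, so the recursion is
  structural. At a leaf the summand counts, with sign, the \<open>k\<close>-tuples that dominate no
  vertex of \<open>A\<close>.\<close>

fun signed_count :: "nat \<Rightarrow> state \<Rightarrow> int" where
  "signed_count 0 (v, k, b, D, A) = (-1) ^ card A * int (card (avoiders A) ^ k)"
| "signed_count (Suc f) s = (\<Sum>c\<leftarrow>children s. signed_count f c)"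

text \<open>The set \<open>B\<close> of vertices that must stay undominated is there for the
  induction of inclusion-exclusion; the branching uses \<open>B = {}\<close>.\<close>

definition covers :: "nat \<Rightarrow> nat set \<Rightarrow> nat set \<Rightarrow> nat list set" where
  "covers k M B = {xs. length xs = k \<and> set xs \<subseteq> avoiders B \<and> (\<forall>x\<in>M. \<exists>u\<in>set xs. a u x)}"

text \<open>The same branching before the inclusion-exclusion sum is merged into it: the last
  component is the full marked set, and marking is a single branch. Its values are honest numbers of
  solutions, so positivity can be argued combinatorially.\<close>

fun cover_count :: "nat \<Rightarrow> state \<Rightarrow> nat" where
  "cover_count 0 (v, k, b, D, M) = card (covers k M {})"
| "cover_count (Suc f) (v, k, b, D, M) =
    (if v \<in> D then cover_count f (Suc v, k, b, D, M)
     else (if 0 < b then cover_count f (Suc v, k, b - 1, D, insert v M) else 0)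
       + (if 0 < k \<and> d \<le> b then \<Sum>u\<leftarrow>cands v. cover_count f (pick (v, k, b, D, M) u) else 0))"

section \<open>Inclusion-exclusion\<close>

lemma finite_avoiders [simp]: "finite (avoiders B)"
  by (simp add: avoiders_def)

lemma finite_covers [simp]: "finite (covers k M B)"
  by (rule finite_subset[OF _ finite_lists_length_eq[OF finite_avoiders[of B], of k]])
    (auto simp: covers_def)

text \<open>Induction on \<open>M\<close> with \<open>B\<close> arbitrary. Among the tuples that
  cover \<open>M\<close> and avoid \<open>B\<close>, those covering a new \<open>x\<close> as well
  are all but those avoiding \<open>x\<close>, so the subsets containing \<open>x\<close> contribute
  the count for \<open>insert x B\<close> with a minus sign.\<close>

lemma card_covers:
  assumes "finite M" "finite B" "M \<inter> B = {}"
  shows "(\<Sum>A\<in>Pow M. (-1) ^ card A * int (card (avoiders (A \<union> B)) ^ k)) = int (card (covers k M B))"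
  using assms
proof (induction M arbitrary: B rule: finite_induct)
  case empty
  have "covers k {} B = {xs. set xs \<subseteq> avoiders B \<and> length xs = k}" by (auto simp: covers_def)
  then show ?case by (simp add: card_lists_length_eq)
next
  case (insert x M)
  let ?f = "\<lambda>A. (-1) ^ card A * int (card (avoiders (A \<union> B)) ^ k)"
  have inj: "inj_on (insert x) (Pow M)" using insert.hyps by (auto simp: inj_on_def)
  have disj: "Pow M \<inter> insert x ` Pow M = {}" using insert.hyps by auto
  have "(\<Sum>A\<in>Pow (insert x M). ?f A) = (\<Sum>A\<in>Pow M. ?f A) + (\<Sum>A\<in>Pow M. ?f (insert x A))"
    using insert.hyps inj disj by (simp add: Pow_insert sum.union_disjoint sum.reindex)
  also have "(\<Sum>A\<in>Pow M. ?f (insert x A))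
      = - (\<Sum>A\<in>Pow M. (-1) ^ card A * int (card (avoiders (A \<union> insert x B)) ^ k))"
    unfolding sum_negf[symmetric]
  proof (rule sum.cong)
    fix A assume "A \<in> Pow M"
    then have "card (insert x A) = Suc (card A)"
      using insert.hyps by (intro card_insert_disjoint) (auto intro: finite_subset)
    then show "?f (insert x A) = - ((-1) ^ card A * int (card (avoiders (A \<union> insert x B)) ^ k))"
      by simp
  qed simp
  also have "(\<Sum>A\<in>Pow M. ?f A) = int (card (covers k M B))"
    using insert.IH[of B] insert.prems by auto
  also have "(\<Sum>A\<in>Pow M. (-1) ^ card A * int (card (avoiders (A \<union> insert x B)) ^ k))
      = int (card (covers k M (insert x B)))"
    using insert.IH[of "insert x B"] insert.prems insert.hyps by auto
  also have "int (card (covers k M B)) + - int (card (covers k M (insert x B)))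
      = int (card (covers k (insert x M) B))"
  proof -
    have "covers k M B = covers k (insert x M) B \<union> covers k M (insert x B)"
      by (auto simp: covers_def avoiders_def)
    moreover have "covers k (insert x M) B \<inter> covers k M (insert x B) = {}"
      by (auto simp: covers_def avoiders_def)
    ultimately have "card (covers k M B)
        = card (covers k (insert x M) B) + card (covers k M (insert x B))"
      by (simp add: card_Un_disjoint)
    then show ?thesis by simp
  qed
  finally show ?case .
qed

text \<open>Summed over all choices \<open>A\<close> of a subset of the marked vertices, the merged
  branching gives the unmerged one. All these choices share \<open>v\<close>, \<open>k\<close>,
  \<open>b\<close> and \<open>D\<close>, hence they branch in parallel;
  \<open>M \<subseteq> {..<v}\<close> makes \<open>v\<close> a fresh element.\<close>

lemma sum_signed_count:
  assumes "M \<subseteq> {..<v}"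
  shows "(\<Sum>A\<in>Pow M. signed_count f (v, k, b, D, A)) = int (cover_count f (v, k, b, D, M))"
  using assms
proof (induction f arbitrary: v k b D M)
  case 0
  then have "finite M" by (rule finite_subset) simp
  then show ?case using card_covers[of M "{}" k] by simp
next
  case (Suc f)
  have fin: "finite M" using Suc.prems by (rule finite_subset) simp
  have M: "M \<subseteq> {..<Suc v}" "insert v M \<subseteq> {..<Suc v}" using Suc.prems by auto
  have v: "v \<notin> M" using Suc.prems by auto
  note IH = Suc.IH[OF M(1)] Suc.IH[OF M(2)]
  show ?case
  proof (cases "v \<in> D")
    case True
    then show ?thesis by (simp add: IH)
  next
    case False
    have inj: "inj_on (insert v) (Pow M)" using v by (auto simp: inj_on_def)
    have disj: "Pow M \<inter> insert v ` Pow M = {}" using v by auto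
    \<comment> \<open>The subsets of \<open>insert v M\<close> are \<open>A\<close> and
      \<open>insert v A\<close> for \<open>A \<subseteq> M\<close>, which matches the two branches
      for marking.\<close>
    have mark: "(\<Sum>A\<in>Pow M. signed_count f (Suc v, k, b - 1, D, A)
          + signed_count f (Suc v, k, b - 1, D, insert v A))
        = int (cover_count f (Suc v, k, b - 1, D, insert v M))"
      unfolding IH(2)[symmetric]
      using fin inj disj by (simp add: Pow_insert sum.union_disjoint sum.reindex sum.distrib)
    have pick: "(\<Sum>A\<in>Pow M. \<Sum>u\<leftarrow>cs. signed_count f (pick (v, k, b, D, A) u))
        = int (\<Sum>u\<leftarrow>cs. cover_count f (pick (v, k, b, D, M) u))" for cs
      by (induction cs) (simp_all add: sum.distrib, simp add: pick_def IH)
    have "(\<Sum>A\<in>Pow M. signed_count (Suc f) (v, k, b, D, A))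
      = (\<Sum>A\<in>Pow M. (if 0 < b then signed_count f (Suc v, k, b - 1, D, A)
            + signed_count f (Suc v, k, b - 1, D, insert v A) else 0)
          + (if 0 < k \<and> d \<le> b
             then \<Sum>u\<leftarrow>cands v. signed_count f (pick (v, k, b, D, A) u) else 0))"
      using False by (intro sum.cong) (auto simp: comp_def)
    also have "\<dots> = int (cover_count (Suc f) (v, k, b, D, M))"
      using False mark pick[of "cands v"] by (auto simp: sum.distrib)
    finally show ?thesis .
  qed
qed

section \<open>Soundness and completeness of the branching\<close>

lemma set_cands: "set (cands v) = {u. first_cand v \<le> u \<and> u < n \<and> a v u}"
  by (auto simp: cands_def)

text \<open>No branch loses a vertex: a skipped one is in \<open>D\<close>, a marked one is handed
  to the tuple at the leaf, and a candidate picked for \<open>v\<close> dominates \<open>v\<close>.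
  The set \<open>T\<close> consists of the leaf tuple together with the picks made below the
  state.\<close>

lemma cover_count_sound:
  assumes "0 < cover_count f (v, k, b, D, M)" "v + f = n"
  shows "\<exists>T \<subseteq> {..<n}. card T \<le> k \<and> (\<forall>x \<in> M \<union> ({v..<n} - D). \<exists>u\<in>T. a u x)"
  using assms
proof (induction f arbitrary: v k b D M)
  case 0
  then have "covers k M {} \<noteq> {}" by auto
  then obtain xs where xs: "length xs = k" "set xs \<subseteq> {..<n}" "\<forall>x\<in>M. \<exists>u\<in>set xs. a u x"
    by (auto simp: covers_def avoiders_def)
  then show ?case using 0 by (intro exI[of _ "set xs"]) (auto simp: card_length)
next
  case (Suc f)
  have vf: "Suc v + f = n" using Suc.prems by simp
  consider (skip) "v \<in> D" "0 < cover_count f (Suc v, k, b, D, M)"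
    | (mark) "0 < cover_count f (Suc v, k, b - 1, D, insert v M)"
    | (pick) u where "0 < k" "u \<in> set (cands v)"
        "0 < cover_count f (Suc v, k - 1, b - d, D \<union> {x. a u x}, M)"
    using Suc.prems(1)
    unfolding cover_count.simps
    by (auto split: if_splits simp: pick_def sum_list_pos_iff)
  then show ?case
  proof cases
    case skip
    from Suc.IH[OF skip(2) vf] obtain T where T: "T \<subseteq> {..<n}" "card T \<le> k"
      and dom: "\<forall>x \<in> M \<union> ({Suc v..<n} - D). \<exists>u\<in>T. a u x" by blast
    have "M \<union> ({v..<n} - D) \<subseteq> M \<union> ({Suc v..<n} - D)"
      using skip by (auto simp: Suc_le_eq le_less)
    then show ?thesis using T dom by blast
  next
    case mark
    from Suc.IH[OF mark vf] obtain T where T: "T \<subseteq> {..<n}" "card T \<le> k"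
      and dom: "\<forall>x \<in> insert v M \<union> ({Suc v..<n} - D). \<exists>u\<in>T. a u x" by blast
    have "M \<union> ({v..<n} - D) \<subseteq> insert v M \<union> ({Suc v..<n} - D)"
      by (auto simp: Suc_le_eq le_less)
    then show ?thesis using T dom by blast
  next
    case (pick u)
    from Suc.IH[OF pick(3) vf] obtain T where T: "T \<subseteq> {..<n}" "card T \<le> k - 1"
      and dom: "\<forall>x \<in> M \<union> ({Suc v..<n} - (D \<union> {x. a u x})). \<exists>w\<in>T. a w x" by blast
    have u: "u < n" "a u v" using pick(2) sym by (auto simp: set_cands)
    have "\<exists>w\<in>insert u T. a w x" if "x \<in> M \<union> ({v..<n} - D)" for x
    proof (cases "a u x")
      case False
      then have "x \<noteq> v" using u by auto
      then have "x \<in> M \<union> ({Suc v..<n} - (D \<union> {x. a u x}))"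
        using that False by auto
      then show ?thesis using dom by blast
    qed auto
    moreover have "card (insert u T) \<le> k"
      using T pick(1) card_insert_le_m1[of k T u] by simp
    ultimately show ?thesis using T u by (intro exI[of _ "insert u T"]) auto
  qed
qed

lemma card_later_le: "v < n \<Longrightarrow> card (later v) \<le> d"
  using later_degree by (simp add: later_def)

text \<open>This is the origin of the budget: a vertex of \<open>T\<close> dominates at most
  \<open>d\<close> vertices that come after it.\<close>

lemma card_dominated_by_earlier:
  assumes T: "T \<subseteq> {..<n}" and M: "M \<subseteq> {..<n}" "\<forall>x\<in>M. \<exists>u\<in>T. u < x \<and> a u x"
  shows "card M \<le> d * card T"
proof -
  have fin: "finite T" using T by (rule finite_subset) simp
  have "M \<subseteq> (\<Union>u\<in>T. later u)" using M by (auto simp: later_def)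
  then have "card M \<le> card (\<Union>u\<in>T. later u)"
    by (rule card_mono[rotated]) (use fin in \<open>auto simp: later_def\<close>)
  also have "\<dots> \<le> (\<Sum>u\<in>T. card (later u))" using fin by (rule card_UN_le)
  also have "\<dots> \<le> (\<Sum>u\<in>T. d)" using T by (intro sum_mono card_later_le) auto
  finally show ?thesis by (simp add: mult.commute)
qed

text \<open>A solution guides the branching. \<open>T\<close> contains its vertices not yet used up
  by a pick; every marked vertex is dominated by an earlier member of \<open>T\<close>, and
  \<open>b\<close> is exactly \<open>d * k\<close> minus the number of marked vertices. These
  invariants show that the branch chosen is never cut by the budget.\<close>

lemma cover_count_complete:
  assumes "0 < n" "v + f = n" "T \<subseteq> {..<n}" "card T \<le> k" "M \<subseteq> {..<v}"
    and "\<forall>x\<in>M. \<exists>u\<in>T. u < x \<and> a u x"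
    and "\<forall>x\<in>{v..<n} - D. \<exists>u\<in>T. a u x"
    and "b + card M = d * k"
  shows "0 < cover_count f (v, k, b, D, M)"
  using assms(2-)
proof (induction f arbitrary: v k b D M T)
  case 0
  have fin: "finite T" using 0(2) by (rule finite_subset) simp
  obtain ys where ys: "set ys = T" "length ys = card T"
    using finite_distinct_list[OF fin] distinct_card by metis
  \<comment> \<open>Tuples have length exactly \<open>k\<close>, so a smaller solution is padded
    with the vertex 0, which exists since \<open>0 < n\<close>.\<close>
  define xs where "xs = ys @ replicate (k - card T) 0"
  have "xs \<in> covers k M {}"
  proof -
    have "length xs = k" using 0(3) ys by (simp add: xs_def)
    moreover have "set xs \<subseteq> avoiders {}"
      using 0(2) ys \<open>0 < n\<close> by (auto simp: xs_def avoiders_def)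
    moreover have "\<forall>x\<in>M. \<exists>u\<in>set xs. a u x" using 0(5) ys by (fastforce simp: xs_def)
    ultimately show ?thesis by (simp add: covers_def)
  qed
  then have "covers k M {} \<noteq> {}" by blast
  then show ?case by (simp add: card_gt_0_iff)
next
  case (Suc f)
  have vf: "Suc v + f = n" and v: "v < n" using Suc.prems by auto
  have fin: "finite T" "finite M" using Suc.prems(2,4) by (auto intro: finite_subset)
  have M: "M \<subseteq> {..<n}" "M \<subseteq> {..<Suc v}" "insert v M \<subseteq> {..<Suc v}" "insert v M \<subseteq> {..<n}" "v \<notin> M"
    using Suc.prems(4) v by auto
  show ?case
  proof (cases "v \<in> D")
    case True
    have "0 < cover_count f (Suc v, k, b, D, M)"
    proof (rule Suc.IH[OF vf Suc.prems(2,3) M(2) Suc.prems(5) _ Suc.prems(7)], rule ballI)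
      fix x assume "x \<in> {Suc v..<n} - D"
      then have "x \<in> {v..<n} - D" by auto
      then show "\<exists>u\<in>T. a u x" using Suc.prems(6) by blast
    qed
    then show ?thesis using True by simp
  next
    case False
    \<comment> \<open>An exchange: the solution vertex \<open>t\<close> is given up and the
      candidate \<open>u\<close> is picked in its place. A marked \<open>x < v\<close> has a
      dominator below \<open>x\<close>, hence different from \<open>t \<ge> v\<close>, so the marked
      vertices are still dominated by \<open>T - {t}\<close>. There are then at most
      \<open>d * (k - 1)\<close> of them, which gives \<open>d \<le> b\<close>.\<close>
    have remove: "0 < cover_count (Suc f) (v, k, b, D, M)"
      if t: "t \<in> T" "v \<le> t" and u: "u \<in> set (cands v)"
        and dom: "\<And>x. x \<in> {Suc v..<n} - D \<Longrightarrow> \<not> a u x \<Longrightarrow> \<exists>w\<in>T - {t}. a w x" for t u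
    proof -
      have "card T = Suc (card (T - {t}))" using card_Suc_Diff1[OF fin(1) t(1)] by simp
      then have k: "0 < k" "card (T - {t}) \<le> k - 1" using Suc.prems(3) by auto
      have M': "\<forall>x\<in>M. \<exists>u\<in>T - {t}. u < x \<and> a u x"
      proof
        fix x assume x: "x \<in> M"
        then have "x < v" using Suc.prems(4) by auto
        moreover obtain u where "u \<in> T" "u < x" "a u x" using Suc.prems(5) x by blast
        ultimately show "\<exists>u\<in>T - {t}. u < x \<and> a u x" using t(2) by (intro bexI[of _ u]) auto
      qed
      have "card M \<le> d * card (T - {t})"
        using Suc.prems(2) M M' by (intro card_dominated_by_earlier) auto
      also have "\<dots> \<le> d * (k - 1)" using k by simp
      finally have cM: "card M \<le> d * (k - 1)" .
      have dk: "d * k = d * (k - 1) + d" using k by (cases k) auto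
      have b: "d \<le> b" "b - d + card M = d * (k - 1)" using cM dk Suc.prems(7) by auto
      have "0 < cover_count f (Suc v, k - 1, b - d, D \<union> {x. a u x}, M)"
      proof (rule Suc.IH[OF vf _ k(2) M(2) M' _ b(2)])
        show "T - {t} \<subseteq> {..<n}" using Suc.prems(2) by auto
        show "\<forall>x\<in>{Suc v..<n} - (D \<union> {x. a u x}). \<exists>w\<in>T - {t}. a w x" using dom by blast
      qed
      then have "0 < (\<Sum>u\<leftarrow>cands v. cover_count f (pick (v, k, b, D, M) u))"
        unfolding sum_list_pos_iff using u by (intro bexI[of _ u]) (simp_all add: pick_def)
      then show ?thesis using False k b by simp
    qed
    consider (after) u where "u \<in> T" "v < u" "a u v"
      | (self) "v \<in> T"
      | (before) u where "u \<in> T" "u < v" "a u v"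
      using Suc.prems(6) v False by (metis DiffI atLeastLessThan_iff order.refl nat_neq_iff)
    then show ?thesis
    proof cases
      case after
      then have "u \<in> set (cands v)" using Suc.prems(2) by (auto simp: set_cands first_cand_def intro: sym)
      moreover have "\<exists>w\<in>T - {u}. a w x" if "x \<in> {Suc v..<n} - D" "\<not> a u x" for x
      proof -
        have "x \<in> {v..<n} - D" using that by auto
        then obtain w where "w \<in> T" "a w x" using Suc.prems(6) by blast
        then show ?thesis using that by (intro bexI[of _ w]) auto
      qed
      ultimately show ?thesis using after by (intro remove[of u u]) auto
    next
      case self
      show ?thesis
      proof (cases "card (later v) = 1")
        case True
        then obtain u where u: "later v = {u}" by (auto simp: card_1_singleton_iff)
        then have "u \<in> later v" by simp
        then have u': "u \<in> set (cands v)" using True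
          unfolding set_cands first_cand_def later_def by simp
        show ?thesis
        proof (rule remove[OF self _ u'])
          fix x assume x: "x \<in> {Suc v..<n} - D" "\<not> a u x"
          \<comment> \<open>The exchange of \<open>v\<close> for its only later neighbour
            \<open>u\<close>: whatever \<open>v\<close> dominates after itself is \<open>u\<close>,
            and \<open>u\<close> dominates itself.\<close>
          have "\<not> a v x"
          proof
            assume "a v x"
            then have "x \<in> later v" using x by (auto simp: later_def)
            then show False using u x(2) refl by auto
          qed
          moreover have "x \<in> {v..<n} - D" using x by auto
          then obtain w where "w \<in> T" "a w x" using Suc.prems(6) by blast
          ultimately show "\<exists>w\<in>T - {v}. a w x" by (intro bexI[of _ w]) auto
        qed simp
      next
        case False
        then have "v \<in> set (cands v)" using v refl by (simp add: set_cands first_cand_def)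
        moreover have "\<exists>w\<in>T - {v}. a w x" if "x \<in> {Suc v..<n} - D" "\<not> a v x" for x
        proof -
          have "x \<in> {v..<n} - D" using that by auto
          then obtain w where "w \<in> T" "a w x" using Suc.prems(6) by blast
          then show ?thesis using that by (intro bexI[of _ w]) auto
        qed
        ultimately show ?thesis using self by (intro remove[of v v]) auto
      qed
    next
      case before
      have M': "\<forall>x\<in>insert v M. \<exists>u\<in>T. u < x \<and> a u x" using before Suc.prems(5) by auto
      \<comment> \<open>The bound on the marked vertices already holds with \<open>v\<close>
        included, so the budget is not yet exhausted.\<close>
      have "card (insert v M) \<le> d * card T"
        using Suc.prems(2) M M' by (intro card_dominated_by_earlier) auto
      also have "\<dots> \<le> d * k" using Suc.prems(3) by simp
      finally have "Suc (card M) \<le> d * k" using M fin by simp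
      then have b: "0 < b" "b - 1 + card (insert v M) = d * k" using M fin Suc.prems(7) by auto
      have "0 < cover_count f (Suc v, k, b - 1, D, insert v M)"
      proof (rule Suc.IH[OF vf Suc.prems(2,3) M(3) M' _ b(2)], rule ballI)
        fix x assume "x \<in> {Suc v..<n} - D"
        then have "x \<in> {v..<n} - D" by auto
        then show "\<exists>u\<in>T. a u x" using Suc.prems(6) by blast
      qed
      then show ?thesis using False b by simp
    qed
  qed
qed

text \<open>At the root nothing is marked, so the sum over subsets of the marked set has a single
  term. The signed count is therefore a natural number, positive exactly if some branch has a
  covering tuple.\<close>

theorem signed_count_pos_iff:
  assumes "0 < n"
  shows "0 < signed_count n (0, k, d * k, {}, {}) \<longleftrightarrow>
    (\<exists>T \<subseteq> {..<n}. card T \<le> k \<and> (\<forall>x<n. \<exists>u\<in>T. a u x))"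
proof -
  have eq: "signed_count n (0, k, d * k, {}, {}) = int (cover_count n (0, k, d * k, {}, {}))"
    using sum_signed_count[of "{}" 0 n k "d * k" "{}"] by simp
  show ?thesis
    using cover_count_sound[of n 0 k "d * k" "{}" "{}"]
      cover_count_complete[OF assms, of 0 n _ k "{}" "{}" "d * k"]
    unfolding eq by (simp add: Ball_def) blast
qed

text \<open>A bound for the number of states in the branching tree below a state: at most
  \<open>3 ^ b\<close> for each of the levels \<open>v\<close> to \<open>n\<close>.\<close>

definition weight :: "state \<Rightarrow> nat" where
  "weight = (\<lambda>(v, k, b, D, A). (n + 1 - v) * 3 ^ b)"

text \<open>With at least two later neighbours \<open>3 * (d + 1) \<le> 3 ^ d\<close> applies, an
  equality at \<open>d = 2\<close>; with one or none there is a single candidate. The maximum with 1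
  covers \<open>d = 0\<close>, where the candidate is \<open>v\<close> itself.\<close>

lemma length_cands: "v < n \<Longrightarrow> 3 * length (cands v) \<le> 3 ^ max 1 d"
proof -
  assume v: "v < n"
  have le: "card (later v) \<le> d" using v by (rule card_later_le)
  have fin: "finite (later v)" by (simp add: later_def)
  have len: "length (cands v) = card (set (cands v))"
    by (rule distinct_card[symmetric]) (simp add: cands_def)
  have pow: "3 * Suc d \<le> 3 ^ d" if "2 \<le> d" for d :: nat
    using that by (induction d rule: dec_induct) auto
  show ?thesis
  proof (cases "card (later v) = 1")
    case True
    have "set (cands v) = later v" using True by (auto simp: set_cands first_cand_def later_def)
    then have "length (cands v) = 1" using True len by simp
    moreover have "(3::nat) ^ 1 \<le> 3 ^ max 1 d" by (rule power_increasing) auto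
    ultimately show ?thesis by simp
  next
    case False
    have "set (cands v) = insert v (later v)"
      using False v refl by (auto simp: set_cands first_cand_def later_def)
    then have l: "length (cands v) = Suc (card (later v))"
      using len fin by (simp add: later_def)
    show ?thesis
    proof (cases "card (later v) = 0")
      case True
      moreover have "(3::nat) ^ 1 \<le> 3 ^ max 1 d" by (rule power_increasing) auto
      ultimately show ?thesis using l by simp
    next
      case nz: False
      then have "2 \<le> d" using False le by auto
      then show ?thesis using pow[of d] l le by (simp add: max_def)
    qed
  qed
qed

text \<open>With \<open>c = n - v\<close> the children weigh at most \<open>c * 3 ^ b\<close>: two
  thirds of it for marking, one third for the picks. The remaining \<open>3 ^ b\<close> pays for the
  state itself. If \<open>d = 0\<close>, picks do not lower the budget, so they must not compete
  with marking; \<open>b = 0\<close> rules marking out.\<close>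

lemma weight_children:
  assumes "v < n" "d = 0 \<Longrightarrow> b = 0"
  shows "Suc (\<Sum>c\<leftarrow>children (v, k, b, D, A). weight c) \<le> weight (v, k, b, D, A)"
proof -
  define c where "c = n - v"
  have c: "Suc n - v = Suc c" "n - v = c" using assms by (auto simp: c_def)
  have p: "(1::nat) \<le> 3 ^ b" by simp
  have pick: "(\<Sum>u\<leftarrow>us. weight (pick (v, k, b, D, A) u)) = length us * (c * 3 ^ (b - d))" for us
    by (induction us) (auto simp: pick_def weight_def c)
  \<comment> \<open>The factor 3 stands for the third of \<open>3 ^ b\<close> that the two marking
    branches leave over.\<close>
  have pick2: "3 * (\<Sum>u\<leftarrow>cands v. weight (pick (v, k, b, D, A) u)) \<le> c * 3 ^ b" if "d \<le> b" "0 < d"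
  proof -
    have "3 * length (cands v) \<le> 3 ^ d" using length_cands[OF assms(1)] that by (simp add: max_def)
    then have "3 * length (cands v) * (c * 3 ^ (b - d)) \<le> 3 ^ d * (c * 3 ^ (b - d))"
      by (rule mult_le_mono1)
    also have "\<dots> = c * 3 ^ b" using that by (simp flip: power_add)
    finally show ?thesis unfolding pick by simp
  qed
  define ws where "ws = (\<Sum>u\<leftarrow>cands v. weight (pick (v, k, b, D, A) u))"
  have w: "weight (Suc v, k', b', D, A') = c * 3 ^ b'" for k' b' A' by (simp add: weight_def c)
  have eq: "(\<Sum>c\<leftarrow>children (v, k, b, D, A). weight c) =
      (if v \<in> D then c * 3 ^ b
       else (if 0 < b then 2 * (c * 3 ^ (b - 1)) else 0) + (if 0 < k \<and> d \<le> b then ws else 0))"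
    by (auto simp: w comp_def ws_def)
  have wt: "weight (v, k, b, D, A) = 3 ^ b + c * 3 ^ b" by (simp add: weight_def c)
  consider "v \<in> D" | "v \<notin> D" "b = 0" "d = 0" | "v \<notin> D" "b = 0" "0 < d" | b' where "v \<notin> D" "b = Suc b'"
    by (cases b) auto
  then show ?thesis
  proof cases
    case 1
    then show ?thesis unfolding eq wt using p by simp
  next
    case 2
    have "length (cands v) \<le> 1" using length_cands[OF assms(1)] 2 by simp
    then have "ws \<le> c" unfolding ws_def pick using 2
      by (cases "length (cands v)") auto
    then show ?thesis unfolding eq wt using 2 by simp
  next
    case 3
    then show ?thesis unfolding eq wt by simp
  next
    case 4
    then have "(if 0 < k \<and> d \<le> b then ws else 0) \<le> c * 3 ^ b'"
      using pick2 assms(2) unfolding ws_def by auto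
    then show ?thesis unfolding eq wt using 4 p by (auto simp del: One_nat_def)
  qed
qed

end

subsection \<open>Verification conditions for the random access machine\<close>

text \<open>
  \<open>u\<close> counts steps. All registers and memory cells stay below \<open>2 ^ L\<close>, so one step costs at most
  \<open>2 * L + 1\<close>.
\<close>

definition bounded :: "nat \<Rightarrow> config \<Rightarrow> bool" where
  "bounded L s \<longleftrightarrow> (\<forall>i. fst s i < 2 ^ L) \<and> (\<forall>i. snd s i < 2 ^ L)"

definition wp :: "nat \<Rightarrow> ram \<Rightarrow> (nat \<Rightarrow> config \<Rightarrow> bool) \<Rightarrow> config \<Rightarrow> bool" where
  "wp L P Q s \<longleftrightarrow> (bounded L s \<longrightarrow>
    (\<exists>t s' u. exec P s t s' \<and> t \<le> u * (2 * L + 1) \<and> bounded L s' \<and> Q u s'))"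

lemma len_le: "x < 2 ^ L \<Longrightarrow> len x \<le> L"
  by (rule floorlog_leI) auto

lemma wpI:
  assumes "bounded L s \<Longrightarrow> exec P s t s' \<and> t \<le> u * (2 * L + 1) \<and> bounded L s'" "Q u s'"
  shows "wp L P Q s"
  using assms unfolding wp_def by blast

lemma wp_mono:
  assumes "wp L P Q s" "\<And>u s'. Q u s' \<Longrightarrow> Q' u s'"
  shows "wp L P Q' s"
  using assms unfolding wp_def by blast

lemma wp_Skip: "Q 1 s \<Longrightarrow> wp L Skip Q s"
  by (rule wpI[where t=1 and u=1]) (auto intro: exec.intros[simplified])

text \<open>Only \<open>Const\<close> and \<open>Add\<close> can create a number larger than those
  present, so only they carry a side condition about \<open>2 ^ L\<close>.\<close>

lemma wp_Const: "c < 2 ^ L \<Longrightarrow> Q 1 (r(i := c), m) \<Longrightarrow> wp L (Const i c) Q (r, m)"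
  by (rule wpI[where t=1 and u=1]) (auto intro: exec.intros[simplified] simp: bounded_def)

lemma wp_Add: "r j + r l < 2 ^ L \<Longrightarrow> Q 1 (r(i := r j + r l), m) \<Longrightarrow> wp L (Add i j l) Q (r, m)"
  by (rule wpI[where t="1 + len (r j) + len (r l)" and u=1])
    (auto intro: exec.intros[simplified] simp: bounded_def mult_2 intro!: add_mono len_le)

lemma wp_Sub: "Q 1 (r(i := r j - r l), m) \<Longrightarrow> wp L (Sub i j l) Q (r, m)"
  by (rule wpI[where t="1 + len (r j) + len (r l)" and u=1])
    (auto intro: exec.intros[simplified] simp: bounded_def mult_2 less_imp_diff_less intro!: add_mono len_le)

lemma wp_Load: "Q 1 (r(i := m (r j)), m) \<Longrightarrow> wp L (Load i j) Q (r, m)"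
  by (rule wpI[where t="1 + len (r j) + len (m (r j))" and u=1])
    (auto intro: exec.intros[simplified] simp: bounded_def mult_2 intro!: add_mono len_le)

lemma wp_Store: "Q 1 (r, m(r i := r j)) \<Longrightarrow> wp L (Store i j) Q (r, m)"
  by (rule wpI[where t="1 + len (r i) + len (r j)" and u=1])
    (auto intro: exec.intros[simplified] simp: bounded_def mult_2 intro!: add_mono len_le)

lemma wp_Seq:
  assumes "wp L P1 (\<lambda>u. wp L P2 (\<lambda>u'. Q (u + u'))) s"
  shows "wp L (Seq P1 P2) Q s"
  unfolding wp_def
proof
  assume "bounded L s"
  with assms obtain t s' u where 1: "exec P1 s t s'" "t \<le> u * (2 * L + 1)" "bounded L s'"
    "wp L P2 (\<lambda>u'. Q (u + u')) s'" unfolding wp_def[of L P1] by blast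
  then obtain t' s'' u' where 2: "exec P2 s' t' s''" "t' \<le> u' * (2 * L + 1)" "bounded L s''"
    "Q (u + u') s''" unfolding wp_def by blast
  have "t + t' \<le> (u + u') * (2 * L + 1)" using 1 2 by (simp add: algebra_simps)
  then show "\<exists>t s' u. exec (Seq P1 P2) s t s' \<and> t \<le> u * (2 * L + 1) \<and> bounded L s' \<and> Q u s'"
    using exec.Seq[OF 1(1) 2(1)] 2 by blast
qed

lemma wp_If:
  assumes "r i \<noteq> 0 \<Longrightarrow> wp L P1 (\<lambda>u. Q (Suc u)) (r, m)"
    and "r i = 0 \<Longrightarrow> wp L P2 (\<lambda>u. Q (Suc u)) (r, m)"
  shows "wp L (If i P1 P2) Q (r, m)"
  unfolding wp_def
proof
  assume b: "bounded L (r, m)"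
  have l: "len (r i) \<le> L" using b by (auto simp: bounded_def intro: len_le)
  obtain P where P: "wp L P (\<lambda>u. Q (Suc u)) (r, m)"
    and ex: "\<And>t s. exec P (r, m) t s \<Longrightarrow> exec (If i P1 P2) (r, m) (1 + len (r i) + t) s"
    using assms exec.IfTrue[of r i P1 m _ _ P2] exec.IfFalse[of r i P2 m _ _ P1] by metis
  from P b obtain t s' u where 1: "exec P (r, m) t s'" "t \<le> u * (2 * L + 1)" "bounded L s'"
    "Q (Suc u) s'" unfolding wp_def by blast
  have "1 + len (r i) + t \<le> Suc u * (2 * L + 1)" using 1 l by simp
  then show "\<exists>t s' u. exec (If i P1 P2) (r, m) t s' \<and> t \<le> u * (2 * L + 1) \<and> bounded L s' \<and> Q u s'"
    using ex[OF 1(1)] 1 by blast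
qed

lemma wp_While_False:
  assumes "r i = 0" "Q 1 (r, m)"
  shows "wp L (While i P) Q (r, m)"
  by (rule wpI[where t="1 + len (r i)" and u=1])
    (use assms exec.WhileFalse[of r i P m] in \<open>simp_all add: bounded_def floorlog_def\<close>)

lemma wp_While_True:
  assumes "r i \<noteq> 0" "wp L P (\<lambda>u. wp L (While i P) (\<lambda>u'. Q (Suc (u + u')))) (r, m)"
  shows "wp L (While i P) Q (r, m)"
  unfolding wp_def
proof
  assume b: "bounded L (r, m)"
  have l: "len (r i) \<le> L" using b by (auto simp: bounded_def intro: len_le)
  from assms(2) b obtain t s' u where 1: "exec P (r, m) t s'" "t \<le> u * (2 * L + 1)" "bounded L s'"
    "wp L (While i P) (\<lambda>u'. Q (Suc (u + u'))) s'"
    unfolding wp_def[of L P] by blast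
  then obtain t' s'' u' where 2: "exec (While i P) s' t' s''" "t' \<le> u' * (2 * L + 1)" "bounded L s''"
    "Q (Suc (u + u')) s''" unfolding wp_def by blast
  have "1 + len (r i) + t + t' \<le> Suc (u + u') * (2 * L + 1)" using 1 2 l by (simp add: algebra_simps)
  then show "\<exists>t s' u. exec (While i P) (r, m) t s' \<and> t \<le> u * (2 * L + 1) \<and> bounded L s' \<and> Q u s'"
    using exec.WhileTrue[OF assms(1) 1(1) 2(1)] 2 by blast
qed

text \<open>Straight-line code is executed symbolically by unfolding these equations. A loop is left
  as \<open>wp\<close> and is later discharged through an invariant.\<close>

fun vc :: "nat \<Rightarrow> ram \<Rightarrow> (nat \<Rightarrow> config \<Rightarrow> bool) \<Rightarrow> config \<Rightarrow> bool" where
  "vc L Skip Q s = Q 1 s"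
| "vc L (Const i c) Q (r, m) = (c < 2 ^ L \<and> Q 1 (r(i := c), m))"
| "vc L (Add i j l) Q (r, m) = (r j + r l < 2 ^ L \<and> Q 1 (r(i := r j + r l), m))"
| "vc L (Sub i j l) Q (r, m) = Q 1 (r(i := r j - r l), m)"
| "vc L (Load i j) Q (r, m) = Q 1 (r(i := m (r j)), m)"
| "vc L (Store i j) Q (r, m) = Q 1 (r, m(r i := r j))"
| "vc L (Seq P1 P2) Q s = vc L P1 (\<lambda>u. vc L P2 (\<lambda>u'. Q (u + u'))) s"
| "vc L (If i P1 P2) Q (r, m) =
    (if r i \<noteq> 0 then vc L P1 (\<lambda>u. Q (Suc u)) (r, m) else vc L P2 (\<lambda>u. Q (Suc u)) (r, m))"
| "vc L (While i P) Q s = wp L (While i P) Q s"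

lemma vc_mono: "vc L P Q s \<Longrightarrow> (\<And>u s'. Q u s' \<Longrightarrow> Q' u s') \<Longrightarrow> vc L P Q' s"
proof (induction P arbitrary: Q Q' s)
  case (Seq P1 P2)
  have "vc L P1 (\<lambda>u. vc L P2 (\<lambda>u'. Q (u + u'))) s" using Seq.prems(1) by simp
  then have "vc L P1 (\<lambda>u. vc L P2 (\<lambda>u'. Q' (u + u'))) s"
    by (rule Seq.IH(1)) (erule Seq.IH(2), rule Seq.prems(2))
  then show ?case by simp
next
  case (If i P1 P2)
  show ?case using If.prems by (cases s) (auto intro: If.IH)
next
  case (While i P)
  then show ?case by (auto intro: wp_mono)
qed (cases s; auto)+

lemma vc_imp_wp: "vc L P Q s \<Longrightarrow> wp L P Q s"
proof (induction P arbitrary: Q s)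
  case (Seq P1 P2)
  show ?case using Seq.prems by (auto intro!: wp_Seq intro: wp_mono Seq.IH)
next
  case (If i P1 P2)
  show ?case using If.prems by (cases s) (auto intro!: wp_If intro: If.IH split: if_splits)
qed (cases s; auto intro: wp_Skip wp_Const wp_Add wp_Sub wp_Load wp_Store)+

text \<open>Register 3 holds the constant 1 throughout, and \<open>x\<close> is a scratch register for the test.\<close>

definition For :: "nat \<Rightarrow> nat \<Rightarrow> nat \<Rightarrow> ram \<Rightarrow> ram" where
  "For i x l P = Seq (Sub x l i) (While x (Seq P (Seq (Add i i 3) (Sub x l i))))"

text \<open>Each round costs the body plus three steps: the test, the increment and the new
  difference. The additive 2 is the first difference and the failing test. The increment belongs to
  the loop, so the body leaves the counter alone and establishes the invariant for the counter
  already advanced.\<close>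

lemma vc_For:
  assumes inv: "I (r i) (r, m)" and le: "r i \<le> N" and l: "r l = N"
    and N: "N < 2 ^ L"
    and frame: "\<And>j r m y. I j (r, m) \<Longrightarrow> I j (r(x := y), m)"
    and body: "\<And>r m j. I j (r, m) \<Longrightarrow> j < N \<Longrightarrow> r i = j \<Longrightarrow> r l = N \<Longrightarrow>
       vc L P (\<lambda>u (r', m'). u \<le> \<tau> \<and> r' i = j \<and> r' l = N \<and> r' 3 = 1 \<and> I (Suc j) (r'(i := Suc j), m')) (r, m)"
    and regs: "x \<noteq> i" "x \<noteq> l" "i \<noteq> l"
    and Q: "\<And>u r' m'. u \<le> (N - r i) * (\<tau> + 3) + 2 \<Longrightarrow> r' i = N \<Longrightarrow> r' l = N \<Longrightarrow> I N (r', m') \<Longrightarrow> Q u (r', m')"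
  shows "vc L (For i x l P) Q (r, m)"
proof -
  have loop: "wp L (While x (Seq P (Seq (Add i i 3) (Sub x l i))))
      (\<lambda>u (r', m'). u \<le> c * (\<tau> + 3) + 1 \<and> r' i = N \<and> r' l = N \<and> I N (r', m')) (r, m)"
    if "I j (r, m)" "r i = j" "r l = N" "r x = N - j" "j + c = N" for j r m c
    using that
  proof (induction c arbitrary: j r m)
    case 0
    then show ?case by (intro wp_While_False) auto
  next
    case (Suc c)
    show ?case
    proof (rule wp_While_True)
      show "r x \<noteq> 0" using Suc.prems by auto
      show "wp L (Seq P (Seq (Add i i 3) (Sub x l i))) (\<lambda>u. wp L (While x (Seq P (Seq (Add i i 3) (Sub x l i))))
         (\<lambda>u' (r', m'). Suc (u + u') \<le> Suc c * (\<tau> + 3) + 1 \<and> r' i = N \<and> r' l = N \<and> I N (r', m'))) (r, m)"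
      proof (rule wp_Seq, rule wp_mono[OF vc_imp_wp[OF body[OF Suc.prems(1)]]], goal_cases)
        case (4 u s)
        obtain r' m' where s: "s = (r', m')" by (cases s)
        from 4 s have a: "u \<le> \<tau>" "r' i = j" "r' l = N" "r' 3 = 1" "I (Suc j) (r'(i := Suc j), m')"
          by auto
        have st: "(r'(i := r' i + r' 3))(x := (r'(i := r' i + r' 3)) l - (r'(i := r' i + r' 3)) i)
            = r'(i := Suc j, x := N - Suc j)"
          using a regs by (simp add: fun_eq_iff)
        have "wp L (While x (Seq P (Seq (Add i i 3) (Sub x l i))))
          (\<lambda>u' (r', m'). u' \<le> c * (\<tau> + 3) + 1 \<and> r' i = N \<and> r' l = N \<and> I N (r', m'))
          (r'(i := Suc j, x := N - Suc j), m')"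
          using a Suc.prems regs by (intro Suc.IH[of "Suc j"] frame) auto
        then show ?case unfolding s using a(1,2,4) Suc.prems N
          apply (intro wp_Seq wp_Add wp_Sub)
           apply simp
          unfolding st
          apply (erule wp_mono)
          apply (auto simp: algebra_simps)
          done
      qed (use Suc.prems in auto)
    qed
  qed
  show ?thesis
    unfolding For_def vc.simps
    apply (rule wp_mono[OF loop[of "r i" _ _ "N - r i"]])
    using inv le l regs frame by (auto intro!: Q)
qed

subsection \<open>States in memory\<close>

text \<open>
  Registers: 0 answer, 1 \<open>k\<close>, 2 \<open>n\<close>, 3 the constant 1, 4 and 5 the bases of two arrays that hold, for each
  position \<open>p\<close> of the degeneracy order, the address of the matrix row of the vertex at \<open>p\<close> and that vertex
  itself, 6 the largest number of later neighbours, 7 the block size \<open>n + 3\<close>, 8 and 9 head and tail of the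
  queue of states, 10 and 11 the positive and negative part of the sum, 12 to 14 the entries
  \<open>v\<close>, \<open>k\<close>, \<open>b\<close> of the current state, 15 to 17 those of a child. The others are scratch.
\<close>

abbreviation seqs :: "ram list \<Rightarrow> ram" where
  "seqs Ps \<equiv> foldr Seq Ps Skip"

definition ADJ :: "nat \<Rightarrow> nat \<Rightarrow> ram" where
  "ADJ p q = seqs [Add 31 4 p, Load 31 31, Add 30 5 q, Load 30 30, Add 31 31 30, Load 31 31]"

definition COPY :: ram where
  "COPY = seqs [Const 20 0, For 20 21 2 (seqs [Add 24 8 20, Load 24 24, Add 25 9 20, Store 25 24]),
     Add 25 9 2, Store 25 15, Add 25 25 3, Store 25 16, Add 25 25 3, Store 25 17]"

definition PUSH :: ram where
  "PUSH = seqs [COPY, Add 9 9 7]"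

definition PUSH_MARKED :: ram where
  "PUSH_MARKED = seqs [COPY, Const 24 2, Add 25 9 12, Store 25 24, Add 9 9 7]"

definition DOMINATE :: ram where
  "DOMINATE = seqs [ADJ 18 22, If 31 (seqs [Add 25 9 22, Store 25 3]) Skip]"

text \<open>Adding a register that holds 0 serves as a register move here and below. The loop starts
  at \<open>Suc v\<close> because cells before that position encode membership in \<open>A\<close>
  in the child and must not be overwritten by domination marks.\<close>

definition PUSH_PICK :: ram where
  "PUSH_PICK = seqs [COPY, Const 24 0, Add 22 15 24,
     For 22 23 2 DOMINATE,
     Add 9 9 7]"

text \<open>\<open>RB\<close> and \<open>OB\<close> are the bases of the tables of row addresses and
  of vertices, \<open>QB\<close> that of the queue. All graph data lies below \<open>QB\<close>, so
  it survives every write to the queue.\<close>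

locale layout =
  fixes n :: nat and a :: "nat \<Rightarrow> nat \<Rightarrow> bool" and L RB OB QB :: nat
  assumes bases: "RB + n \<le> QB" "OB + n \<le> QB" "QB < 2 ^ L" "3 \<le> QB"
begin

definition adj_mem :: "(nat \<Rightarrow> nat) \<Rightarrow> bool" where
  "adj_mem m \<longleftrightarrow> (\<forall>p<n. \<forall>q<n. m (RB + p) + m (OB + q) < QB \<and>
     m (m (RB + p) + m (OB + q)) = of_bool (a p q))"

lemma adj_mem_cong:
  assumes "adj_mem m" "\<And>x. x < QB \<Longrightarrow> m' x = m x"
  shows "adj_mem m'"
proof -
  have "m' (RB + p) = m (RB + p)" "m' (OB + p) = m (OB + p)" if "p < n" for p
    using that assms(2) bases by auto
  then show ?thesis using assms unfolding adj_mem_def by simp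
qed

lemma adj_mem_upd [simp]: "QB \<le> x \<Longrightarrow> adj_mem m \<Longrightarrow> adj_mem (m(x := y))"
  by (erule adj_mem_cong) auto

text \<open>The address of a matrix entry is the row address plus the vertex that names the column.
  The 7 steps are six instructions and the closing \<open>Skip\<close>; 30 and 31 are
  scratch.\<close>

lemma vc_ADJ [simp]:
  assumes "adj_mem m" "r p < n" "r q < n" "r 4 = RB" "r 5 = OB" "p < 30" "q < 30"
  shows "vc L (ADJ p q) Q (r, m) =
    Q 7 (r(30 := m (OB + r q), 31 := of_bool (a (r p) (r q))), m)"
proof -
  have "RB + r p < 2 ^ L" "OB + r q < 2 ^ L" "m (RB + r p) + m (OB + r q) < 2 ^ L"
    "m (m (RB + r p) + m (OB + r q)) = of_bool (a (r p) (r q))"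
    using assms bases unfolding adj_mem_def by (auto intro: order.strict_trans)
  then show ?thesis using assms by (simp add: ADJ_def fun_upd_twist numeral_eq_Suc)
qed

end

locale machine = ordered_graph n d a + layout n a L RB OB QB for n d a L RB OB QB
begin

lemma vc_COPY:
  assumes "r 2 = n" "r 3 = 1" "r 8 + (n + 3) \<le> r 9" "r 9 + (n + 3) < 2 ^ L"
    and Q: "\<And>u r' m'. u \<le> 8 * n + 20 \<Longrightarrow> (\<forall>i. i \<notin> {20,21,24,25} \<longrightarrow> r' i = r i) \<Longrightarrow>
      (\<forall>x<r 9. m' x = m x) \<Longrightarrow> (\<forall>x<n. m' (r 9 + x) = m (r 8 + x)) \<Longrightarrow>
      m' (r 9 + n) = r 15 \<Longrightarrow> m' (r 9 + n + 1) = r 16 \<Longrightarrow> m' (r 9 + n + 2) = r 17 \<Longrightarrow> Q u (r', m')"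
  shows "vc L COPY Q (r, m)"
  unfolding COPY_def
  apply simp
  apply (rule vc_For[where N=n and \<tau>=5 and I="\<lambda>j (r', m'). (\<forall>i. i \<notin> {20,21,24,25} \<longrightarrow> r' i = r i) \<and>
      (\<forall>x<r 9. m' x = m x) \<and> (\<forall>x<j. m' (r 9 + x) = m (r 8 + x))"])
  using assms(1-4)
         apply (auto simp: less_Suc_eq)
  apply (rule Q)
  apply (auto simp: less_Suc_eq)
  done


text \<open>
  The cell of a vertex at or after \<open>v\<close> records domination by 0 or 1; the cell of a vertex before \<open>v\<close> is 2
  exactly if the vertex is in \<open>A\<close>, whereas 0 and 1 carry no information there.
\<close>

fun repr :: "(nat \<Rightarrow> nat) \<Rightarrow> nat \<Rightarrow> state \<Rightarrow> bool" where
  "repr m h (v, k, b, D, A) \<longleftrightarrow> v \<le> n \<and> A \<subseteq> {..<v} \<and>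
    (\<forall>x<n. if v \<le> x then m (h + x) = of_bool (x \<in> D)
           else m (h + x) \<le> 2 \<and> (m (h + x) = 2 \<longleftrightarrow> x \<in> A)) \<and>
    m (h + n) = v \<and> m (h + n + 1) = k \<and> m (h + n + 2) = b"

lemma repr_cong:
  assumes "repr m h s" "\<And>x. h \<le> x \<Longrightarrow> x < h + (n + 3) \<Longrightarrow> m' x = m x"
  shows "repr m' h s"
proof -
  obtain v k b D A where s: "s = (v, k, b, D, A)" by (cases s)
  have "m' (h + x) = m (h + x)" if "x < n" for x using that assms(2) by simp
  moreover have "m' (h + n) = m (h + n)" "m' (h + n + 1) = m (h + n + 1)" "m' (h + n + 2) = m (h + n + 2)"
    using assms(2) by auto
  ultimately show ?thesis using assms(1) unfolding s by auto
qed

text \<open>Common to all kinds of children. Passing from \<open>v\<close> to \<open>Suc v\<close>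
  changes the role of one cell: at \<open>v\<close> it recorded domination, afterwards only whether
  its value is 2 matters. An unchanged 0 or 1 thus already says that \<open>v\<close> is not in
  \<open>A'\<close>.\<close>

lemma repr_child:
  assumes h: "repr m h (v, k, b, D, A)" and v: "v < n"
    and "\<forall>x<v. m' (t + x) = m (h + x)" "\<forall>x. v < x \<longrightarrow> x < n \<longrightarrow> m' (t + x) = of_bool (x \<in> D')"
    and "m' (t + v) \<le> 2" "m' (t + v) = 2 \<longleftrightarrow> v \<in> A'" "A' = A \<or> A' = insert v A"
    and "m' (t + n) = Suc v" "m' (t + n + 1) = k'" "m' (t + n + 2) = b'"
  shows "repr m' t (Suc v, k', b', D', A')"
proof -
  have A: "A \<subseteq> {..<v}" using h by simp
  have "m' (t + x) \<le> 2 \<and> (m' (t + x) = 2 \<longleftrightarrow> x \<in> A')" if "x < v" for x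
  proof -
    have "m (h + x) \<le> 2 \<and> (m (h + x) = 2 \<longleftrightarrow> x \<in> A)" using h that v by (auto split: if_splits)
    moreover have "x \<in> A' \<longleftrightarrow> x \<in> A" using assms(7) that by auto
    ultimately show ?thesis using assms(3) that by simp
  qed
  moreover have "A' \<subseteq> {..<Suc v}" using assms(7) A by auto
  moreover have "if Suc v \<le> x then m' (t + x) = of_bool (x \<in> D')
      else m' (t + x) \<le> 2 \<and> (m' (t + x) = 2 \<longleftrightarrow> x \<in> A')" if "x < n" for x
    using assms(4-6) calculation(1)[of x] that by (cases x v rule: linorder_cases) simp_all
  ultimately show ?thesis using v assms(8-10) by simp
qed

lemma repr_entries:
  assumes "repr m h (v, k, b, D, A)"
  shows "A \<subseteq> {..<v}" "\<And>x. v \<le> x \<Longrightarrow> x < n \<Longrightarrow> m (h + x) = of_bool (x \<in> D)"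
    "\<And>x. x < v \<Longrightarrow> m (h + x) \<le> 2" "\<And>x. x < v \<Longrightarrow> m (h + x) = 2 \<longleftrightarrow> x \<in> A"
    "v \<le> n" "m (h + n) = v" "m (h + n + 1) = k" "m (h + n + 2) = b"
  using assms by (auto split: if_splits)

declare repr.simps [simp del]

lemma vc_PUSH:
  assumes "r 2 = n" "r 3 = 1" "r 7 = n + 3" "r 8 + (n + 3) \<le> r 9" "r 9 + (n + 3) < 2 ^ L"
    and h: "repr m (r 8) (v, k, b, D, A)" "v < n" "r 15 = Suc v"
    and Q: "\<And>u r' m'. u \<le> 8 * n + 30 \<Longrightarrow> (\<forall>i. i \<notin> {9,20,21,24,25} \<longrightarrow> r' i = r i) \<Longrightarrow>
      r' 9 = r 9 + (n + 3) \<Longrightarrow> (\<forall>x<r 9. m' x = m x) \<Longrightarrow>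
      repr m' (r 9) (Suc v, r 16, r 17, D, A) \<Longrightarrow> Q u (r', m')"
  shows "vc L PUSH Q (r, m)"
  unfolding PUSH_def
  apply simp
  apply (rule vc_COPY)
  using assms(1-8)
      apply simp_all
  apply (rule Q)
      apply simp_all
  apply (rule repr_child[OF h(1,2)])
  using repr_entries[OF h(1)] h(2)
         apply auto
  done

lemma vc_PUSH_MARKED:
  assumes "r 2 = n" "r 3 = 1" "r 7 = n + 3" "r 8 + (n + 3) \<le> r 9" "r 9 + (n + 3) < 2 ^ L"
    and h: "repr m (r 8) (v, k, b, D, A)" "v < n" "r 12 = v" "r 15 = Suc v"
    and Q: "\<And>u r' m'. u \<le> 8 * n + 30 \<Longrightarrow> (\<forall>i. i \<notin> {9,20,21,24,25} \<longrightarrow> r' i = r i) \<Longrightarrow>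
      r' 9 = r 9 + (n + 3) \<Longrightarrow> (\<forall>x<r 9. m' x = m x) \<Longrightarrow>
      repr m' (r 9) (Suc v, r 16, r 17, D, insert v A) \<Longrightarrow> Q u (r', m')"
  shows "vc L PUSH_MARKED Q (r, m)"
  unfolding PUSH_MARKED_def
  apply simp
  apply (rule vc_COPY)
  using assms(1-9) bases
      apply simp_all
  apply (rule Q)
      apply simp_all
  apply (rule repr_child[OF h(1,2)])
  using repr_entries[OF h(1)] h(2)
         apply auto
  done

lemma vc_PUSH_PICK:
  assumes "r 2 = n" "r 3 = 1" "r 4 = RB" "r 5 = OB" "r 7 = n + 3" "r 8 + (n + 3) \<le> r 9"
    "r 9 + (n + 3) < 2 ^ L" "QB \<le> r 8" "adj_mem m"
    and h: "repr m (r 8) (v, k, b, D, A)" "v < n" "r 15 = Suc v" "r 18 < n"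
    and Q: "\<And>u r' m'. u \<le> 40 * n + 40 \<Longrightarrow> (\<forall>i. i \<notin> {9,20,21,22,23,24,25,30,31} \<longrightarrow> r' i = r i) \<Longrightarrow>
      r' 9 = r 9 + (n + 3) \<Longrightarrow> (\<forall>x<r 9. m' x = m x) \<Longrightarrow>
      repr m' (r 9) (Suc v, r 16, r 17, D \<union> {x. a (r 18) x}, A) \<Longrightarrow> Q u (r', m')"
  shows "vc L PUSH_PICK Q (r, m)"
proof -
  \<comment> \<open>The condition \<open>v < j\<close> ensures that the loop never touches the cell
    of \<open>v\<close> or an earlier one.\<close>
  define I where "I = (\<lambda>j (r', m'). (\<forall>i. i \<notin> {20,21,22,23,24,25,30,31} \<longrightarrow> r' i = r i) \<and>
      (\<forall>x<r 9. m' x = m x) \<and> m' (r 9 + n) = r 15 \<and> m' (r 9 + n + 1) = r 16 \<and> m' (r 9 + n + 2) = r 17 \<and>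
      v < j \<and> (\<forall>x<n. m' (r 9 + x) = (if v < x \<and> x < j \<and> a (r 18) x then 1 else m (r 8 + x))))"
  have body: "vc L DOMINATE
      (\<lambda>u (r', m'). u \<le> 20 \<and> r' 22 = j \<and> r' 2 = n \<and> r' 3 = 1 \<and> I (Suc j) (r'(22 := Suc j), m')) (r', m')"
    if inv: "I j (r', m')" and j: "j < n" "r' 22 = j" for j r' m'
  proof -
    have r': "\<forall>i. i \<notin> {20,21,22,23,24,25,30,31} \<longrightarrow> r' i = r i" using inv by (simp add: I_def)
    have "adj_mem m'" using \<open>adj_mem m\<close> inv assms(6,8) by (elim adj_mem_cong) (simp add: I_def)
    moreover have "I (Suc j) (r'', m')"
      if "\<not> a (r 18) j" "\<forall>i. i \<notin> {20,21,22,23,24,25,30,31} \<longrightarrow> r'' i = r i" for r''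
      using that inv unfolding I_def by (auto simp: less_Suc_eq)
    moreover have "I (Suc j) (r'', m'(r 9 + j := 1))"
      if "a (r 18) j" "\<forall>i. i \<notin> {20,21,22,23,24,25,30,31} \<longrightarrow> r'' i = r i" for r''
      using that inv j unfolding I_def by (auto simp: less_Suc_eq)
    ultimately show ?thesis using r' j assms(1-7) h(4) by (simp add: DOMINATE_def)
  qed
  show ?thesis
    unfolding PUSH_PICK_def
    apply simp
    apply (rule vc_COPY)
    using assms(1-7)
        apply simp_all
    subgoal for u0 r0 m0
      apply (intro conjI)
      subgoal using h bases by simp
      apply (rule vc_For[where N=n and \<tau>=20 and I=I])
      subgoal using h by (simp add: I_def)
      subgoal using h by simp
      subgoal by simp
      subgoal using bases by simp
      subgoal by (simp add: I_def)
      subgoal by (rule body)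
      subgoal by simp
      subgoal by simp
      subgoal by simp
      subgoal for u r' m'
        unfolding I_def using h(2-)
        apply simp
        apply (rule Q)
            apply simp_all
        apply (rule repr_child[OF h(1,2)])
        using repr_entries[OF h(1)]
               apply auto
        done
      done
    done
qed

end

subsection \<open>Evaluating a leaf\<close>

text \<open>Truncated subtraction of 1 leaves a nonzero value exactly for a cell equal to 2, that
  is, for a vertex of \<open>A\<close>.\<close>

definition CHECK :: ram where
  "CHECK = seqs [Add 24 8 20, Load 24 24, Sub 24 24 3, If 24 (seqs [ADJ 18 20, If 31 (Const 25 0) Skip]) Skip]"

definition AVOIDS :: ram where
  "AVOIDS = seqs [Const 25 1, Const 20 0, For 20 21 2 CHECK, Add 26 26 25]"

definition COUNT_AVOIDERS :: ram where
  "COUNT_AVOIDERS = seqs [Const 26 0, Const 18 0, For 18 19 2 AVOIDS]"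

definition FLIP :: ram where
  "FLIP = seqs [Add 24 8 20, Load 24 24, Sub 24 24 3, If 24 (Sub 27 3 27) Skip]"

definition SIGN :: ram where
  "SIGN = seqs [Const 27 0, Const 20 0, For 20 21 2 FLIP]"

text \<open>Multiplication by repeated addition is cheap enough since the factor in register 26 is a
  number of vertices.\<close>

definition MULT :: ram where
  "MULT = seqs [Const 24 0, Const 20 0, For 20 21 26 (Add 24 24 28), Const 25 0, Add 28 24 25]"

definition POWER :: ram where
  "POWER = seqs [Const 28 1, Const 18 0, For 18 19 13 MULT]"

text \<open>Registers hold natural numbers, so terms of either sign are collected separately and
  only the difference is meaningful.\<close>

definition LEAF :: ram where
  "LEAF = seqs [COUNT_AVOIDERS, SIGN, POWER, If 27 (Add 11 11 28) (Add 10 10 28)]"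

context machine
begin

lemma repr_leaf:
  assumes "repr m h (n, k, b, D, A)"
  shows "A \<subseteq> {..<n}" "x < n \<Longrightarrow> m (h + x) \<le> Suc 0 \<longleftrightarrow> x \<notin> A"
  using repr_entries[OF assms] by (fastforce simp: le_Suc_eq numeral_2_eq_2)+

lemma vc_AVOIDS:
  assumes regs: "r 2 = n" "r 3 = 1" "r 4 = RB" "r 5 = OB" "r 18 < n" "r 8 + n < 2 ^ L" "r 26 + 1 < 2 ^ L"
    and m: "adj_mem m" "repr m (r 8) (n, k, b, D, A)"
    and Q: "\<And>u r'. u \<le> 25 * n + 10 \<Longrightarrow> (\<forall>i. i \<notin> {20,21,24,25,26,30,31} \<longrightarrow> r' i = r i) \<Longrightarrow>
      r' 26 = r 26 + of_bool (r 18 \<in> avoiders A) \<Longrightarrow> Q u (r', m)"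
  shows "vc L AVOIDS Q (r, m)"
proof -
  define I where "I = (\<lambda>j (r', m'). (\<forall>i. i \<notin> {20,21,24,25,30,31} \<longrightarrow> r' i = r i) \<and> m' = m \<and>
     r' 25 = of_bool (\<forall>x\<in>A. x < j \<longrightarrow> \<not> a (r 18) x))"
  have body: "vc L CHECK (\<lambda>u (r', m'). u \<le> 20 \<and> r' 20 = j \<and> r' 2 = n \<and> r' 3 = 1 \<and>
      I (Suc j) (r'(20 := Suc j), m')) (r', m')"
    if inv: "I j (r', m')" and j: "j < n" "r' 20 = j" for j r' m'
  proof -
    have r': "\<forall>i. i \<notin> {20,21,24,25,30,31} \<longrightarrow> r' i = r i" "m' = m"
      "r' 25 = of_bool (\<forall>x\<in>A. x < j \<longrightarrow> \<not> a (r 18) x)"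
      using inv by (simp_all add: I_def)
    have keep: "I (Suc j) (r'', m)" if "\<not> (j \<in> A \<and> a (r 18) j)" "r'' 25 = r' 25"
      "\<forall>i. i \<notin> {20,21,24,25,30,31} \<longrightarrow> r'' i = r i" for r''
      using that r' unfolding I_def by (auto simp: less_Suc_eq)
    have drop: "I (Suc j) (r'', m)" if "j \<in> A" "a (r 18) j" "r'' 25 = 0"
      "\<forall>i. i \<notin> {20,21,24,25,30,31} \<longrightarrow> r'' i = r i" for r''
      using that r' unfolding I_def by (auto simp: less_Suc_eq)
    show ?thesis using r'(1,2) j regs m(1) repr_leaf(2)[OF m(2)] by (simp add: CHECK_def keep drop)
  qed
  show ?thesis
    unfolding AVOIDS_def using regs bases
    apply simp
    apply (rule vc_For[where N=n and \<tau>=20 and I=I])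
    subgoal by (simp add: I_def)
    subgoal by simp
    subgoal by simp
    subgoal by simp
    subgoal by (simp add: I_def)
    subgoal by (rule body)
    subgoal by simp
    subgoal by simp
    subgoal by simp
    subgoal for u r' m'
    proof -
      have eq: "r 18 \<in> avoiders A \<longleftrightarrow> (\<forall>x\<in>A. x < n \<longrightarrow> \<not> a (r 18) x)"
        using repr_leaf(1)[OF m(2)] regs(5) by (auto simp: avoiders_def)
      show "I n (r', m') \<Longrightarrow> u \<le> (n - (r(25 := Suc 0, 20 := 0)) 20) * (20 + 3) + 2 \<Longrightarrow> ?thesis"
        using regs(7) unfolding I_def eq[symmetric]
        apply simp
        apply (intro conjI impI; rule Q)
             apply (simp_all add: eq)
        done
    qed
    done
qed

lemma vc_COUNT_AVOIDERS:
  assumes regs: "r 2 = n" "r 3 = 1" "r 4 = RB" "r 5 = OB" "r 8 + n < 2 ^ L"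
    and m: "adj_mem m" "repr m (r 8) (n, k, b, D, A)"
    and Q: "\<And>u r'. u \<le> n * (25 * n + 13) + 5 \<Longrightarrow> (\<forall>i. i \<notin> {18,19,20,21,24,25,26,30,31} \<longrightarrow> r' i = r i) \<Longrightarrow>
      r' 26 = card (avoiders A) \<Longrightarrow> Q u (r', m)"
  shows "vc L COUNT_AVOIDERS Q (r, m)"
proof -
  define I where "I = (\<lambda>j (r', m'). (\<forall>i. i \<notin> {18,19,20,21,24,25,26,30,31} \<longrightarrow> r' i = r i) \<and> m' = m \<and>
     r' 26 = card (avoiders A \<inter> {..<j}))"
  have body: "vc L AVOIDS (\<lambda>u (r', m'). u \<le> 25 * n + 10 \<and> r' 18 = j \<and> r' 2 = n \<and> r' 3 = 1 \<and>
      I (Suc j) (r'(18 := Suc j), m')) (r', m')"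
    if inv: "I j (r', m')" and j: "j < n" "r' 18 = j" for j r' m'
  proof -
    have r': "\<forall>i. i \<notin> {18,19,20,21,24,25,26,30,31} \<longrightarrow> r' i = r i" "m' = m"
      "r' 26 = card (avoiders A \<inter> {..<j})"
      using inv by (simp_all add: I_def)
    have "card (avoiders A \<inter> {..<j}) \<le> card {..<j}" by (rule card_mono) auto
    then have le: "Suc (r' 26) < 2 ^ L" using r' j bases by auto
    have "avoiders A \<inter> {..<Suc j} = (if j \<in> avoiders A then insert j (avoiders A \<inter> {..<j}) else avoiders A \<inter> {..<j})"
      by (auto simp: less_Suc_eq)
    then have card: "card (avoiders A \<inter> {..<Suc j}) = r' 26 + of_bool (j \<in> avoiders A)"
      using r' by simp
    show ?thesis unfolding r'(2)
      apply (rule vc_AVOIDS[OF _ _ _ _ _ _ _ m(1)])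
      using r'(1) le regs j m(2) card by (simp_all add: I_def)
  qed
  show ?thesis
    unfolding COUNT_AVOIDERS_def using regs bases
    apply simp
    apply (rule vc_For[where N=n and \<tau>="25 * n + 10" and I=I])
    subgoal by (simp add: I_def)
    subgoal by simp
    subgoal by simp
    subgoal by simp
    subgoal by (simp add: I_def)
    subgoal by (rule body)
    subgoal by simp
    subgoal by simp
    subgoal by simp
    subgoal for u r' m'
    proof -
      have "avoiders A \<inter> {..<n} = avoiders A" by (auto simp: avoiders_def)
      then show "I n (r', m') \<Longrightarrow> u \<le> (n - (r(26 := 0, 18 := 0)) 18) * (25 * n + 10 + 3) + 2 \<Longrightarrow> ?thesis"
        by (auto simp: I_def algebra_simps intro!: Q)
    qed
    done
qed

lemma vc_SIGN:
  assumes regs: "r 2 = n" "r 3 = 1" "r 8 + n < 2 ^ L"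
    and m: "repr m (r 8) (n, k, b, D, A)"
    and Q: "\<And>u r'. u \<le> 15 * n + 5 \<Longrightarrow> (\<forall>i. i \<notin> {20,21,24,27} \<longrightarrow> r' i = r i) \<Longrightarrow>
      r' 27 = card A mod 2 \<Longrightarrow> Q u (r', m)"
  shows "vc L SIGN Q (r, m)"
proof -
  define I where "I = (\<lambda>j (r', m'). (\<forall>i. i \<notin> {20,21,24,27} \<longrightarrow> r' i = r i) \<and> m' = m \<and>
     r' 27 = card (A \<inter> {..<j}) mod 2)"
  have body: "vc L FLIP (\<lambda>u (r', m'). u \<le> 10 \<and> r' 20 = j \<and> r' 2 = n \<and> r' 3 = 1 \<and>
      I (Suc j) (r'(20 := Suc j), m')) (r', m')"
    if inv: "I j (r', m')" and j: "j < n" "r' 20 = j" for j r' m'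
  proof -
    have r': "\<forall>i. i \<notin> {20,21,24,27} \<longrightarrow> r' i = r i" "m' = m"
      "r' 27 = card (A \<inter> {..<j}) mod 2"
      using inv by (simp_all add: I_def)
    have *: "A \<inter> {..<Suc j} = (if j \<in> A then insert j (A \<inter> {..<j}) else A \<inter> {..<j})"
      by (auto simp: less_Suc_eq)
    have keep: "I (Suc j) (r'', m)" if "j \<notin> A" "r'' 27 = r' 27"
      "\<forall>i. i \<notin> {20,21,24,27} \<longrightarrow> r'' i = r i" for r''
      using that r' unfolding I_def by (simp add: *)
    have flip: "I (Suc j) (r'', m)" if "j \<in> A" "r'' 27 = Suc 0 - r' 27"
      "\<forall>i. i \<notin> {20,21,24,27} \<longrightarrow> r'' i = r i" for r''
      using that r' unfolding I_def by (simp add: * mod_Suc)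
    show ?thesis using r'(1,2) j regs repr_leaf(2)[OF m] by (simp add: FLIP_def keep flip)
  qed
  show ?thesis
    unfolding SIGN_def using regs bases
    apply simp
    apply (rule vc_For[where N=n and \<tau>=10 and I=I])
    subgoal by (simp add: I_def)
    subgoal by simp
    subgoal by simp
    subgoal by simp
    subgoal by (simp add: I_def)
    subgoal by (rule body)
    subgoal by simp
    subgoal by simp
    subgoal by simp
    subgoal for u r' m'
    proof -
      have "A \<inter> {..<n} = A" using repr_leaf(1)[OF m] by auto
      then show "I n (r', m') \<Longrightarrow> u \<le> (n - (r(27 := 0, 20 := 0)) 20) * (10 + 3) + 2 \<Longrightarrow> ?thesis"
        by (auto simp: I_def intro!: Q)
    qed
    done
qed

end

lemma vc_MULT:
  assumes regs: "r 3 = 1" "r 26 = c" "c * r 28 < 2 ^ L" "c < 2 ^ L"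
    and Q: "\<And>u r'. u \<le> 4 * c + 10 \<Longrightarrow> (\<forall>i. i \<notin> {20,21,24,25,28} \<longrightarrow> r' i = r i) \<Longrightarrow>
      r' 28 = c * r 28 \<Longrightarrow> Q u (r', m)"
  shows "vc L MULT Q (r, m)"
proof -
  define I where "I = (\<lambda>j (r', m'). (\<forall>i. i \<notin> {20,21,24,25} \<longrightarrow> r' i = r i) \<and> m' = m \<and>
     r' 24 = j * r 28)"
  have body: "vc L (Add 24 24 28) (\<lambda>u (r', m'). u \<le> 1 \<and> r' 20 = j \<and> r' 26 = c \<and> r' 3 = 1 \<and>
      I (Suc j) (r'(20 := Suc j), m')) (r', m')"
    if inv: "I j (r', m')" and j: "j < c" "r' 20 = j" for j r' m'
  proof -
    have "Suc j * r 28 \<le> c * r 28" using j by (intro mult_le_mono1) simp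
    then have "r 28 + j * r 28 < 2 ^ L" using regs by simp
    then show ?thesis using inv j regs by (simp add: I_def add.commute)
  qed
  show ?thesis
    unfolding MULT_def using regs
    apply simp
    apply (rule vc_For[where N=c and \<tau>=1 and I=I])
    subgoal by (simp add: I_def)
    subgoal by simp
    subgoal by simp
    subgoal by simp
    subgoal by (simp add: I_def)
    subgoal by (rule body)
    subgoal by simp
    subgoal by simp
    subgoal by simp
    subgoal for u r' m'
      unfolding I_def
      apply simp
      apply (rule Q)
        apply simp_all
      done
    done
qed

text \<open>The bound is stated with base \<open>c + 1\<close> so that it also controls
  \<open>c\<close> itself and every intermediate power when \<open>c = 0\<close> or
  \<open>k = 0\<close>.\<close>

lemma vc_POWER:
  assumes regs: "r 3 = 1" "r 26 = c" "r 13 = k" "(c + 1) ^ k * (c + 1) < 2 ^ L" "k < 2 ^ L"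
    and Q: "\<And>u r'. u \<le> k * (4 * c + 13) + 5 \<Longrightarrow> (\<forall>i. i \<notin> {18,19,20,21,24,25,28} \<longrightarrow> r' i = r i) \<Longrightarrow>
      r' 28 = c ^ k \<Longrightarrow> Q u (r', m)"
  shows "vc L POWER Q (r, m)"
proof -
  define I where "I = (\<lambda>j (r', m'). (\<forall>i. i \<notin> {18,19,20,21,24,25,28} \<longrightarrow> r' i = r i) \<and> m' = m \<and>
     r' 28 = c ^ j)"
  have c: "c < 2 ^ L" "1 < (2::nat) ^ L"
  proof -
    have "1 \<le> (c + 1) ^ k * (c + 1)" by (simp add: Suc_le_eq)
    then show "1 < (2::nat) ^ L" using regs(4) by (rule order.strict_trans1)
    have "1 * (c + 1) \<le> (c + 1) ^ k * (c + 1)" by (intro mult_le_mono1) simp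
    then show "c < 2 ^ L" using regs(4) by simp
  qed
  have body: "vc L MULT (\<lambda>u (r', m'). u \<le> 4 * c + 10 \<and> r' 18 = j \<and> r' 13 = k \<and> r' 3 = 1 \<and>
      I (Suc j) (r'(18 := Suc j), m')) (r', m')"
    if inv: "I j (r', m')" and j: "j < k" "r' 18 = j" for j r' m'
  proof -
    have r': "\<forall>i. i \<notin> {18,19,20,21,24,25,28} \<longrightarrow> r' i = r i" "m' = m" "r' 28 = c ^ j"
      using inv by (simp_all add: I_def)
    have "c ^ Suc j \<le> (c + 1) ^ Suc j" by (rule power_mono) auto
    also have "\<dots> \<le> (c + 1) ^ Suc k" using j by (intro power_increasing) auto
    also have "\<dots> < 2 ^ L" using regs(4) by (simp add: mult.commute)
    finally have "c * c ^ j < 2 ^ L" by simp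
    then show ?thesis unfolding r'(2)
      by (intro vc_MULT[where c=c]) (use r' regs j c in \<open>simp_all add: I_def\<close>)
  qed
  show ?thesis
    unfolding POWER_def using regs c
    apply simp
    apply (rule vc_For[where N=k and \<tau>="4 * c + 10" and I=I])
    subgoal by (simp add: I_def)
    subgoal by simp
    subgoal by simp
    subgoal by simp
    subgoal by (simp add: I_def)
    subgoal by (rule body)
    subgoal by simp
    subgoal by simp
    subgoal by simp
    subgoal for u r' m' by (auto simp: I_def algebra_simps intro!: Q)
    done
qed

lemma (in machine) vc_LEAF:
  assumes regs: "r 2 = n" "r 3 = 1" "r 4 = RB" "r 5 = OB" "r 8 + n < 2 ^ L" "r 13 = k"
    and m: "adj_mem m" "repr m (r 8) (n, k, b, D, A)"
    and k: "k \<le> n" "(n + 1) ^ (k + 1) < 2 ^ L" "r 10 + r 11 + n ^ k < 2 ^ L"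
    and Q: "\<And>u r'. u \<le> 50 * (n + 1) ^ 2 \<Longrightarrow> (\<forall>i. i < 10 \<longrightarrow> r' i = r i) \<Longrightarrow>
      int (r' 10) - int (r' 11) = int (r 10) - int (r 11) + signed_count 0 (n, k, b, D, A) \<Longrightarrow>
      r' 10 + r' 11 \<le> r 10 + r 11 + n ^ k \<Longrightarrow> Q u (r', m)"
  shows "vc L LEAF Q (r, m)"
proof -
  define c where "c = card (avoiders A)"
  have "avoiders A \<subseteq> {..<n}" by (auto simp: avoiders_def)
  then have c: "c \<le> n" unfolding c_def using card_mono[of "{..<n}"] by fastforce
  have "(c + 1) ^ (k + 1) \<le> (n + 1) ^ (k + 1)" using c by (intro power_mono) auto
  then have ck: "(c + 1) ^ k * (c + 1) < 2 ^ L" using k by (simp add: mult.commute)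
  have ckn: "c ^ k \<le> n ^ k" using c by (rule power_mono) simp
  have time: "n * (25 * n + 13) + 5 + (15 * n + 5) + (k * (4 * c + 13) + 5) + 6 \<le> 50 * (n + 1) ^ 2"
  proof -
    have "k * (4 * c + 13) \<le> n * (4 * n + 13)" using k c by (intro mult_le_mono) auto
    then show ?thesis by (simp add: power2_eq_square algebra_simps)
  qed
  have sign: "(-1) ^ card A = (if card A mod 2 = 0 then 1 else - 1 :: int)"
    by (auto simp: even_iff_mod_2_eq_zero)
  show ?thesis
    unfolding LEAF_def
    apply simp
    apply (rule vc_COUNT_AVOIDERS[OF regs(1-5) m])
    apply simp
    apply (rule vc_SIGN[where A=A and k=k and b=b and D=D])
    subgoal using regs by simp
    subgoal using regs by simp
    subgoal using regs by simp
    subgoal using m by simp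
    apply simp
    apply (rule vc_POWER[where c=c and k=k])
    subgoal using regs by simp
    subgoal using c_def by simp
    subgoal using regs by simp
    subgoal using ck .
    subgoal using k bases by simp
    subgoal for u1 r1 u2 r2 u3 r3
      using ckn k time
      apply (simp del: of_nat_power)
      apply (intro conjI impI; (rule Q)?)
               apply (simp_all add: sign c_def)
      done
    done
qed

subsection \<open>Expanding a state\<close>

definition COUNT_STEP :: ram where
  "COUNT_STEP = seqs [ADJ 12 27, Add 26 26 31]"

definition COUNT_LATER :: ram where
  "COUNT_LATER = seqs [Const 26 0, Const 24 0, Add 27 15 24, For 27 28 2 COUNT_STEP]"

definition TRY_PICK :: ram where
  "TRY_PICK = seqs [ADJ 12 18, If 31 PUSH_PICK Skip]"

text \<open>Register 26 counts the later neighbours. Exactly one is detected as a nonzero count that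
  becomes zero after subtracting 1.\<close>

definition FIRST_CAND :: ram where
  "FIRST_CAND = seqs [COUNT_LATER, Const 24 0, Add 18 12 24,
     If 26 (seqs [Sub 24 26 3, If 24 Skip (seqs [Const 24 0, Add 18 15 24])]) Skip]"

definition PICKS :: ram where
  "PICKS = seqs [Sub 16 13 3, Sub 17 14 6, FIRST_CAND, For 18 19 2 TRY_PICK]"

definition MARKS :: ram where
  "MARKS = seqs [Sub 17 14 3, Const 24 0, Add 16 13 24, PUSH, PUSH_MARKED]"

definition MAYBE_PICKS :: ram where
  "MAYBE_PICKS = If 13 (seqs [Sub 24 6 14, If 24 Skip PICKS]) Skip"

definition EXPAND :: ram where
  "EXPAND = seqs [Add 24 8 12, Load 24 24, Add 15 12 3,
     If 24 (seqs [Const 24 0, Add 16 13 24, Add 17 14 24, PUSH])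
       (seqs [If 14 MARKS Skip, MAYBE_PICKS])]"

text \<open>\<open>n - v\<close> is zero exactly at a leaf. Register 29 becomes tail minus head, so
  the main loop stops when the queue is empty.\<close>

definition STEP :: ram where
  "STEP = seqs [Add 24 8 2, Load 12 24, Add 24 24 3, Load 13 24, Add 24 24 3, Load 14 24,
     Sub 24 2 12, If 24 EXPAND LEAF, Add 8 8 7, Sub 29 9 8]"

context machine
begin

text \<open>Nothing is said about the blocks between \<open>QB\<close> and the head: states already
  processed stay there as garbage.\<close>

definition queue :: "(nat \<Rightarrow> nat) \<Rightarrow> (nat \<Rightarrow> nat) \<Rightarrow> state list \<Rightarrow> bool" where
  "queue r m qs \<longleftrightarrow> r 2 = n \<and> r 3 = 1 \<and> r 4 = RB \<and> r 5 = OB \<and> r 6 = d \<and> r 7 = n + 3 \<and>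
     QB \<le> r 8 \<and> r 9 = r 8 + length qs * (n + 3) \<and> adj_mem m \<and>
     (\<forall>i<length qs. repr m (r 8 + i * (n + 3)) (qs ! i))"

lemma queue_regs:
  assumes "queue r m (q # qs)"
  shows "r 2 = n" "r 3 = 1" "r 4 = RB" "r 5 = OB" "r 6 = d" "r 7 = n + 3" "QB \<le> r 8"
    "r 8 + (n + 3) \<le> r 9" "adj_mem m" "repr m (r 8) q" "r 9 = r 8 + (length qs + 1) * (n + 3)"
  using assms unfolding queue_def by auto

lemma queue_append:
  assumes q: "queue r m qs" and r: "\<forall>i. 2 \<le> i \<and> i \<le> 8 \<longrightarrow> r' i = r i" "r' 9 = r 9 + (n + 3)"
    and m: "\<forall>x<r 9. m' x = m x" "repr m' (r 9) c"
  shows "queue r' m' (qs @ [c])"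
proof -
  have "repr m' (r 8 + i * (n + 3)) (qs ! i)" if "i < length qs" for i
  proof (rule repr_cong)
    show "repr m (r 8 + i * (n + 3)) (qs ! i)" using q that by (simp add: queue_def)
    fix x assume "x < r 8 + i * (n + 3) + (n + 3)"
    moreover have "Suc i * (n + 3) \<le> length qs * (n + 3)" using that by (intro mult_le_mono1) simp
    ultimately have "x < r 9" using q by (simp add: queue_def)
    then show "m' x = m x" using m by simp
  qed
  moreover have "adj_mem m'"
    using q m by (intro adj_mem_cong[of m m']) (auto simp: queue_def)
  ultimately show ?thesis using q r m by (auto simp: queue_def nth_append less_Suc_eq)
qed

lemma queue_frame:
  assumes "queue r m qs" "\<forall>i. 2 \<le> i \<and> i \<le> 9 \<longrightarrow> r' i = r i"
  shows "queue r' m qs"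
  using assms by (simp add: queue_def)

lemma vc_PUSH_queue:
  assumes q: "queue r m (q # qs)" and qv: "q = (v, k, b, D, A)" "v < n" and regs: "r 15 = Suc v"
    and room: "r 9 + (n + 3) < 2 ^ L"
    and Q: "\<And>u r' m'. u \<le> 8 * n + 30 \<Longrightarrow> (\<forall>i. i \<notin> {9,20,21,24,25} \<longrightarrow> r' i = r i) \<Longrightarrow>
      r' 9 = r 9 + (n + 3) \<Longrightarrow> queue r' m' (q # qs @ [(Suc v, r 16, r 17, D, A)]) \<Longrightarrow> Q u (r', m')"
  shows "vc L PUSH Q (r, m)"
proof (rule vc_PUSH[OF queue_regs(1,2,6,8)[OF q] room _ qv(2) regs])
  show "repr m (r 8) (v, k, b, D, A)" using queue_regs(10)[OF q] qv by simp
next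
  fix u r' m'
  assume *: "u \<le> 8 * n + 30" "\<forall>i. i \<notin> {9,20,21,24,25} \<longrightarrow> r' i = r i" "r' 9 = r 9 + (n + 3)"
    "\<forall>x<r 9. m' x = m x" "repr m' (r 9) (Suc v, r 16, r 17, D, A)"
  have "queue r' m' ((q # qs) @ [(Suc v, r 16, r 17, D, A)])"
    by (rule queue_append[OF q]) (use * in auto)
  then show "Q u (r', m')" using * by (intro Q) simp_all
qed

lemma vc_PUSH_MARKED_queue:
  assumes q: "queue r m (q # qs)" and qv: "q = (v, k, b, D, A)" "v < n" and regs: "r 12 = v" "r 15 = Suc v"
    and room: "r 9 + (n + 3) < 2 ^ L"
    and Q: "\<And>u r' m'. u \<le> 8 * n + 30 \<Longrightarrow> (\<forall>i. i \<notin> {9,20,21,24,25} \<longrightarrow> r' i = r i) \<Longrightarrow>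
      r' 9 = r 9 + (n + 3) \<Longrightarrow> queue r' m' (q # qs @ [(Suc v, r 16, r 17, D, insert v A)]) \<Longrightarrow> Q u (r', m')"
  shows "vc L PUSH_MARKED Q (r, m)"
proof (rule vc_PUSH_MARKED[OF queue_regs(1,2,6,8)[OF q] room _ qv(2) regs])
  show "repr m (r 8) (v, k, b, D, A)" using queue_regs(10)[OF q] qv by simp
next
  fix u r' m'
  assume *: "u \<le> 8 * n + 30" "\<forall>i. i \<notin> {9,20,21,24,25} \<longrightarrow> r' i = r i" "r' 9 = r 9 + (n + 3)"
    "\<forall>x<r 9. m' x = m x" "repr m' (r 9) (Suc v, r 16, r 17, D, insert v A)"
  have "queue r' m' ((q # qs) @ [(Suc v, r 16, r 17, D, insert v A)])"
    by (rule queue_append[OF q]) (use * in auto)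
  then show "Q u (r', m')" using * by (intro Q) simp_all
qed

lemma vc_PUSH_PICK_queue:
  assumes q: "queue r m (q # qs)" and qv: "q = (v, k, b, D, A)" "v < n" and regs: "r 15 = Suc v" "r 18 < n"
    and room: "r 9 + (n + 3) < 2 ^ L"
    and Q: "\<And>u r' m'. u \<le> 40 * n + 40 \<Longrightarrow> (\<forall>i. i \<notin> {9,20,21,22,23,24,25,30,31} \<longrightarrow> r' i = r i) \<Longrightarrow>
      r' 9 = r 9 + (n + 3) \<Longrightarrow>
      queue r' m' (q # qs @ [(Suc v, r 16, r 17, D \<union> {x. a (r 18) x}, A)]) \<Longrightarrow> Q u (r', m')"
  shows "vc L PUSH_PICK Q (r, m)"
proof (rule vc_PUSH_PICK[OF queue_regs(1-4,6,8)[OF q] room queue_regs(7,9)[OF q] _ qv(2) regs])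
  show "repr m (r 8) (v, k, b, D, A)" using queue_regs(10)[OF q] qv by simp
next
  fix u r' m'
  assume *: "u \<le> 40 * n + 40" "\<forall>i. i \<notin> {9,20,21,22,23,24,25,30,31} \<longrightarrow> r' i = r i" "r' 9 = r 9 + (n + 3)"
    "\<forall>x<r 9. m' x = m x" "repr m' (r 9) (Suc v, r 16, r 17, D \<union> {x. a (r 18) x}, A)"
  have "queue r' m' ((q # qs) @ [(Suc v, r 16, r 17, D \<union> {x. a (r 18) x}, A)])"
    by (rule queue_append[OF q]) (use * in auto)
  then show "Q u (r', m')" using * by (intro Q) simp_all
qed

lemma vc_COUNT_LATER:
  assumes regs: "r 2 = n" "r 3 = 1" "r 4 = RB" "r 5 = OB" "r 12 = v" "r 15 = Suc v" "v < n" "adj_mem m"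
    and Q: "\<And>u r'. u \<le> 20 * n + 10 \<Longrightarrow> (\<forall>i. i \<notin> {24,26,27,28,30,31} \<longrightarrow> r' i = r i) \<Longrightarrow>
      r' 26 = card (later v) \<Longrightarrow> Q u (r', m)"
  shows "vc L COUNT_LATER Q (r, m)"
proof -
  define I where "I = (\<lambda>j (r', m'). (\<forall>i. i \<notin> {24,26,27,28,30,31} \<longrightarrow> r' i = r i) \<and> m' = m \<and>
     v < j \<and> r' 26 = card (later v \<inter> {..<j}))"
  have body: "vc L COUNT_STEP (\<lambda>u (r', m'). u \<le> 15 \<and> r' 27 = j \<and> r' 2 = n \<and> r' 3 = 1 \<and>
      I (Suc j) (r'(27 := Suc j), m')) (r', m')"
    if inv: "I j (r', m')" and j: "j < n" "r' 27 = j" for j r' m'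
  proof -
    have r': "\<forall>i. i \<notin> {24,26,27,28,30,31} \<longrightarrow> r' i = r i" "m' = m" "v < j"
      "r' 26 = card (later v \<inter> {..<j})"
      using inv by (simp_all add: I_def)
    have "card (later v \<inter> {..<j}) \<le> card {..<j}" by (rule card_mono) auto
    then have le: "Suc (r' 26) < 2 ^ L" "r' 26 < 2 ^ L" using r' j bases by auto
    have "later v \<inter> {..<Suc j} = (if a v j then insert j (later v \<inter> {..<j}) else later v \<inter> {..<j})"
      using j r'(3) by (auto simp: less_Suc_eq later_def)
    then have card: "card (later v \<inter> {..<Suc j}) = r' 26 + of_bool (a v j)"
      using r' by simp
    show ?thesis using r'(1-3) le regs j card by (simp add: COUNT_STEP_def I_def)
  qed
  have empty: "later v \<inter> {..<Suc v} = {}" by (auto simp: later_def)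
  show ?thesis
    unfolding COUNT_LATER_def using regs bases
    apply simp
    apply (rule vc_For[where N=n and \<tau>=15 and I=I])
    subgoal by (simp add: I_def empty)
    subgoal by simp
    subgoal by simp
    subgoal by simp
    subgoal by (simp add: I_def)
    subgoal by (rule body)
    subgoal by simp
    subgoal by simp
    subgoal by simp
    subgoal for u r' m'
    proof -
      have "later v \<inter> {..<n} = later v" by (auto simp: later_def)
      then show "I n (r', m') \<Longrightarrow> u \<le> (n - (r(26 := 0, 24 := 0, 27 := Suc v)) 27) * (15 + 3) + 2 \<Longrightarrow> ?thesis"
        unfolding I_def
        apply simp
        apply (rule Q)
          apply simp_all
        done
    qed
    done
qed

lemma vc_FIRST_CAND:
  assumes regs: "r 2 = n" "r 3 = 1" "r 4 = RB" "r 5 = OB" "r 12 = v" "r 15 = Suc v" "v < n" "adj_mem m"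
    and Q: "\<And>u r'. u \<le> 20 * n + 20 \<Longrightarrow> (\<forall>i. i \<notin> {18,24,26,27,28,30,31} \<longrightarrow> r' i = r i) \<Longrightarrow>
      r' 18 = first_cand v \<Longrightarrow> Q u (r', m)"
  shows "vc L FIRST_CAND Q (r, m)"
  unfolding FIRST_CAND_def
  apply simp
  apply (rule vc_COUNT_LATER[OF regs])
  using regs bases
  apply simp
  apply (intro conjI impI; rule Q)
           apply (simp_all add: first_cand_def)
  done

lemma vc_PICKS:
  assumes q: "queue r m (q # qs)" and qv: "q = (v, k, b, D, A)" "v < n"
    and regs: "r 12 = v" "r 13 = k" "r 14 = b" "r 15 = Suc v"
    and room: "r 9 + length (cands v) * (n + 3) < 2 ^ L"
    and Q: "\<And>u r' m'. u \<le> 100 * (n + 1) ^ 2 \<Longrightarrow> (\<forall>i. i < 12 \<and> i \<noteq> 9 \<longrightarrow> r' i = r i) \<Longrightarrow>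
      queue r' m' (q # qs @ map (pick q) (cands v)) \<Longrightarrow> Q u (r', m')"
  shows "vc L PICKS Q (r, m)"
proof -
  define cs where "cs j = filter (a v) [first_cand v..<j]" for j
  define I where "I = (\<lambda>j (r', m'). (\<forall>i. i < 18 \<and> i \<noteq> 9 \<and> i \<noteq> 16 \<and> i \<noteq> 17 \<longrightarrow> r' i = r i) \<and>
    r' 16 = k - 1 \<and> r' 17 = b - d \<and>
    first_cand v \<le> j \<and> queue r' m' (q # qs @ map (pick q) (cs j)))"
  have body: "vc L TRY_PICK (\<lambda>u (r', m'). u \<le> 40 * n + 60 \<and> r' 18 = j \<and> r' 2 = n \<and> r' 3 = 1 \<and>
      I (Suc j) (r'(18 := Suc j), m')) (r', m')"
    if inv: "I j (r', m')" and j: "j < n" "r' 18 = j" for j r' m'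
  proof -
    have r': "\<forall>i. i < 18 \<and> i \<noteq> 9 \<and> i \<noteq> 16 \<and> i \<noteq> 17 \<longrightarrow> r' i = r i"
      "r' 16 = k - 1" "r' 17 = b - d" "first_cand v \<le> j"
      and q': "queue r' m' (q # qs @ map (pick q) (cs j))"
      using inv by (simp_all add: I_def)
    note qr = queue_regs(1-10)[OF q']
    have csS: "cs (Suc j) = cs j @ (if a v j then [j] else [])" using r'(4) by (simp add: cs_def)
    show ?thesis
    proof (cases "a v j")
      case False
      then have "I (Suc j) (r'(30 := y, 31 := z, 18 := Suc j), m')" for y z
        using r' q' unfolding I_def by (auto simp: csS intro: queue_frame)
      then show ?thesis using qr qv False j regs r'(1) by (simp add: TRY_PICK_def)
    next
      case True
      \<comment> \<open>The candidates met so far form a prefix of all candidates, so space reserved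
        for all of them suffices for the next block.\<close>
      have "cands v = cs (Suc j) @ filter (a v) [Suc j..<n]"
        unfolding cands_def cs_def using r'(4) j
        by (metis filter_append le_SucI less_eq_Suc_le upt_add_eq_append le_add_diff_inverse)
      then have "length (cs (Suc j)) \<le> length (cands v)" by simp
      then have "Suc (length (cs j)) * (n + 3) \<le> length (cands v) * (n + 3)"
        using True by (intro mult_le_mono1) (simp add: csS)
      moreover have "r' 9 = r 9 + length (cs j) * (n + 3)"
        using queue_regs(11)[OF q] queue_regs(11)[OF q'] r'(1) by (simp add: algebra_simps)
      ultimately have room': "r' 9 + (n + 3) < 2 ^ L" using room by simp
      show ?thesis
        unfolding TRY_PICK_def using qr qv True j regs r'(1)
        apply simp
        subgoal premises prems
        proof -
          have q1: "queue (r'(30 := m' (OB + j), 31 := Suc 0)) m' (q # qs @ map (pick q) (cs j))"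
            using q' by (rule queue_frame) simp
          show ?thesis
            apply (rule vc_PUSH_PICK_queue[OF q1 qv])
            using j regs r'(1) room'
               apply simp_all
            subgoal for u r'' m''
              unfolding I_def csS
              using r' True queue_regs(1,2)[OF q] queue_frame[of r'' m'' "q # qs @ map (pick q) (cs j) @ [pick q j]" "r''(18 := Suc j)"]
              apply (simp add: pick_def qv)
              done
            done
        qed
        done
    qed
  qed
  have frame: "I j (r'(19 := y), m')" if "I j (r', m')" for j r' m' y
    using that unfolding I_def by (auto intro: queue_frame)
  have fc: "first_cand v \<le> n" using qv by (simp add: first_cand_def)
  show ?thesis
    unfolding PICKS_def
    apply simp
    apply (rule vc_FIRST_CAND[where v=v])
    using queue_regs(1-10)[OF q] qv regs
             apply simp_all
    subgoal for u0 r0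
      apply (rule vc_For[where N=n and \<tau>="40 * n + 60" and I=I])
      subgoal unfolding I_def using queue_frame[OF q, of r0] by (simp add: cs_def)
      subgoal using fc by simp
      subgoal by simp
      subgoal using bases by simp
      subgoal by (rule frame)
      subgoal by (rule body)
      subgoal by simp
      subgoal by simp
      subgoal by simp
      subgoal for u r' m'
      proof -
        assume a: "I n (r', m')" "u0 \<le> 20 * n + 20" "u \<le> (n - r0 18) * (40 * n + 60 + 3) + 2"
        have "(n - r0 18) * (40 * n + 60 + 3) \<le> n * (40 * n + 60 + 3)" by (intro mult_le_mono1) simp
        then have "u0 + u + 10 \<le> 100 * (n + 1) ^ 2" using a
          by (simp add: power2_eq_square algebra_simps)
        then show "vc L Skip (\<lambda>u'. Q (Suc (Suc (u0 + (u + u'))))) (r', m')"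
          using a(1) by (auto simp: I_def cs_def cands_def intro!: Q)
      qed
      done
    done
qed

lemma vc_MARKS:
  assumes q: "queue r m (q # qs)" and qv: "q = (v, k, b, D, A)" "v < n"
    and regs: "r 12 = v" "r 13 = k" "r 14 = b" "r 15 = Suc v"
    and room: "r 9 + 2 * (n + 3) < 2 ^ L" "k < 2 ^ L"
    and Q: "\<And>u r' m'. u \<le> 16 * n + 80 \<Longrightarrow> (\<forall>i. i < 16 \<and> i \<noteq> 9 \<longrightarrow> r' i = r i) \<Longrightarrow>
      queue r' m' (q # qs @ [(Suc v, k, b - 1, D, A), (Suc v, k, b - 1, D, insert v A)]) \<Longrightarrow> Q u (r', m')"
  shows "vc L MARKS Q (r, m)"
  unfolding MARKS_def
  using room(2) regs
  apply simp
  apply (rule vc_PUSH_queue[OF queue_frame[OF q] qv])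
  subgoal using queue_regs(2)[OF q] by simp
  subgoal by simp
  subgoal using room(1) by simp
  subgoal for u1 r1 m1
    apply simp
    apply (erule vc_PUSH_MARKED_queue[OF _ qv])
    subgoal by simp
    subgoal by simp
    subgoal using room(1) by simp
    subgoal for u2 r2 m2
      using queue_regs(2)[OF q]
      apply simp
      apply (rule Q)
        apply simp_all
      done
    done
  done

lemma vc_EXPAND:
  assumes q: "queue r m (q # qs)" and qv: "q = (v, k, b, D, A)" "v < n"
    and regs: "r 12 = v" "r 13 = k" "r 14 = b"
    and room: "r 9 + length (children q) * (n + 3) < 2 ^ L" "k < 2 ^ L" "b < 2 ^ L"
    and Q: "\<And>u r' m'. u \<le> 200 * (n + 1) ^ 2 \<Longrightarrow> (\<forall>i. i < 12 \<and> i \<noteq> 9 \<longrightarrow> r' i = r i) \<Longrightarrow>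
      queue r' m' (q # qs @ children q) \<Longrightarrow> Q u (r', m')"
  shows "vc L EXPAND Q (r, m)"
proof -
  note qr = queue_regs(1-10)[OF q]
  have lens: "r 8 + v < 2 ^ L" "Suc v < 2 ^ L" using qr qv bases room(1) by auto
  have mv: "m (r 8 + v) = of_bool (v \<in> D)" using repr_entries(2)[of m "r 8" v k b D A v] qr qv by simp
  have n2: "(Suc n)\<^sup>2 = n * n + 2 * n + 1" by (simp add: power2_eq_square)
  show ?thesis
  proof (cases "v \<in> D")
    case True
    show ?thesis
      unfolding EXPAND_def using qr regs lens mv True room qv
      apply simp
      apply (rule vc_PUSH_queue[OF queue_frame[OF q] qv])
      subgoal by simp
      subgoal by simp
      subgoal by simp
      subgoal for u r' m'
        apply simp
        apply (rule Q)
        using n2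
          apply simp_all
        done
      done
  next
    case False
    define ms where "ms = (if 0 < b then [(Suc v, k, b - 1, D, A), (Suc v, k, b - 1, D, insert v A)] else [])"
    define ps where "ps = (if 0 < k \<and> d \<le> b then map (pick q) (cands v) else [])"
    have ch: "children q = ms @ ps" using False qv by (simp add: ms_def ps_def)
    have picks: "vc L MAYBE_PICKS
        (\<lambda>u (r', m'). u \<le> 100 * (n + 1) ^ 2 + 10 \<and> (\<forall>i. i < 12 \<and> i \<noteq> 9 \<longrightarrow> r' i = r i) \<and>
          queue r' m' (q # qs @ children q)) (r', m')"
      if q': "queue r' m' (q # qs @ ms)"
        and r': "\<forall>i. i < 16 \<and> i \<noteq> 9 \<longrightarrow> r' i = (r(15 := Suc v)) i" for r' m'
    proof (cases "0 < k \<and> d \<le> b")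
      case False
      then have "queue r' m' (q # qs @ children q)" using q' by (auto simp: ch ps_def)
      moreover have "queue (r'(24 := x)) m' (q # qs @ children q)" for x
        by (rule queue_frame[OF calculation]) simp
      ultimately show ?thesis unfolding MAYBE_PICKS_def using False r' regs qr
        by (auto simp del: children.simps)
    next
      case True
      have "r' 9 + length (cands v) * (n + 3) = r 9 + length (children q) * (n + 3)"
        using queue_regs(11)[OF q'] queue_regs(11)[OF q] r' True by (simp add: ch ps_def algebra_simps)
      then have room': "r' 9 + length (cands v) * (n + 3) < 2 ^ L" using room by simp
      have "queue (r'(24 := 0)) m' (q # qs @ ms)" using q' by (rule queue_frame) simp
      then show ?thesis
        unfolding MAYBE_PICKS_def using True regs r' qr(5)
        apply simp
        apply (erule vc_PICKS[OF _ qv])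
        using room'
             apply simp_all
        apply (simp add: ch ps_def)
        done
    qed
    show ?thesis
    proof (cases "0 < b")
      case False
      then have "queue (r(24 := 0, 15 := Suc v)) m (q # qs @ ms)"
        using q by (auto simp: ms_def intro: queue_frame)
      then show ?thesis
        unfolding EXPAND_def using qr(1-7) regs lens mv \<open>v \<notin> D\<close> False
        apply simp
        apply (rule vc_mono[OF picks])
          apply simp_all
        apply (clarsimp simp del: children.simps)
        apply (rule Q)
        using n2
          apply (simp_all del: children.simps)
        done
    next
      case True
      have q0: "queue (r(24 := 0, 15 := Suc v)) m (q # qs)"
        using q by (auto intro: queue_frame)
      have "2 * (n + 3) \<le> length (children q) * (n + 3)"
        using True by (intro mult_le_mono1) (simp add: ch ms_def)
      then have room': "r 9 + 2 * (n + 3) < 2 ^ L" using room by simp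
      show ?thesis
        unfolding EXPAND_def using qr(1-7) regs lens mv \<open>v \<notin> D\<close> True
        apply simp
        apply (rule vc_MARKS[OF q0 qv])
        using room room'
              apply (simp_all del: children.simps)
        subgoal for u1 r1 m1
          apply (rule vc_mono[OF picks])
          apply (simp add: ms_def)
           apply simp
          apply (clarsimp simp del: children.simps)
          apply (rule Q)
          using n2
            apply (simp_all del: children.simps)
          done
        done
    qed
  qed
qed

end

subsection \<open>The main loop\<close>

context machine
begin

definition successors :: "state \<Rightarrow> state list" where
  "successors q = (if fst q < n then children q else [])"

definition leaf_value :: "state \<Rightarrow> int" where
  "leaf_value q = (if fst q < n then 0 else signed_count 0 q)"

lemma queue_tl:
  assumes "queue r m (q # qs)" "\<forall>i. 2 \<le> i \<and> i \<le> 9 \<and> i \<noteq> 8 \<longrightarrow> r' i = r i" "r' 8 = r 8 + (n + 3)"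
  shows "queue r' m qs"
proof -
  have "repr m (r 8 + (n + 3) + i * (n + 3)) (qs ! i)" if "i < length qs" for i
  proof -
    have "\<forall>i<length (q # qs). repr m (r 8 + i * (n + 3)) ((q # qs) ! i)"
      using assms(1) unfolding queue_def by blast
    from this[rule_format, of "Suc i"] that show ?thesis by (simp add: algebra_simps)
  qed
  then show ?thesis using assms unfolding queue_def by simp
qed

lemma vc_STEP:
  assumes q: "queue r m (q # qs)" and qv: "q = (v, k, b, D, A)" "k \<le> n"
    and room: "r 9 + length (successors q) * (n + 3) < 2 ^ L" "b < 2 ^ L"
      "(n + 1) ^ (k + 1) < 2 ^ L" "r 10 + r 11 + n ^ k < 2 ^ L"
    and Q: "\<And>u r' m'. u \<le> 250 * (n + 1) ^ 2 \<Longrightarrow> r' 8 = r 8 + (n + 3) \<Longrightarrow>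
      r' 29 = length (qs @ successors q) * (n + 3) \<Longrightarrow> queue r' m' (qs @ successors q) \<Longrightarrow>
      int (r' 10) - int (r' 11) = int (r 10) - int (r 11) + leaf_value q \<Longrightarrow>
      r' 10 + r' 11 \<le> r 10 + r 11 + n ^ k \<Longrightarrow> Q u (r', m')"
  shows "vc L STEP Q (r, m)"
proof -
  note qr = queue_regs(1-10)[OF q]
  have ent: "v \<le> n" "m (r 8 + n) = v" "m (Suc (r 8 + n)) = k" "m (Suc (Suc (r 8 + n))) = b"
    using repr_entries(5-8)[of m "r 8" v k b D A] qr(10) qv by simp_all
  have k: "k < 2 ^ L" using qv bases by simp
  have n2: "(Suc n)\<^sup>2 = n * n + 2 * n + 1" by (simp add: power2_eq_square)
  have w: "r 8 + (n + 3) < 2 ^ L" using qr(8) room(1) by simp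
  show ?thesis
  proof (cases "v < n")
    case True
    then have su: "successors q = children q" and lv: "leaf_value q = 0"
      by (simp_all add: successors_def leaf_value_def qv)
    show ?thesis
      unfolding STEP_def using qr(1-7) ent True w
      apply simp
      apply (rule vc_EXPAND[OF queue_frame[OF q] qv(1) True])
      subgoal by simp
      subgoal by simp
      subgoal by simp
      subgoal by simp
      subgoal using room su by simp
      subgoal by (rule k)
      subgoal by (rule room(2))
      subgoal for u r' m'
        apply simp
        apply (rule Q)
        subgoal using n2 by simp
        subgoal by simp
        subgoal unfolding su using queue_regs(11)[of r' m' q "qs @ children q"] by simp
        subgoal unfolding su by (erule queue_tl) simp_all
        subgoal using lv by simp
        subgoal by simp
        done
      done
  next
    case False
    then have v: "v = n" using ent by simp
    have su: "successors q = []" and lv: "leaf_value q = signed_count 0 (n, k, b, D, A)"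
      by (simp_all add: successors_def leaf_value_def qv v)
    show ?thesis
      unfolding STEP_def using qr(1-7) ent v w
      apply simp
      apply (rule vc_LEAF[where A=A and k=k and b=b and D=D])
      subgoal by simp
      subgoal by simp
      subgoal by simp
      subgoal by simp
      subgoal by simp
      subgoal by simp
      subgoal by (rule qr(9))
      subgoal using qr(10) qv by simp
      subgoal by (rule qv(2))
      subgoal by (rule room(3))
      subgoal using room(4) by simp
      subgoal for u r'
        apply (simp del: signed_count.simps)
        apply (rule Q)
        subgoal using n2 by simp
        subgoal by simp
        subgoal unfolding su using queue_regs(11)[OF q] by simp
        subgoal unfolding su append_Nil2 by (rule queue_tl[OF q]) simp_all
        subgoal using lv by (simp del: signed_count.simps)
        subgoal by simp
        done
      done
  qed
qed

text \<open>Properties of the root that all descendants inherit. The implication for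
  \<open>d = 0\<close> holds at the root, where \<open>b = d * k\<close>, and persists because
  budgets never grow.\<close>

definition good :: "nat \<Rightarrow> nat \<Rightarrow> state \<Rightarrow> bool" where
  "good K B = (\<lambda>(v, k, b, D, A). v \<le> n \<and> k \<le> K \<and> b \<le> B \<and> (d = 0 \<longrightarrow> b = 0))"

lemma good_children: "good K B q \<Longrightarrow> fst q < n \<Longrightarrow> c \<in> set (children q) \<Longrightarrow> good K B c"
  by (cases q) (auto simp: good_def pick_def split: if_splits)

lemma good_weight: "good K B q \<Longrightarrow> 1 \<le> weight q"
  by (cases q) (auto simp: good_def weight_def Suc_le_eq)

lemma good_successors:
  assumes "good K B q"
  shows "Suc (\<Sum>c\<leftarrow>successors q. weight c) \<le> weight q" "\<forall>c\<in>set (successors q). good K B c"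
proof -
  obtain v k b D A where q: "q = (v, k, b, D, A)" by (cases q)
  show "Suc (\<Sum>c\<leftarrow>successors q. weight c) \<le> weight q"
    using weight_children[of v b k D A] good_weight[OF assms] assms
    by (simp add: successors_def q good_def del: children.simps)
  show "\<forall>c\<in>set (successors q). good K B c"
    using good_children[OF assms] by (simp add: successors_def)
qed

definition state_value :: "state \<Rightarrow> int" where
  "state_value q = signed_count (n - fst q) q"

lemma fst_children: "c \<in> set (children q) \<Longrightarrow> fst c = Suc (fst q)"
  by (cases q) (auto simp: pick_def split: if_splits)

text \<open>Consequently the accumulated difference plus the values of all queued states stays
  constant during the main loop.\<close>

lemma state_value_eq: "state_value q = leaf_value q + (\<Sum>c\<leftarrow>successors q. state_value c)"
proof (cases "fst q < n")
  case True
  then have "state_value q = (\<Sum>c\<leftarrow>children q. signed_count (n - Suc (fst q)) c)"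
    by (simp add: state_value_def flip: Suc_diff_Suc)
  also have "\<dots> = (\<Sum>c\<leftarrow>children q. state_value c)"
    by (rule arg_cong[where f=sum_list], rule map_cong) (simp_all add: state_value_def fst_children)
  finally show ?thesis using True by (simp add: leaf_value_def successors_def)
qed (simp add: state_value_def leaf_value_def successors_def)

lemma length_le_sum_weight:
  "\<forall>q\<in>set qs. good K B q \<Longrightarrow> length qs \<le> (\<Sum>q\<leftarrow>qs. weight q)"
proof (induction qs)
  case (Cons q qs)
  then show ?case using good_weight[of K B q] by simp
qed simp

text \<open>The total weight of the queue drops by at least one per round. It serves as the
  termination measure and at the same time pays for the running time, for the advance of the head by
  one block, and for the growth of the accumulators by at most \<open>n ^ K\<close>.\<close>

lemma wp_MAIN:
  assumes "queue r m qs" "\<forall>q\<in>set qs. good K B q" "r 29 = length qs * (n + 3)"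
    and K: "K \<le> n" "(n + 1) ^ (K + 1) < 2 ^ L" "B < 2 ^ L"
    and "r 8 + (n + 3) * (\<Sum>q\<leftarrow>qs. weight q) < 2 ^ L"
    and "r 10 + r 11 + n ^ K * (\<Sum>q\<leftarrow>qs. weight q) < 2 ^ L"
  shows "wp L (While 29 STEP) (\<lambda>u (r', m').
    u \<le> (\<Sum>q\<leftarrow>qs. weight q) * (250 * (n + 1) ^ 2 + 1) + 1 \<and>
    int (r' 10) - int (r' 11) = int (r 10) - int (r 11) + (\<Sum>q\<leftarrow>qs. state_value q)) (r, m)"
  using assms(1-3,7-)
proof (induction "\<Sum>q\<leftarrow>qs. weight q" arbitrary: qs r m rule: less_induct)
  case less
  show ?case
  proof (cases qs)
    case Nil
    then show ?thesis using less.prems(3) by (intro wp_While_False) auto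
  next
    case (Cons q qs')
    obtain v k b D A where qv: "q = (v, k, b, D, A)" by (cases q)
    define ss where "ss = qs' @ successors q"
    have gq: "good K B q" and gs: "\<forall>q\<in>set ss. good K B q"
      using less.prems(2) Cons good_successors(2)[of K B q] by (auto simp: ss_def)
    have w: "Suc (\<Sum>q\<leftarrow>ss. weight q) \<le> (\<Sum>q\<leftarrow>qs. weight q)"
      using good_successors(1)[OF gq] Cons by (simp add: ss_def)
    have k: "k \<le> K" "k \<le> n" "b < 2 ^ L" using gq K by (auto simp: good_def qv)
    \<comment> \<open>Monotonicity of the power in the exponent fails for base 0, where
      \<open>0 ^ 0 = 1\<close>; there \<open>K \<le> n\<close> forces both exponents to be
      0.\<close>
    have "0 < n \<or> k = K" using k K by auto
    then have nk: "n ^ k \<le> n ^ K" using k by (auto intro: power_increasing)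
    have pow: "(n + 1) ^ (k + 1) < 2 ^ L"
      using power_increasing[of "k + 1" "K + 1" "n + 1"] k K by simp
    have mono: "c * Suc (\<Sum>q\<leftarrow>ss. weight q) \<le> c * (\<Sum>q\<leftarrow>qs. weight q)" for c
      using w by (rule mult_le_mono2)
    have queue: "queue r m (q # qs')" using less.prems(1) Cons by simp
    \<comment> \<open>Every queued state weighs at least 1, so the space occupied is bounded by the
      weight.\<close>
    have "length (q # ss) * (n + 3) \<le> (n + 3) * Suc (\<Sum>q\<leftarrow>ss. weight q)"
      using length_le_sum_weight[OF gs] by simp
    then have room: "r 9 + length (successors q) * (n + 3) < 2 ^ L"
      using queue_regs(11)[OF queue] mono[of "n + 3"] less.prems(4)
      by (simp add: ss_def algebra_simps)
    have "r 10 + r 11 + n ^ K * Suc (\<Sum>q\<leftarrow>ss. weight q) < 2 ^ L"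
      using mono[of "n ^ K"] less.prems(5) by linarith
    then have acc: "r 10 + r 11 + n ^ k + n ^ K * (\<Sum>q\<leftarrow>ss. weight q) < 2 ^ L"
      using nk by simp
    show ?thesis
    proof (rule wp_While_True)
      show "r 29 \<noteq> 0" using less.prems(3) Cons by simp
      show "wp L STEP (\<lambda>u. wp L (While 29 STEP) (\<lambda>u' (r', m').
          Suc (u + u') \<le> (\<Sum>q\<leftarrow>qs. weight q) * (250 * (n + 1) ^ 2 + 1) + 1 \<and>
          int (r' 10) - int (r' 11) = int (r 10) - int (r 11) + (\<Sum>q\<leftarrow>qs. state_value q))) (r, m)"
      proof (rule vc_imp_wp, rule vc_STEP[OF queue qv k(2) room k(3) pow])
        show "r 10 + r 11 + n ^ k < 2 ^ L" using acc by simp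
      next
        fix u r' m'
        assume *: "u \<le> 250 * (n + 1) ^ 2" "r' 8 = r 8 + (n + 3)"
          "r' 29 = length (qs' @ successors q) * (n + 3)" "queue r' m' (qs' @ successors q)"
          "int (r' 10) - int (r' 11) = int (r 10) - int (r 11) + leaf_value q"
          "r' 10 + r' 11 \<le> r 10 + r 11 + n ^ k"
        show "wp L (While 29 STEP) (\<lambda>u' (r', m').
          Suc (u + u') \<le> (\<Sum>q\<leftarrow>qs. weight q) * (250 * (n + 1) ^ 2 + 1) + 1 \<and>
          int (r' 10) - int (r' 11) = int (r 10) - int (r 11) + (\<Sum>q\<leftarrow>qs. state_value q)) (r', m')"
        proof (rule wp_mono[OF less.hyps[of ss]])
          show "(\<Sum>q\<leftarrow>ss. weight q) < (\<Sum>q\<leftarrow>qs. weight q)" using w by simp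
          show "queue r' m' ss" "r' 29 = length ss * (n + 3)" using * by (simp_all add: ss_def)
          show "\<forall>q\<in>set ss. good K B q" by (rule gs)
          show "r' 8 + (n + 3) * (\<Sum>q\<leftarrow>ss. weight q) < 2 ^ L"
            using mono[of "n + 3"] less.prems(4) *(2) by simp
          show "r' 10 + r' 11 + n ^ K * (\<Sum>q\<leftarrow>ss. weight q) < 2 ^ L"
            using acc *(6) by linarith
        next
          fix u' s'
          assume a: "case s' of (r'', m') \<Rightarrow>
            u' \<le> (\<Sum>q\<leftarrow>ss. weight q) * (250 * (n + 1) ^ 2 + 1) + 1 \<and>
            int (r'' 10) - int (r'' 11) = int (r' 10) - int (r' 11) + (\<Sum>q\<leftarrow>ss. state_value q)"
          have "(\<Sum>q\<leftarrow>qs. state_value q) = leaf_value q + (\<Sum>q\<leftarrow>ss. state_value q)"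
            using state_value_eq[of q] by (simp add: Cons ss_def)
          moreover have "Suc (u + u') \<le> (250 * (n + 1) ^ 2 + 1) * Suc (\<Sum>q\<leftarrow>ss. weight q) + 1"
            using a *(1) by (cases s') (simp add: algebra_simps)
          then have "Suc (u + u') \<le> (\<Sum>q\<leftarrow>qs. weight q) * (250 * (n + 1) ^ 2 + 1) + 1"
            using mono[of "250 * (n + 1) ^ 2 + 1"] by (simp only: mult.commute)
          ultimately show "case s' of (r'', m') \<Rightarrow>
            Suc (u + u') \<le> (\<Sum>q\<leftarrow>qs. weight q) * (250 * (n + 1) ^ 2 + 1) + 1 \<and>
            int (r'' 10) - int (r'' 11) = int (r 10) - int (r 11) + (\<Sum>q\<leftarrow>qs. state_value q)"
            using a *(5) by (cases s') simp
        qed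
      qed
    qed
  qed
qed

end

subsection \<open>Degeneracy orders\<close>

lemma vertex_degree_induced:
  assumes E: "\<forall>e\<in>E. card e = 2" and v: "v \<in> R"
  shows "vertex_degree {e \<in> E. e \<subseteq> R} v = card {u \<in> R. {v, u} \<in> E}"
proof -
  have "{e \<in> {e \<in> E. e \<subseteq> R}. v \<in> e} = (\<lambda>u. {v, u}) ` {u \<in> R. {v, u} \<in> E}"
  proof (intro equalityI subsetI)
    fix e assume e: "e \<in> {e \<in> {e \<in> E. e \<subseteq> R}. v \<in> e}"
    then have "card e = 2" using E by auto
    then obtain x y where "e = {x, y}" by (auto simp: card_2_iff)
    then obtain u where "e = {v, u}" using e by auto
    then show "e \<in> (\<lambda>u. {v, u}) ` {u \<in> R. {v, u} \<in> E}" using e by auto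
  qed (use v in auto)
  moreover have "inj_on (\<lambda>u. {v, u}) {u \<in> R. {v, u} \<in> E}" by (auto simp: inj_on_def doubleton_eq_iff)
  ultimately show ?thesis by (simp add: vertex_degree_def card_image)
qed

text \<open>The number of edges bounds every degree in every subgraph, so the least bound is
  attained; it is then applied to the subgraph induced by \<open>R\<close>.\<close>

lemma degeneracy_witness:
  assumes G: "simple_graph V E" and R: "R \<subseteq> V" "R \<noteq> {}"
  shows "\<exists>v\<in>R. card {u \<in> R. {v, u} \<in> E} \<le> degeneracy V E"
proof -
  let ?P = "\<lambda>d. \<forall>V' E'. subgraph V' E' V E \<and> V' \<noteq> {} \<longrightarrow> (\<exists>v\<in>V'. vertex_degree E' v \<le> d)"
  have fin: "finite E"
    using G by (intro finite_subset[of E "Pow V"]) (auto simp: simple_graph_def)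
  have "?P (card E)"
  proof (intro allI impI)
    fix V' E' assume *: "subgraph V' E' V E \<and> V' \<noteq> {}"
    then have "vertex_degree E' v \<le> card E" for v
      unfolding vertex_degree_def using fin by (intro card_mono) (auto simp: subgraph_def)
    then show "\<exists>v\<in>V'. vertex_degree E' v \<le> card E" using * by auto
  qed
  then have "?P (degeneracy V E)" unfolding degeneracy_def by (rule LeastI)
  moreover have "subgraph R {e \<in> E. e \<subseteq> R} V E"
    using G R by (auto simp: subgraph_def simple_graph_def intro: finite_subset)
  ultimately obtain v where "v \<in> R" "vertex_degree {e \<in> E. e \<subseteq> R} v \<le> degeneracy V E"
    using R by blast
  then show ?thesis using vertex_degree_induced[of E v R] G by (auto simp: simple_graph_def)
qed

lemma card_reindex:
  assumes "inj_on \<pi> X"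
  shows "card {q \<in> X. P (\<pi> q)} = card {u \<in> \<pi> ` X. P u}"
proof -
  have "{u \<in> \<pi> ` X. P u} = \<pi> ` {q \<in> X. P (\<pi> q)}" by auto
  moreover have "inj_on \<pi> {q \<in> X. P (\<pi> q)}" using assms by (rule inj_on_subset) auto
  ultimately show ?thesis by (simp add: card_image)
qed

lemma image_swap_values:
  assumes "p \<in> X" "s \<in> X"
  shows "(\<pi>(p := \<pi> s, s := \<pi> p)) ` X = \<pi> ` X" (is "?\<pi> ` X = _")
proof -
  have "\<pi> x \<in> ?\<pi> ` X" if "x \<in> X" for x
  proof -
    have "\<pi> x = ?\<pi> (if x = p then s else if x = s then p else x)" by auto
    then show ?thesis using that assms by (metis imageI)
  qed
  moreover have "?\<pi> x \<in> \<pi> ` X" if "x \<in> X" for x using that assms by auto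
  ultimately show ?thesis by blast
qed

lemma bij_betw_swap_values:
  assumes "bij_betw \<pi> A B" "p \<in> A" "s \<in> A"
  shows "bij_betw (\<pi>(p := \<pi> s, s := \<pi> p)) A B"
proof -
  have "inj_on (\<pi>(p := \<pi> s, s := \<pi> p)) A"
    using assms by (auto simp: bij_betw_def inj_on_def)
  then show ?thesis using assms by (simp add: bij_betw_def image_swap_values del: fun_upd_apply)
qed

definition closed_adj :: "nat set set \<Rightarrow> nat \<Rightarrow> nat \<Rightarrow> bool" where
  "closed_adj E u v \<longleftrightarrow> u = v \<or> {u, v} \<in> E"

lemma closed_adj_sym: "closed_adj E u v \<Longrightarrow> closed_adj E v u"
  by (auto simp: closed_adj_def insert_commute)

text \<open>For a position \<open>q\<close> from \<open>p\<close> to \<open>n - 1\<close> this is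
  one more than its degree among the remaining vertices, since closed adjacency counts the vertex
  itself.\<close>

definition remaining_degree :: "nat set set \<Rightarrow> (nat \<Rightarrow> nat) \<Rightarrow> nat \<Rightarrow> nat \<Rightarrow> nat \<Rightarrow> nat" where
  "remaining_degree E \<pi> n p q = card {x \<in> {p..<n}. closed_adj E (\<pi> q) (\<pi> x)}"

lemma remaining_degree_reindex:
  assumes "inj_on \<pi> {p..<n}"
  shows "remaining_degree E \<pi> n p q = card {u \<in> \<pi> ` {p..<n}. closed_adj E (\<pi> q) u}"
  unfolding remaining_degree_def by (rule card_reindex[OF assms])

text \<open>One round of greedy ordering. The remaining vertices induce a subgraph, so the minimum
  is at most the degeneracy plus 1. For a position \<open>q < p\<close> the swap only permutes the
  vertices after \<open>q\<close>, so numbers of later neighbours fixed earlier stay valid.\<close>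

lemma swap_minimum:
  fixes n :: nat
  assumes G: "simple_graph {..<n} E" and bij: "bij_betw \<pi> {..<n} {..<n}"
    and s: "p \<le> s" "s < n" and min: "\<And>q. p \<le> q \<Longrightarrow> q < n \<Longrightarrow> remaining_degree E \<pi> n p s \<le> remaining_degree E \<pi> n p q"
    and \<pi>': "\<pi>' = \<pi>(p := \<pi> s, s := \<pi> p)"
  shows "bij_betw \<pi>' {..<n} {..<n}"
    and "remaining_degree E \<pi> n p s - 1 \<le> degeneracy {..<n} E"
    and "card {x \<in> {Suc p..<n}. closed_adj E (\<pi>' p) (\<pi>' x)} = remaining_degree E \<pi> n p s - 1"
    and "\<And>q. q < p \<Longrightarrow> card {x \<in> {Suc q..<n}. closed_adj E (\<pi>' q) (\<pi>' x)}
      = card {x \<in> {Suc q..<n}. closed_adj E (\<pi> q) (\<pi> x)}"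
proof -
  have p: "p < n" using s by simp
  show bij': "bij_betw \<pi>' {..<n} {..<n}"
    unfolding \<pi>' using bij p s by (intro bij_betw_swap_values) auto
  have inj: "inj_on \<pi> {q..<n}" "inj_on \<pi>' {q..<n}" for q
    using bij bij' by (auto simp: bij_betw_def intro: inj_on_subset)
  have img: "\<pi>' ` {q..<n} = \<pi> ` {q..<n}" if "q \<le> p" for q
    unfolding \<pi>' using that s p by (intro image_swap_values) auto
  let ?R = "\<pi> ` {p..<n}"
  have R: "?R \<subseteq> {..<n}" "?R \<noteq> {}" using bij p by (auto simp: bij_betw_def)
  obtain v where v: "v \<in> ?R" "card {u \<in> ?R. {v, u} \<in> E} \<le> degeneracy {..<n} E"
    using degeneracy_witness[OF G R] by blast
  then obtain q where q: "p \<le> q" "q < n" "v = \<pi> q" by auto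
  have "{v, v} \<notin> E" using G by (auto simp: simple_graph_def)
  then have "{u \<in> ?R. closed_adj E v u} = insert v {u \<in> ?R. {v, u} \<in> E}" "v \<notin> {u \<in> ?R. {v, u} \<in> E}"
    using v(1) by (auto simp: closed_adj_def)
  then have "remaining_degree E \<pi> n p q = Suc (card {u \<in> ?R. {v, u} \<in> E})"
    unfolding remaining_degree_reindex[OF inj(1)] q(3) by simp
  then show "remaining_degree E \<pi> n p s - 1 \<le> degeneracy {..<n} E"
    using min[OF q(1,2)] v(2) by simp
  have "card {x \<in> {p..<n}. closed_adj E (\<pi>' p) (\<pi>' x)} = remaining_degree E \<pi> n p s"
    unfolding card_reindex[OF inj(2), where P="closed_adj E (\<pi>' p)"] remaining_degree_reindex[OF inj(1)] img[OF order.refl]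
    by (simp add: \<pi>')
  moreover have "{x \<in> {p..<n}. closed_adj E (\<pi>' p) (\<pi>' x)}
      = insert p {x \<in> {Suc p..<n}. closed_adj E (\<pi>' p) (\<pi>' x)}"
    using p by (auto simp: closed_adj_def Suc_le_eq le_less)
  ultimately show "card {x \<in> {Suc p..<n}. closed_adj E (\<pi>' p) (\<pi>' x)} = remaining_degree E \<pi> n p s - 1"
    by simp
  fix q assume q: "q < p"
  then have "\<pi>' q = \<pi> q" using s by (simp add: \<pi>')
  then show "card {x \<in> {Suc q..<n}. closed_adj E (\<pi>' q) (\<pi>' x)}
      = card {x \<in> {Suc q..<n}. closed_adj E (\<pi> q) (\<pi> x)}"
    using q unfolding card_reindex[OF inj(2), where P="closed_adj E (\<pi>' q)"] card_reindex[OF inj(1), where P="closed_adj E (\<pi> q)"]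
    by (simp add: img Suc_le_eq)
qed

lemma Dominating_Set_reindex:
  assumes bij: "bij_betw \<pi> {..<n} {..<n}"
  shows "Dominating_Set {..<n} E k \<longleftrightarrow>
    (\<exists>T\<subseteq>{..<n}. card T \<le> k \<and> (\<forall>x<n. \<exists>u\<in>T. closed_adj E (\<pi> u) (\<pi> x)))"
proof
  assume "Dominating_Set {..<n} E k"
  then obtain S where S: "S \<subseteq> {..<n}" "\<forall>v<n. \<exists>u\<in>S. closed_adj E u v" "card S \<le> k"
    unfolding Dominating_Set_def dominating_set_def closed_adj_def by (metis lessThan_iff)
  let ?T = "{u \<in> {..<n}. \<pi> u \<in> S}"
  have img: "\<pi> ` ?T = S"
  proof (intro equalityI subsetI)
    fix x assume x: "x \<in> S"
    then have "x \<in> \<pi> ` {..<n}" using bij S(1) by (auto simp: bij_betw_def)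
    then show "x \<in> \<pi> ` ?T" using x by auto
  qed auto
  have "inj_on \<pi> ?T" using bij by (auto simp: bij_betw_def intro: inj_on_subset)
  then have "card ?T = card S" using card_image img by metis
  moreover have "\<exists>u\<in>?T. closed_adj E (\<pi> u) (\<pi> x)" if "x < n" for x
  proof -
    have "\<pi> x < n" using bij that by (auto simp: bij_betw_def)
    then obtain w where w: "w \<in> S" "closed_adj E w (\<pi> x)" using S(2) by blast
    then have "w \<in> \<pi> ` ?T" using img by simp
    then show ?thesis using w(2) by blast
  qed
  ultimately show "\<exists>T\<subseteq>{..<n}. card T \<le> k \<and> (\<forall>x<n. \<exists>u\<in>T. closed_adj E (\<pi> u) (\<pi> x))"
    using S(3) by (intro exI[of _ ?T]) auto
next
  assume "\<exists>T\<subseteq>{..<n}. card T \<le> k \<and> (\<forall>x<n. \<exists>u\<in>T. closed_adj E (\<pi> u) (\<pi> x))"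
  then obtain T where T: "T \<subseteq> {..<n}" "card T \<le> k" "\<forall>x<n. \<exists>u\<in>T. closed_adj E (\<pi> u) (\<pi> x)" by blast
  have "dominating_set {..<n} E (\<pi> ` T)"
    unfolding dominating_set_def
  proof (intro conjI ballI)
    show "\<pi> ` T \<subseteq> {..<n}" using bij T(1) by (auto simp: bij_betw_def)
    fix v assume "v \<in> {..<n}"
    then have "v \<in> \<pi> ` {..<n}" using bij by (simp add: bij_betw_def)
    then obtain x where x: "x < n" "v = \<pi> x" by auto
    then obtain u where u: "u \<in> T" "closed_adj E (\<pi> u) v" using T(3) by blast
    then have "\<pi> u \<in> \<pi> ` T" by simp
    then show "v \<in> \<pi> ` T \<or> (\<exists>u\<in>\<pi> ` T. {u, v} \<in> E)"
      using u(2) unfolding closed_adj_def by metis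
  qed
  moreover have "card (\<pi> ` T) \<le> k"
    using T card_image_le[of T \<pi>] finite_subset[OF T(1)] by force
  ultimately show "Dominating_Set {..<n} E k" by (auto simp: Dominating_Set_def)
qed

subsection \<open>Computing a degeneracy order\<close>

definition DEGREE_STEP :: ram where
  "DEGREE_STEP = seqs [ADJ 20 22, Add 25 25 31]"

definition CONSIDER :: ram where
  "CONSIDER = seqs [Const 25 0, Const 24 0, Add 22 18 24, For 22 23 2 DEGREE_STEP,
     Sub 24 13 25, If 24 (seqs [Const 24 0, Add 13 25 24, Add 14 20 24]) Skip]"

text \<open>The initial minimum \<open>n + 1\<close> acts as infinity: no remaining degree exceeds
  \<open>n\<close>, so the first position considered always replaces it.\<close>

definition SELECT_MIN :: ram where
  "SELECT_MIN = seqs [Add 13 2 3, Const 24 0, Add 20 18 24, For 20 21 2 CONSIDER]"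

definition SWAP :: "nat \<Rightarrow> ram" where
  "SWAP i = seqs [Add 24 i 18, Load 25 24, Add 26 i 14, Load 27 26, Store 24 27, Store 26 25]"

text \<open>The minimum counts the vertex itself, hence the decrement. A truncated difference then
  decides whether the running maximum in register 6 has to be raised.\<close>

definition SELECT :: ram where
  "SELECT = seqs [SELECT_MIN, SWAP 4, SWAP 5, Sub 13 13 3, Sub 24 13 6,
     If 24 (seqs [Const 24 0, Add 6 13 24]) Skip]"

definition ORDER :: ram where
  "ORDER = seqs [Const 6 0, Const 18 0, For 18 19 2 SELECT]"

text \<open>Besides filling both tables it sets the diagonal entry to 1, turning adjacency into
  closed adjacency.\<close>

definition ROW :: ram where
  "ROW = seqs [Add 25 4 20, Store 25 24, Add 25 5 20, Store 25 20, Add 25 24 20, Store 25 3, Add 24 24 2]"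

definition LAYOUT :: ram where
  "LAYOUT = seqs [Const 4 2, Const 20 0, For 20 21 2 (Add 4 4 2), Add 5 4 2,
     Const 24 2, Const 20 0, For 20 21 2 ROW]"

lemma vc_SWAP:
  assumes "r i + r 18 < 2 ^ L" "r i + r 14 < 2 ^ L" "i < 14"
    and Q: "\<And>r'. (\<forall>i. i \<notin> {24,25,26,27} \<longrightarrow> r' i = r i) \<Longrightarrow>
      Q 7 (r', m(r i + r 18 := m (r i + r 14), r i + r 14 := m (r i + r 18)))"
  shows "vc L (SWAP i) Q (r, m)"
proof -
  have "Q (Suc (Suc (Suc (Suc (Suc (Suc (Suc 0))))))) (r(24 := r i + r 18, 25 := m (r i + r 18), 26 := r i + r 14, 27 := m (r i + r 14)),
      m(r i + r 18 := m (r i + r 14), r i + r 14 := m (r i + r 18)))"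
    using Q[of "r(24 := r i + r 18, 25 := m (r i + r 18), 26 := r i + r 14, 27 := m (r i + r 14))"]
    by (simp add: numeral_eq_Suc)
  then show ?thesis using assms(1-3) by (simp add: SWAP_def)
qed

lemma matrix_index_inj:
  fixes n :: nat
  assumes "j < n" "q < n" "n * i + j = n * p + q"
  shows "i = p \<and> j = q"
proof -
  have "(n * i + j) div n = i" "(n * p + q) div n = p" "(n * i + j) mod n = j" "(n * p + q) mod n = q"
    using assms(1,2) by auto
  then show ?thesis using assms(3) by metis
qed

lemma matrix_index_less:
  fixes n :: nat
  assumes "i < n" "j < n"
  shows "n * i + j < n * n"
proof -
  have "n * i + j < n * Suc i" using assms by simp
  also have "\<dots> \<le> n * n" using assms by (intro mult_le_mono2) simp
  finally show ?thesis .
qed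

text \<open>After \<open>k\<close> and \<open>n\<close> in cells 0 and 1 come the matrix, the row
  addresses, the vertices and finally the queue.\<close>

locale instance_layout =
  fixes n L RB OB QB :: nat and E :: "nat set set"
  assumes G: "simple_graph {..<n} E" and n: "0 < n"
    and RB: "RB = 2 + n * n" and OB: "OB = RB + n" and QB: "QB = OB + n" and L: "QB < 2 ^ L"
begin

text \<open>Only the two tables follow the permutation; the matrix never moves. The zeros from
  \<open>QB\<close> on will serve as the untouched part of the initial state.\<close>

definition ord_mem :: "(nat \<Rightarrow> nat) \<Rightarrow> (nat \<Rightarrow> nat) \<Rightarrow> bool" where
  "ord_mem m \<pi> \<longleftrightarrow> bij_betw \<pi> {..<n} {..<n} \<and> (\<forall>j<n. m (RB + j) = 2 + n * \<pi> j \<and> m (OB + j) = \<pi> j) \<and>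
    (\<forall>i<n. \<forall>j<n. m (2 + n * i + j) = of_bool (closed_adj E i j)) \<and> (\<forall>x\<ge>QB. m x = 0)"

lemma index_less: "i < n \<Longrightarrow> j < n \<Longrightarrow> 2 + n * i + j < RB"
  using matrix_index_less[of i n j] by (simp add: RB)

lemma layout: "layout n L RB OB QB"
  by unfold_locales (use L n in \<open>auto simp: QB OB RB\<close>)

lemma ord_mem_adj:
  assumes "ord_mem m \<pi>"
  shows "layout.adj_mem n (\<lambda>p q. closed_adj E (\<pi> p) (\<pi> q)) RB OB QB m"
proof -
  interpret layout n "\<lambda>p q. closed_adj E (\<pi> p) (\<pi> q)" L RB OB QB by (rule layout)
  have "\<pi> p < n" if "p < n" for p using assms that by (auto simp: ord_mem_def bij_betw_def)
  then have "2 + n * \<pi> p + \<pi> q < QB" if "p < n" "q < n" for p q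
    using index_less[of "\<pi> p" "\<pi> q"] that by (simp add: QB OB)
  then show ?thesis using assms \<open>\<And>p. p < n \<Longrightarrow> \<pi> p < n\<close> unfolding adj_mem_def ord_mem_def by simp
qed

lemma vc_ADJ_ord:
  assumes "ord_mem m \<pi>" "r p < n" "r q < n" "r 4 = RB" "r 5 = OB" "p < 30" "q < 30"
  shows "vc L (ADJ p q) Q (r, m) =
    Q 7 (r(30 := m (OB + r q), 31 := of_bool (closed_adj E (\<pi> (r p)) (\<pi> (r q)))), m)"
proof -
  interpret layout n "\<lambda>p q. closed_adj E (\<pi> p) (\<pi> q)" L RB OB QB by (rule layout)
  show ?thesis using assms(2-) ord_mem_adj[OF assms(1)] by (intro vc_ADJ)
qed

lemma n_bound: "n + 2 < 2 ^ L"
  using L by (simp add: QB OB RB)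

lemma remaining_degree_le: "remaining_degree E \<pi> n p q \<le> n"
proof -
  have "remaining_degree E \<pi> n p q \<le> card {p..<n}"
    unfolding remaining_degree_def by (rule card_mono) auto
  then show ?thesis by simp
qed

lemma vc_CONSIDER:
  assumes regs: "r 2 = n" "r 3 = 1" "r 4 = RB" "r 5 = OB" "r 18 = p" "r 20 = q" "p \<le> q" "q < n"
    and m: "ord_mem m \<pi>"
    and Q: "\<And>u r'. u \<le> 20 * n + 20 \<Longrightarrow> (\<forall>i. i \<notin> {13,14,22,23,24,25,30,31} \<longrightarrow> r' i = r i) \<Longrightarrow>
      (if remaining_degree E \<pi> n p q < r 13 then r' 13 = remaining_degree E \<pi> n p q \<and> r' 14 = q
       else r' 13 = r 13 \<and> r' 14 = r 14) \<Longrightarrow> Q u (r', m)"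
  shows "vc L CONSIDER Q (r, m)"
proof -
  define I where "I = (\<lambda>j (r', m'). (\<forall>i. i \<notin> {22,23,24,25,30,31} \<longrightarrow> r' i = r i) \<and> m' = m \<and>
     p \<le> j \<and> r' 25 = card {x \<in> {p..<j}. closed_adj E (\<pi> q) (\<pi> x)})"
  have body: "vc L DEGREE_STEP (\<lambda>u (r', m'). u \<le> 15 \<and> r' 22 = j \<and> r' 2 = n \<and> r' 3 = 1 \<and>
      I (Suc j) (r'(22 := Suc j), m')) (r', m')"
    if inv: "I j (r', m')" and j: "j < n" "r' 22 = j" for j r' m'
  proof -
    have r': "\<forall>i. i \<notin> {22,23,24,25,30,31} \<longrightarrow> r' i = r i" "m' = m" "p \<le> j"
      "r' 25 = card {x \<in> {p..<j}. closed_adj E (\<pi> q) (\<pi> x)}"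
      using inv by (simp_all add: I_def)
    have "card {x \<in> {p..<j}. closed_adj E (\<pi> q) (\<pi> x)} \<le> card {p..<j}" by (rule card_mono) auto
    then have le: "Suc (r' 25) < 2 ^ L" "r' 25 < 2 ^ L" using r' j n_bound by auto
    have "{x \<in> {p..<Suc j}. closed_adj E (\<pi> q) (\<pi> x)} = (if closed_adj E (\<pi> q) (\<pi> j)
        then insert j {x \<in> {p..<j}. closed_adj E (\<pi> q) (\<pi> x)} else {x \<in> {p..<j}. closed_adj E (\<pi> q) (\<pi> x)})"
      using r'(3) by (auto simp: less_Suc_eq)
    then have card: "card {x \<in> {p..<Suc j}. closed_adj E (\<pi> q) (\<pi> x)} = r' 25 + of_bool (closed_adj E (\<pi> q) (\<pi> j))"
      using r'(4) by simp
    show ?thesis using r'(1-3) le regs j card m by (simp add: DEGREE_STEP_def I_def vc_ADJ_ord)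
  qed
  have q: "q < 2 ^ L" "p < 2 ^ L" "remaining_degree E \<pi> n p q < 2 ^ L"
    using regs(7,8) n_bound remaining_degree_le[of \<pi> p q] by auto
  show ?thesis
    unfolding CONSIDER_def using regs n_bound q
    apply simp
    apply (rule vc_For[where N=n and \<tau>=15 and I=I])
    subgoal by (simp add: I_def)
    subgoal by simp
    subgoal by simp
    subgoal by simp
    subgoal by (simp add: I_def)
    subgoal by (rule body)
    subgoal by simp
    subgoal by simp
    subgoal by simp
    subgoal for u r' m'
      unfolding I_def remaining_degree_def[symmetric]
      apply simp
      apply (intro conjI impI; rule Q)
           apply simp_all
      done
    done
qed

lemma vc_SELECT_MIN:
  assumes regs: "r 2 = n" "r 3 = 1" "r 4 = RB" "r 5 = OB" "r 18 = p" "p < n"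
    and m: "ord_mem m \<pi>"
    and Q: "\<And>u r'. u \<le> n * (20 * n + 23) + 10 \<Longrightarrow>
      (\<forall>i. i \<notin> {13,14,20,21,22,23,24,25,30,31} \<longrightarrow> r' i = r i) \<Longrightarrow> p \<le> r' 14 \<Longrightarrow> r' 14 < n \<Longrightarrow>
      r' 13 = remaining_degree E \<pi> n p (r' 14) \<Longrightarrow>
      (\<And>q. p \<le> q \<Longrightarrow> q < n \<Longrightarrow> r' 13 \<le> remaining_degree E \<pi> n p q) \<Longrightarrow> Q u (r', m)"
  shows "vc L SELECT_MIN Q (r, m)"
proof -
  let ?deg = "remaining_degree E \<pi> n p"
  define I where "I = (\<lambda>j (r', m'). (\<forall>i. i \<notin> {13,14,20,21,22,23,24,25,30,31} \<longrightarrow> r' i = r i) \<and> m' = m \<and>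
     p \<le> j \<and> (if j = p then r' 13 = Suc n else p \<le> r' 14 \<and> r' 14 < j \<and> r' 13 = ?deg (r' 14)) \<and>
     (\<forall>q. p \<le> q \<and> q < j \<longrightarrow> r' 13 \<le> ?deg q))"
  have body: "vc L CONSIDER (\<lambda>u (r', m'). u \<le> 20 * n + 20 \<and> r' 20 = j \<and> r' 2 = n \<and> r' 3 = 1 \<and>
      I (Suc j) (r'(20 := Suc j), m')) (r', m')"
    if inv: "I j (r', m')" and j: "j < n" "r' 20 = j" for j r' m'
  proof -
    have r': "\<forall>i. i \<notin> {13,14,20,21,22,23,24,25,30,31} \<longrightarrow> r' i = r i" "m' = m" "p \<le> j"
      "if j = p then r' 13 = Suc n else p \<le> r' 14 \<and> r' 14 < j \<and> r' 13 = ?deg (r' 14)"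
      "\<forall>q. p \<le> q \<and> q < j \<longrightarrow> r' 13 \<le> ?deg q"
      using inv unfolding I_def prod.case by blast+
    show ?thesis unfolding r'(2)
    proof (rule vc_CONSIDER[where p=p and q=j and \<pi>=\<pi>])
      fix u r''
      assume *: "u \<le> 20 * n + 20" "\<forall>i. i \<notin> {13,14,22,23,24,25,30,31} \<longrightarrow> r'' i = r' i"
        "if ?deg j < r' 13 then r'' 13 = ?deg j \<and> r'' 14 = j else r'' 13 = r' 13 \<and> r'' 14 = r' 14"
      have "?deg j < r' 13" if "j = p" using r'(4) remaining_degree_le[of \<pi> p j] that by simp
      then have "if Suc j = p then r'' 13 = Suc n else p \<le> r'' 14 \<and> r'' 14 < Suc j \<and> r'' 13 = ?deg (r'' 14)"
        using * r'(3,4) by (auto split: if_splits)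
      moreover have "r'' 13 \<le> ?deg q" if "p \<le> q" "q < Suc j" for q
      proof (cases "q = j")
        case True
        then show ?thesis using *(3) by (auto split: if_splits)
      next
        case False
        then have "r' 13 \<le> ?deg q" using r'(5) that by auto
        then show ?thesis using *(3) by (auto split: if_splits)
      qed
      ultimately have "I (Suc j) (r''(20 := Suc j), m)"
        using * r'(1,3) by (simp add: I_def)
      then show "case (r'', m) of (r', m') \<Rightarrow> u \<le> 20 * n + 20 \<and> r' 20 = j \<and> r' 2 = n \<and> r' 3 = 1 \<and>
          I (Suc j) (r'(20 := Suc j), m')"
        using * r'(1) j regs by simp
    qed (use r'(1,3) regs j m in auto)
  qed
  have frame: "I j (r'(21 := y), m') = I j (r', m')" for j r' m' y
    unfolding I_def by simp
  show ?thesis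
    unfolding SELECT_MIN_def using regs n_bound
    apply simp
    apply (rule vc_For[where N=n and \<tau>="20 * n + 20" and I=I])
    subgoal by (simp add: I_def)
    subgoal by simp
    subgoal by simp
    subgoal by simp
    subgoal by (simp only: frame)
    subgoal by (rule body)
    subgoal by simp
    subgoal by simp
    subgoal by simp
    subgoal for u r' m'
    proof -
      assume a: "I n (r', m')" "u \<le> (n - (r(13 := Suc n, 24 := 0, 20 := p)) 20) * (20 * n + 20 + 3) + 2"
      have "(n - p) * (20 * n + 23) \<le> n * (20 * n + 23)" by (intro mult_le_mono1) simp
      then have u: "u + 6 \<le> n * (20 * n + 23) + 10" using a(2) by (simp add: algebra_simps)
      have i: "\<forall>i. i \<notin> {13,14,20,21,22,23,24,25,30,31} \<longrightarrow> r' i = r i" "m' = m"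
        "p \<le> r' 14" "r' 14 < n" "r' 13 = ?deg (r' 14)" "\<And>q. p \<le> q \<Longrightarrow> q < n \<Longrightarrow> r' 13 \<le> ?deg q"
        using a(1) \<open>p < n\<close> unfolding I_def prod.case by (auto split: if_splits)
      show ?thesis
        unfolding i(2)
        apply simp
        apply (rule Q[OF _ i(1,3-6)])
        using u by simp_all
    qed
    done
qed

lemma ord_mem_swap:
  assumes m: "ord_mem m \<pi>" and p: "p < n" "s < n"
  shows "ord_mem (m(RB + p := m (RB + s), RB + s := m (RB + p), OB + p := m (OB + s), OB + s := m (OB + p)))
    (\<pi>(p := \<pi> s, s := \<pi> p))"
  (is "ord_mem ?m ?\<pi>")
proof -
  have mj: "m (RB + j) = 2 + n * \<pi> j" "m (OB + j) = \<pi> j" if "j < n" for j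
    using m that by (simp_all add: ord_mem_def)
  have "bij_betw ?\<pi> {..<n} {..<n}"
    using m p by (intro bij_betw_swap_values) (auto simp: ord_mem_def)
  moreover have "?m (RB + j) = 2 + n * ?\<pi> j \<and> ?m (OB + j) = ?\<pi> j" if "j < n" for j
    using mj p that by (auto simp: OB)
  moreover have "?m (2 + n * i + j) = of_bool (closed_adj E i j)" if "i < n" "j < n" for i j
  proof -
    have "m (2 + n * i + j) = of_bool (closed_adj E i j)" using m that by (simp add: ord_mem_def)
    then show ?thesis using index_less[OF that] by (simp add: OB)
  qed
  moreover have "?m x = 0" if "QB \<le> x" for x
  proof -
    have "m x = 0" using m that by (simp add: ord_mem_def)
    then show ?thesis using p that by (simp add: OB QB)
  qed
  ultimately show ?thesis unfolding ord_mem_def by blast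
qed

text \<open>Register 6 gets two upper bounds: the degeneracy for the running time and
  \<open>n\<close> for the word length.\<close>

lemma vc_SELECT:
  assumes regs: "r 2 = n" "r 3 = 1" "r 4 = RB" "r 5 = OB" "r 18 = p" "p < n" "r 6 < 2 ^ L"
    and m: "ord_mem m \<pi>"
    and Q: "\<And>u r' m' \<pi>'. u \<le> n * (20 * n + 23) + 40 \<Longrightarrow>
      (\<forall>i. i \<notin> {6,13,14,20,21,22,23,24,25,26,27,30,31} \<longrightarrow> r' i = r i) \<Longrightarrow> ord_mem m' \<pi>' \<Longrightarrow>
      r 6 \<le> r' 6 \<Longrightarrow> r' 6 \<le> max (r 6) (degeneracy {..<n} E) \<Longrightarrow> r' 6 \<le> max (r 6) n \<Longrightarrow>
      card {x \<in> {Suc p..<n}. closed_adj E (\<pi>' p) (\<pi>' x)} \<le> r' 6 \<Longrightarrow>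
      (\<And>q. q < p \<Longrightarrow> card {x \<in> {Suc q..<n}. closed_adj E (\<pi>' q) (\<pi>' x)}
        = card {x \<in> {Suc q..<n}. closed_adj E (\<pi> q) (\<pi> x)}) \<Longrightarrow> Q u (r', m')"
  shows "vc L SELECT Q (r, m)"
proof -
  have sum: "RB + j < 2 ^ L" "OB + j < 2 ^ L" if "j < n" for j
    using that L by (auto simp: QB OB)
  show ?thesis
    unfolding SELECT_def
    apply simp
    apply (rule vc_SELECT_MIN[OF regs(1-6) m])
    subgoal premises prems for u r1
    proof -
      define s where "s = r1 14"
      define \<pi>' where "\<pi>' = \<pi>(p := \<pi> s, s := \<pi> p)"
      define m' where "m' = m(RB + p := m (RB + s), RB + s := m (RB + p), OB + p := m (OB + s), OB + s := m (OB + p))"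
      have s: "p \<le> s" "s < n" using prems by (simp_all add: s_def)
      have deg: "r1 13 = remaining_degree E \<pi> n p s" using prems by (simp add: s_def)
      have bij: "bij_betw \<pi> {..<n} {..<n}" using m by (simp add: ord_mem_def)
      have min: "\<And>q. p \<le> q \<Longrightarrow> q < n \<Longrightarrow> remaining_degree E \<pi> n p s \<le> remaining_degree E \<pi> n p q"
        using prems(6) deg by simp
      note sw = swap_minimum[OF G bij s min \<pi>'_def]
      have om: "ord_mem m' \<pi>'" unfolding m'_def \<pi>'_def by (rule ord_mem_swap[OF m regs(6) s(2)])
      have dn: "r1 13 \<le> n" using deg remaining_degree_le by simp
      have fr: "\<forall>i. i \<notin> {13,14,20,21,22,23,24,25,30,31} \<longrightarrow> r1 i = r i" by (rule prems(2))
      have mm: "m(RB + p := m (RB + s), RB + s := m (RB + p),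
          OB + p := (m(RB + p := m (RB + s), RB + s := m (RB + p))) (OB + s),
          OB + s := (m(RB + p := m (RB + s), RB + s := m (RB + p))) (OB + p)) = m'"
        unfolding m'_def using s regs(6) by (simp add: OB)
      have fin: "Q u' (r', m')"
        if "u' \<le> n * (20 * n + 23) + 40" "\<forall>i. i \<notin> {6,13,14,20,21,22,23,24,25,26,27,30,31} \<longrightarrow> r' i = r i"
          "r' 6 = max (r 6) (r1 13 - 1)" for u' r'
        by (rule Q[OF that(1,2) om]) (use that(3) sw(2-4) deg dn in auto)
      show ?thesis
        apply simp
        apply (rule vc_SWAP)
        subgoal using fr sum(1)[OF regs(6)] regs by simp
        subgoal using fr sum(1)[OF s(2)] regs by (simp add: s_def)
        subgoal by simp
        subgoal premises r2 for r2
          apply simp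
          apply (rule vc_SWAP)
          subgoal using fr r2 sum(2)[OF regs(6)] regs by simp
          subgoal using fr r2 sum(2)[OF s(2)] regs by (simp add: s_def)
          subgoal by simp
          subgoal premises r3 for r3
          proof -
            have eqs: "r1 4 = RB" "r2 5 = OB" "r1 18 = p" "r2 18 = p" "r2 14 = s" "r1 14 = s"
              "r3 13 = r1 13" "r3 3 = 1" "r3 6 = r 6"
              using fr r2 r3 regs by (simp_all add: s_def)
            have fr3: "\<forall>i. i \<notin> {13,14,20,21,22,23,24,25,26,27,30,31} \<longrightarrow> r3 i = r i"
              using fr r2 r3 by simp
            show ?thesis
              unfolding eqs(1-6) mm
              using eqs(7-) fr3 dn n_bound prems(1)
              apply simp
              apply (intro conjI impI; (rule fin)?)
                    apply auto
              done
          qed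
          done
        done
    qed
    done
qed

lemma vc_ORDER:
  assumes regs: "r 2 = n" "r 3 = 1" "r 4 = RB" "r 5 = OB" and m: "ord_mem m \<pi>"
    and Q: "\<And>u r' m' \<pi>'. u \<le> n * (n * (20 * n + 23) + 43) + 10 \<Longrightarrow>
      (\<forall>i<6. r' i = r i) \<Longrightarrow> ord_mem m' \<pi>' \<Longrightarrow> r' 6 \<le> degeneracy {..<n} E \<Longrightarrow> r' 6 \<le> n \<Longrightarrow>
      (\<And>q. q < n \<Longrightarrow> card {x \<in> {Suc q..<n}. closed_adj E (\<pi>' q) (\<pi>' x)} \<le> r' 6) \<Longrightarrow> Q u (r', m')"
  shows "vc L ORDER Q (r, m)"
proof -
  define I where "I = (\<lambda>j (r', m'). (\<forall>i<6. r' i = r i) \<and> r' 6 \<le> degeneracy {..<n} E \<and> r' 6 \<le> n \<and>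
     (\<exists>\<pi>. ord_mem m' \<pi> \<and> (\<forall>q<j. card {x \<in> {Suc q..<n}. closed_adj E (\<pi> q) (\<pi> x)} \<le> r' 6)))"
  have body: "vc L SELECT (\<lambda>u (r', m'). u \<le> n * (20 * n + 23) + 40 \<and> r' 18 = j \<and> r' 2 = n \<and> r' 3 = 1 \<and>
      I (Suc j) (r'(18 := Suc j), m')) (r', m')"
    if inv: "I j (r', m')" and j: "j < n" "r' 18 = j" for j r' m'
  proof -
    obtain \<pi> where \<pi>: "ord_mem m' \<pi>" "\<forall>q<j. card {x \<in> {Suc q..<n}. closed_adj E (\<pi> q) (\<pi> x)} \<le> r' 6"
      and r': "\<forall>i<6. r' i = r i" "r' 6 \<le> degeneracy {..<n} E" "r' 6 \<le> n"
      using inv unfolding I_def by auto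
    show ?thesis
    proof (rule vc_SELECT[where p=j and \<pi>=\<pi>])
      fix u r'' m'' \<pi>'
      assume *: "u \<le> n * (20 * n + 23) + 40"
        "\<forall>i. i \<notin> {6,13,14,20,21,22,23,24,25,26,27,30,31} \<longrightarrow> r'' i = r' i" "ord_mem m'' \<pi>'"
        "r' 6 \<le> r'' 6" "r'' 6 \<le> max (r' 6) (degeneracy {..<n} E)" "r'' 6 \<le> max (r' 6) n"
        "card {x \<in> {Suc j..<n}. closed_adj E (\<pi>' j) (\<pi>' x)} \<le> r'' 6"
        "\<And>q. q < j \<Longrightarrow> card {x \<in> {Suc q..<n}. closed_adj E (\<pi>' q) (\<pi>' x)}
        = card {x \<in> {Suc q..<n}. closed_adj E (\<pi> q) (\<pi> x)}"
      have "card {x \<in> {Suc q..<n}. closed_adj E (\<pi>' q) (\<pi>' x)} \<le> r'' 6" if "q < Suc j" for q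
      proof (cases "q = j")
        case False
        then have "q < j" using that by simp
        then show ?thesis using *(4) *(8)[of q] \<pi>(2)[rule_format, of q] by linarith
      qed (use *(7) in simp)
      then have "\<exists>\<pi>. ord_mem m'' \<pi> \<and> (\<forall>q<Suc j. card {x \<in> {Suc q..<n}. closed_adj E (\<pi> q) (\<pi> x)} \<le> r'' 6)"
        using *(3) by blast
      then have "I (Suc j) (r''(18 := Suc j), m'')"
        using *(2,5,6) r' unfolding I_def by simp
      then show "case (r'', m'') of (r', m') \<Rightarrow> u \<le> n * (20 * n + 23) + 40 \<and> r' 18 = j \<and> r' 2 = n \<and> r' 3 = 1 \<and>
          I (Suc j) (r'(18 := Suc j), m')"
        using *(1,2) r'(1) j regs by simp
    qed (use r' \<pi> regs j n_bound in auto)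
  qed
  have frame: "I j (r'(19 := y), m') = I j (r', m')" for j r' m' y
    unfolding I_def by simp
  have init: "I 0 (r(6 := 0, 18 := 0), m)" using m unfolding I_def by auto
  show ?thesis
    unfolding ORDER_def using regs n_bound
    apply simp
    apply (rule vc_For[where N=n and \<tau>="n * (20 * n + 23) + 40" and I=I])
    subgoal using init by simp
    subgoal by simp
    subgoal by simp
    subgoal by simp
    subgoal by (simp only: frame)
    subgoal by (rule body)
    subgoal by simp
    subgoal by simp
    subgoal by simp
    subgoal for u r' m'
    proof -
      assume a: "I n (r', m')" "u \<le> (n - (r(6 := 0, 18 := 0)) 18) * (n * (20 * n + 23) + 40 + 3) + 2"
      then obtain \<pi>' where "ord_mem m' \<pi>'" "\<forall>q<n. card {x \<in> {Suc q..<n}. closed_adj E (\<pi>' q) (\<pi>' x)} \<le> r' 6"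
        and "\<forall>i<6. r' i = r i" "r' 6 \<le> degeneracy {..<n} E" "r' 6 \<le> n"
        unfolding I_def by auto
      then show ?thesis using a(2) by (auto simp: algebra_simps intro!: Q)
    qed
    done
qed

lemma vc_LAYOUT:
  assumes regs: "r 2 = n" "r 3 = 1"
    and m: "\<forall>i<n. \<forall>j<n. m (2 + n * i + j) = of_bool ({i, j} \<in> E)" "\<forall>x\<ge>2 + n * n. m x = 0"
    and Q: "\<And>u r' m'. u \<le> 20 * n + 20 \<Longrightarrow> (\<forall>i<4. r' i = r i) \<Longrightarrow> r' 4 = RB \<Longrightarrow> r' 5 = OB \<Longrightarrow>
      ord_mem m' id \<Longrightarrow> Q u (r', m')"
  shows "vc L LAYOUT Q (r, m)"
proof -
  define I1 where "I1 = (\<lambda>j (r', m'). (\<forall>i<4. r' i = r i) \<and> m' = m \<and> r' 4 = 2 + n * j)"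
  have body1: "vc L (Add 4 4 2) (\<lambda>u (r', m'). u \<le> 1 \<and> r' 20 = j \<and> r' 2 = n \<and> r' 3 = 1 \<and>
      I1 (Suc j) (r'(20 := Suc j), m')) (r', m')"
    if inv: "I1 j (r', m')" and j: "j < n" "r' 20 = j" for j r' m'
  proof -
    have "n * Suc j \<le> n * n" using j by (intro mult_le_mono2) simp
    then have "2 + n * j + n < 2 ^ L" using L by (simp add: QB OB RB)
    then show ?thesis using inv j regs by (simp add: I1_def)
  qed
  define I where "I = (\<lambda>p (r', m'). (\<forall>i<4. r' i = r i) \<and> r' 4 = RB \<and> r' 5 = OB \<and> r' 24 = 2 + n * p \<and>
     (\<forall>j<p. m' (RB + j) = 2 + n * j \<and> m' (OB + j) = j) \<and>
     (\<forall>i<n. \<forall>j<n. m' (2 + n * i + j) = of_bool (i = j \<and> i < p \<or> {i, j} \<in> E)) \<and> (\<forall>x\<ge>QB. m' x = 0))"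
  have body: "vc L ROW (\<lambda>u (r', m'). u \<le> 10 \<and> r' 20 = p \<and> r' 2 = n \<and> r' 3 = 1 \<and>
      I (Suc p) (r'(20 := Suc p), m')) (r', m')"
    if inv: "I p (r', m')" and p: "p < n" "r' 20 = p" for p r' m'
  proof -
    have r': "\<forall>i<4. r' i = r i" "r' 4 = RB" "r' 5 = OB" "r' 24 = 2 + n * p"
      and m': "\<forall>j<p. m' (RB + j) = 2 + n * j \<and> m' (OB + j) = j"
      "\<forall>i<n. \<forall>j<n. m' (2 + n * i + j) = of_bool (i = j \<and> i < p \<or> {i, j} \<in> E)" "\<forall>x\<ge>QB. m' x = 0"
      using inv by (simp_all add: I_def)
    have "n * Suc p \<le> n * n" using p by (intro mult_le_mono2) simp
    then have b: "2 + n * p + n < 2 ^ L" "2 + n * p + p < RB" "RB + p < 2 ^ L" "OB + p < 2 ^ L"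
      using L p by (simp_all add: QB OB RB)
    define m'' where "m'' = m'(RB + p := 2 + n * p, OB + p := p, 2 + n * p + p := 1)"
    have "m'' (RB + j) = 2 + n * j \<and> m'' (OB + j) = j" if "j < Suc p" for j
      using that m'(1) p b(2) by (auto simp: m''_def OB less_Suc_eq)
    moreover have "m'' (2 + n * i + j) = of_bool (i = j \<and> i < Suc p \<or> {i, j} \<in> E)" if "i < n" "j < n" for i j
    proof (cases "i = p \<and> j = p")
      case True
      then show ?thesis by (simp add: m''_def)
    next
      case False
      then have "2 + n * i + j \<noteq> 2 + n * p + p" using matrix_index_inj[OF that(2) p(1), of i p] by auto
      then have "m'' (2 + n * i + j) = m' (2 + n * i + j)"
        using index_less[OF that] by (auto simp: m''_def OB)
      then show ?thesis using m'(2) that False by (auto simp: less_Suc_eq)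
    qed
    moreover have "m'' x = 0" if "QB \<le> x" for x
      using m'(3) that p b(2) by (auto simp: m''_def QB OB)
    ultimately have "I (Suc p) (r'', m'')" if "\<forall>i<4. r'' i = r i" "r'' 4 = RB" "r'' 5 = OB"
      "r'' 24 = 2 + n * Suc p" for r''
      using that unfolding I_def by blast
    then show ?thesis using r' p b regs by (simp add: ROW_def m''_def)
  qed
  show ?thesis
    unfolding LAYOUT_def using regs n_bound
    apply simp
    apply (rule vc_For[where N=n and \<tau>=1 and I=I1])
    subgoal by (simp add: I1_def)
    subgoal by simp
    subgoal by simp
    subgoal by simp
    subgoal by (simp add: I1_def)
    subgoal by (rule body1)
    subgoal by simp
    subgoal by simp
    subgoal by simp
    subgoal premises prems for u1 r1 m1
    proof -
      have r1: "\<forall>i<4. r1 i = r i" "m1 = m" "r1 4 = RB" using prems by (simp_all add: I1_def RB)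
      have u1: "u1 \<le> 4 * n + 2" using prems by simp
      have OBL: "RB + n < 2 ^ L" using L by (simp add: QB OB)
      have init: "I 0 (r1(5 := OB, 24 := 2, 20 := 0), m1)"
        unfolding I_def using r1 m by (auto simp: QB OB RB)
      show ?thesis
        using regs n_bound r1 OBL
        apply (simp add: OB[symmetric])
        apply (rule vc_For[where N=n and \<tau>=10 and I=I])
        subgoal using init by simp
        subgoal by simp
        subgoal by simp
        subgoal by simp
        subgoal by (simp add: I_def)
        subgoal by (rule body)
        subgoal by simp
        subgoal by simp
        subgoal by simp
        subgoal premises a for u r' m'
        proof -
          have i: "I n (r', m')" by (rule a)
          have "ord_mem m' id"
            using i unfolding ord_mem_def I_def closed_adj_def by (auto simp: bij_betw_def)
          then show ?thesis using i a u1 unfolding I_def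
            apply simp
            apply (rule Q)
                apply simp_all
            done
        qed
        done
    qed
    done
qed

end

subsection \<open>The complete program\<close>

text \<open>Zero cells already encode \<open>v = 0\<close> and a graph without dominated vertices,
  so only \<open>k\<close> and the budget are stored; the budget is formed by \<open>k\<close>
  additions of \<open>d\<close>.\<close>

definition INIT :: ram where
  "INIT = seqs [Const 24 3, Add 7 2 24, Add 8 5 2, Add 24 8 2, Add 24 24 3, Store 24 1,
     Const 25 0, Const 20 0, For 20 21 1 (Add 25 25 6), Add 24 24 3, Store 24 25,
     Add 9 8 7, Sub 29 9 8, Const 10 0, Const 11 0]"

definition SOLVE :: ram where
  "SOLVE = seqs [LAYOUT, ORDER, INIT, While 29 STEP, Sub 0 10 11]"

text \<open>If \<open>k \<ge> n\<close>, the set of all vertices is a solution. Otherwise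
  \<open>k < n\<close>, which also guarantees a nonempty graph.\<close>

definition DOMINATING_SET :: ram where
  "DOMINATING_SET = seqs [Const 3 1, Const 24 0, Load 1 24, Load 2 3, Sub 24 2 1, If 24 SOLVE (Const 0 1)]"

lemma (in machine) vc_INIT:
  assumes regs: "r 1 = K" "r 2 = n" "r 3 = 1" "r 4 = RB" "r 5 = OB" "r 6 = d"
    and QB: "QB = OB + n" "QB + (n + 3) < 2 ^ L" and K: "K < 2 ^ L" "d * K < 2 ^ L"
    and m: "adj_mem m" "\<forall>x\<ge>QB. m x = 0"
    and Q: "\<And>u r' m'. u \<le> 4 * K + 20 \<Longrightarrow> queue r' m' [(0, K, d * K, {}, {})] \<Longrightarrow> r' 8 = QB \<Longrightarrow>
      r' 29 = n + 3 \<Longrightarrow> r' 10 = 0 \<Longrightarrow> r' 11 = 0 \<Longrightarrow> Q u (r', m')"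
  shows "vc L INIT Q (r, m)"
proof -
  define m1 where "m1 = m(Suc (QB + n) := K)"
  define I where "I = (\<lambda>j (r', m'). (\<forall>i<7. r' i = r i) \<and> r' 7 = n + 3 \<and> r' 8 = QB \<and> r' 24 = Suc (QB + n) \<and>
    m' = m1 \<and> r' 25 = d * j)"
  have body: "vc L (Add 25 25 6) (\<lambda>u (r', m'). u \<le> 1 \<and> r' 20 = j \<and> r' (Suc 0) = K \<and> r' 3 = 1 \<and>
      I (Suc j) (r'(20 := Suc j), m')) (r', m')"
    if inv: "I j (r', m')" and j: "j < K" "r' 20 = j" for j r' m'
  proof -
    have "d * Suc j \<le> d * K" using j by (intro mult_le_mono2) simp
    then have "d * j + d < 2 ^ L" using K by simp
    then show ?thesis using inv j regs by (simp add: I_def)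
  qed
  have q: "queue r' (m1(Suc (Suc (QB + n)) := d * K)) [(0, K, d * K, {}, {})]"
    if "\<forall>i<7. r' i = r i" "r' 7 = n + 3" "r' 8 = QB" "r' 9 = QB + (n + 3)" for r'
    using that regs m unfolding queue_def m1_def by (simp add: repr.simps)
  show ?thesis
    unfolding INIT_def using regs QB bases
    apply (simp add: QB(1)[symmetric])
    apply (rule vc_For[where N=K and \<tau>=1 and I=I])
    subgoal by (simp add: I_def m1_def)
    subgoal by simp
    subgoal by simp
    subgoal using K by simp
    subgoal by (simp add: I_def)
    subgoal by (rule body)
    subgoal by simp
    subgoal by simp
    subgoal by simp
    subgoal premises prems for u r' m'
    proof -
      have r': "\<forall>i<7. r' i = r i" "r' 7 = n + 3" "r' 8 = QB" "r' 24 = Suc (QB + n)" "m' = m1" "r' 25 = d * K"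
        and u: "u \<le> 4 * K + 2"
        using prems by (simp_all add: I_def)
      show ?thesis
        unfolding r'(5) using r'(1-4,6) u regs QB(2)
        apply simp
        apply (rule Q)
             apply simp_all
        apply (rule q)
           apply simp_all
        done
    qed
    done
qed

context instance_layout
begin

text \<open>In the bound on \<open>2 ^ L\<close>, \<open>(n + 1) * 3 ^ (n * n)\<close> bounds the
  number of states because \<open>d * K \<le> n * n\<close>; \<open>n + 3\<close> is the block size
  and \<open>(n + 1) ^ (n + 1)\<close> bounds the term of a leaf.\<close>

lemma vc_SOLVE:
  assumes regs: "r 1 = K" "r 2 = n" "r 3 = 1" and K: "K < n"
    and m: "\<forall>i<n. \<forall>j<n. m (2 + n * i + j) = of_bool ({i, j} \<in> E)" "\<forall>x\<ge>2 + n * n. m x = 0"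
    and big: "QB + (n + 3) * ((n + 1) * 3 ^ (n * n)) * (n + 1) ^ (n + 1) < 2 ^ L"
  shows "vc L SOLVE (\<lambda>u (r', m'). u \<le> 1000 * (n + 1) ^ 3 * 3 ^ (degeneracy {..<n} E * K) \<and>
    (r' 0 \<noteq> 0 \<longleftrightarrow> Dominating_Set {..<n} E K)) (r, m)"
  unfolding SOLVE_def
  apply simp
  apply (rule vc_LAYOUT[OF regs(2,3) m])
  apply simp
  subgoal premises l for u1 r1 m1
    apply (rule vc_ORDER[where \<pi>=id])
    subgoal using l regs by simp
    subgoal using l regs by simp
    subgoal using l regs by simp
    subgoal using l regs by simp
    subgoal using l by simp
    subgoal premises o for u2 r2 m2 \<pi>
    proof -
      \<comment> \<open>The branching runs with the value found by the program, which may lie below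
        the degeneracy \<open>D\<close>.\<close>
      define d where "d = r2 6"
      define a where "a = (\<lambda>p q. closed_adj E (\<pi> p) (\<pi> q))"
      define D where "D = degeneracy {..<n} E"
      have d: "d \<le> D" "d \<le> n" using o by (simp_all add: d_def D_def)
      have deg: "card {u. v < u \<and> u < n \<and> a v u} \<le> d" if "v < n" for v
      proof -
        have "{u. v < u \<and> u < n \<and> a v u} = {x \<in> {Suc v..<n}. closed_adj E (\<pi> v) (\<pi> x)}"
          by (auto simp: a_def)
        then show ?thesis using o(6)[OF that] by (simp add: d_def)
      qed
      interpret layout n a L RB OB QB by (rule layout)
      interpret machine n d a L RB OB QB
      proof unfold_locales
        show "a v u" if "a u v" for u v using that by (simp add: a_def closed_adj_sym)
        show "a v v" for v by (simp add: a_def closed_adj_def)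
      qed (rule deg)
      have om: "ord_mem m2 \<pi>" by (rule o(3))
      have am: "adj_mem m2" using ord_mem_adj[OF om] by (simp add: a_def)
      have z: "\<forall>x\<ge>QB. m2 x = 0" using om by (simp add: ord_mem_def)
      have r2: "r2 1 = K" "r2 2 = n" "r2 3 = 1" "r2 4 = RB" "r2 5 = OB" "r2 6 = d"
        using l o(2) regs by (simp_all add: d_def)
      define X where "X = (n + 1) * 3 ^ (n * n)"
      define Y where "Y = (n + 1) ^ (n + 1)"
      have dK: "d * K \<le> n * n" using d K by (intro mult_le_mono) auto
      have w: "weight (0, K, d * K, {}, {}) \<le> X"
      proof -
        have "(3::nat) ^ (d * K) \<le> 3 ^ (n * n)" using dK by (intro power_increasing) auto
        from mult_le_mono2[OF this, of "n + 1"] show ?thesis by (simp add: weight_def X_def)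
      qed
      have X: "1 \<le> X" "n * n < X"
      proof -
        have "n * n < 3 ^ (n * n)" by (rule order.strict_trans1[OF _ less_exp[THEN order.strict_trans2]]) (auto intro: power_mono)
        then show "n * n < X" by (auto simp: X_def)
        then show "1 \<le> X" by simp
      qed
      have Y: "1 \<le> Y" unfolding Y_def by (rule one_le_power) simp
      have big: "QB + (n + 3) * X * Y < 2 ^ L" using big unfolding X_def Y_def .
      have big1: "QB + (n + 3) * X < 2 ^ L"
      proof -
        have "(n + 3) * X * 1 \<le> (n + 3) * X * Y" using Y by (intro mult_le_mono2)
        then show ?thesis using big by linarith
      qed
      have big2: "Y * X < 2 ^ L"
      proof -
        have "1 * (X * Y) \<le> (n + 3) * (X * Y)" by (intro mult_le_mono1) simp
        then have "Y * X \<le> (n + 3) * X * Y" by (simp only: mult.assoc mult_1 mult.commute[of Y])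
        then show ?thesis using big by linarith
      qed
      have nK: "n ^ K \<le> Y" "(n + 1) ^ (K + 1) \<le> Y"
      proof -
        show "(n + 1) ^ (K + 1) \<le> Y" unfolding Y_def using K by (intro power_increasing) auto
        have "n ^ K \<le> (n + 1) ^ K" by (rule power_mono) auto
        also have "\<dots> \<le> Y" unfolding Y_def using K by (intro power_increasing) auto
        finally show "n ^ K \<le> Y" .
      qed
      have YL: "Y < 2 ^ L" and XL: "X < 2 ^ L"
        using big2 mult_le_mono2[OF X(1), of Y] mult_le_mono1[OF Y, of X] by linarith+
      have sv: "state_value (0, K, d * K, {}, {}) = signed_count n (0, K, d * K, {}, {})"
        by (simp add: state_value_def)
      have ans: "0 < state_value (0, K, d * K, {}, {}) \<longleftrightarrow> Dominating_Set {..<n} E K"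
        unfolding sv signed_count_pos_iff[OF n] using Dominating_Set_reindex[of \<pi> n E K] om
        by (simp add: ord_mem_def a_def)
      show ?thesis
        apply simp
        apply (rule vc_INIT[OF r2])
        subgoal by (rule QB)
        subgoal using big1 mult_le_mono2[OF X(1), of "n + 3", unfolded mult_1_right] by linarith
        subgoal using K n_bound by simp
        subgoal using dK X(2) XL by linarith
        subgoal by (rule am)
        subgoal by (rule z)
        subgoal premises i for u3 r3 m3
        proof -
          have main: "wp L (While 29 STEP) (\<lambda>u (r', m').
              u \<le> weight (0, K, d * K, {}, {}) * (250 * (n + 1) ^ 2 + 1) + 1 \<and>
              int (r' 10) - int (r' 11) = state_value (0, K, d * K, {}, {})) (r3, m3)"
          proof -
            have "n ^ K * weight (0, K, d * K, {}, {}) \<le> Y * X" using nK(1) w by (rule mult_le_mono)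
            then have acc: "n ^ K * weight (0, K, d * K, {}, {}) < 2 ^ L" using big2 by linarith
            have "(n + 3) * weight (0, K, d * K, {}, {}) \<le> (n + 3) * X" using w by (rule mult_le_mono2)
            then have room: "QB + (n + 3) * weight (0, K, d * K, {}, {}) < 2 ^ L" using big1 by linarith
            have "wp L (While 29 STEP) (\<lambda>u (r', m').
              u \<le> (\<Sum>q\<leftarrow>[(0, K, d * K, {}, {})]. weight q) * (250 * (n + 1) ^ 2 + 1) + 1 \<and>
              int (r' 10) - int (r' 11) = int (r3 10) - int (r3 11) + (\<Sum>q\<leftarrow>[(0, K, d * K, {}, {})]. state_value q)) (r3, m3)"
              using i K nK(2) YL XL X(2) dK acc room
              by (intro wp_MAIN[where K=K and B="d * K"]) (auto simp: good_def)
            then show ?thesis using i by simp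
          qed
          have time: "u1 + (u2 + (u3 + (u + 10))) \<le> 1000 * (n + 1) ^ 3 * 3 ^ (D * K)"
            if "u \<le> weight (0, K, d * K, {}, {}) * (250 * (n + 1) ^ 2 + 1) + 1" for u
          proof -
            define N where "N = (n + 1) ^ 3"
            have "3 ^ (d * K) \<le> (3::nat) ^ (D * K)" using d by (intro power_increasing mult_le_mono1) auto
            then have Z: "N * 3 ^ (d * K) \<le> N * 3 ^ (D * K)" "N \<le> N * 3 ^ (D * K)" by auto
            have "(n + 1) * (250 * (n + 1) ^ 2 + 1) \<le> 251 * N"
              by (simp add: N_def power3_eq_cube power2_eq_square algebra_simps)
            then have "(n + 1) * (250 * (n + 1) ^ 2 + 1) * 3 ^ (d * K) \<le> 251 * N * 3 ^ (d * K)"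
              by (rule mult_le_mono1)
            then have u: "u \<le> 251 * (N * 3 ^ (d * K)) + 1"
              using that by (simp add: weight_def algebra_simps)
            \<comment> \<open>The cubic part comes from ordering the vertices: \<open>n\<close>
              rounds, each computing up to \<open>n\<close> degrees in linear time.\<close>
            have "u1 + u2 + u3 + 11 \<le> 500 * N"
              using l(1) o(1) i(1) K by (simp add: N_def power3_eq_cube algebra_simps)
            then have "u1 + (u2 + (u3 + (u + 10))) \<le> 1000 * (N * 3 ^ (D * K))" using u Z by linarith
            then show ?thesis by (simp add: N_def mult.assoc)
          qed
          show ?thesis
            apply simp
            apply (rule wp_mono[OF main])
            subgoal for u s
              apply (cases s)
              subgoal for r' m'
                using ans time[of u] by (auto simp: D_def)
              done
            done
        qed
        done
    qed
    done
  done

end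

section \<open>Encoded instances and word length\<close>

lemma concat_map_uniform:
  assumes "\<And>i. i < k \<Longrightarrow> length (f i) = n"
  shows "length (concat (map f [0..<k])) = n * k \<and>
    (\<forall>i<k. \<forall>j<n. concat (map f [0..<k]) ! (n * i + j) = f i ! j)"
  using assms
proof (induction k)
  case (Suc k)
  then have len: "length (concat (map f [0..<k])) = n * k"
    and nth: "\<forall>i<k. \<forall>j<n. concat (map f [0..<k]) ! (n * i + j) = f i ! j" by auto
  have "concat (map f [0..<Suc k]) ! (n * i + j) = f i ! j" if "i < Suc k" "j < n" for i j
  proof (cases "i = k")
    case True
    then show ?thesis using len by (simp add: nth_append)
  next
    case False
    then have "i < k" using that by simp
    then have "n * Suc i \<le> n * k" by (intro mult_le_mono2) simp
    then have "n * i + j < n * k" using that by simp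
    then show ?thesis using len nth \<open>i < k\<close> that by (simp add: nth_append)
  qed
  then show ?case using len Suc.prems[of k] by simp
qed simp

lemma initial_encode_instance:
  defines "m n E k \<equiv> snd (initial (encode_instance n E k))"
  shows "m n E k 0 = k" "m n E k (Suc 0) = n"
    "\<forall>i<n. \<forall>j<n. m n E k (2 + n * i + j) = of_bool ({i, j} \<in> E)"
    "\<forall>x\<ge>2 + n * n. m n E k x = 0"
proof -
  let ?f = "\<lambda>i. map (\<lambda>j. if {i, j} \<in> E then 1 else 0 :: nat) [0..<n]"
  let ?xs = "concat (map ?f [0..<n])"
  have xs: "length ?xs = n * n" "\<forall>i<n. \<forall>j<n. ?xs ! (n * i + j) = ?f i ! j"
    using concat_map_uniform[of n ?f n] by simp_all
  show "m n E k 0 = k" "m n E k (Suc 0) = n" "\<forall>x\<ge>2 + n * n. m n E k x = 0"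
    using xs(1) by (simp_all add: m_def initial_def encode_instance_def)
  show "\<forall>i<n. \<forall>j<n. m n E k (2 + n * i + j) = of_bool ({i, j} \<in> E)"
  proof (intro allI impI)
    fix i j assume ij: "i < n" "j < n"
    then have "m n E k (2 + n * i + j) = ?xs ! (n * i + j)"
      using xs(1) matrix_index_less[OF ij] by (simp add: m_def initial_def encode_instance_def)
    also have "\<dots> = ?f i ! j" using xs(2) ij by blast
    finally show "m n E k (2 + n * i + j) = of_bool ({i, j} \<in> E)" using ij by simp
  qed
qed

lemma less_power_len: "x < 2 ^ len x"
  by (rule floorlog_leD) auto

lemma entry_less_power_input_size:
  assumes "x \<in> set xs"
  shows "x < 2 ^ input_size xs"
proof -
  have "1 + len x \<le> input_size xs"
    unfolding input_size_def using assms by (intro member_le_sum_list) auto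
  then have "(2::nat) ^ len x \<le> 2 ^ input_size xs" by (intro power_increasing) auto
  then show ?thesis using less_power_len[of x] by (rule order.strict_trans2[rotated])
qed

lemma length_le_input_size: "length xs \<le> input_size xs"
  unfolding input_size_def by (induction xs) auto

lemma n_le_input_size: "n * n + 2 \<le> input_size (encode_instance n E k)"
proof -
  have "length (encode_instance n E k) = n * n + 2"
    using concat_map_uniform[of n "\<lambda>i. map (\<lambda>j. if {i, j} \<in> E then 1 else 0 :: nat) [0..<n]" n]
    by (simp add: encode_instance_def)
  then show ?thesis using length_le_input_size[of "encode_instance n E k"] by simp
qed

text \<open>Each factor is bounded by a power of 2, via \<open>x + 1 \<le> 2 ^ x\<close> and
  \<open>3 < 4\<close>, and the exponents add up to a quadratic polynomial. One bit is kept in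
  reserve to absorb the sum of the two parts.\<close>

lemma memory_bound:
  fixes n :: nat
  shows "2 + n * n + n + n + (n + 3) * ((n + 1) * 3 ^ (n * n)) * (n + 1) ^ (n + 1) < 2 ^ (20 * (n + 2) ^ 2)"
proof -
  have e: "x + 1 \<le> 2 ^ x" for x :: nat using less_exp[of x] by (simp add: Suc_le_eq)
  have "(3::nat) ^ (n * n) \<le> 4 ^ (n * n)" by (rule power_mono) auto
  also have "(4::nat) ^ (n * n) = 2 ^ (2 * (n * n))" by (simp add: power_mult)
  finally have 3: "(3::nat) ^ (n * n) \<le> 2 ^ (2 * (n * n))" .
  have "(n + 1) ^ (n + 1) \<le> (2 ^ n) ^ (n + 1)" using e by (rule power_mono) simp
  then have 4: "(n + 1) ^ (n + 1) \<le> 2 ^ (n * (n + 1))" by (simp only: power_mult)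
  have "(n + 3) * ((n + 1) * 3 ^ (n * n)) * (n + 1) ^ (n + 1)
      \<le> 2 ^ (n + 2) * (2 ^ n * 2 ^ (2 * (n * n))) * 2 ^ (n * (n + 1))"
    using e[of "n + 2"] e[of n] 3 4 by (intro mult_le_mono) auto
  also have "\<dots> = 2 ^ (n + 2 + (n + 2 * (n * n)) + n * (n + 1))" by (simp only: power_add)
  also have "\<dots> \<le> 2 ^ (20 * (n + 2) ^ 2 - 1)"
    by (intro power_increasing) (auto simp: power2_eq_square algebra_simps)
  finally have a: "(n + 3) * ((n + 1) * 3 ^ (n * n)) * (n + 1) ^ (n + 1) \<le> 2 ^ (20 * (n + 2) ^ 2 - 1)" .
  have "2 + n * n + n + n + 1 \<le> 20 * (n + 2) ^ 2 - 1" by (simp add: power2_eq_square algebra_simps)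
  also have "\<dots> < 2 ^ (20 * (n + 2) ^ 2 - 1)" by (rule less_exp)
  finally have b: "2 + n * n + n + n < 2 ^ (20 * (n + 2) ^ 2 - 1)" by simp
  have "(2::nat) ^ (20 * (n + 2) ^ 2) = 2 * 2 ^ (20 * (n + 2) ^ 2 - 1)"
    by (subst power_Suc[symmetric]) (simp add: power2_eq_square)
  then show ?thesis using a b by linarith
qed

text \<open>The exponent 5 combines a cubic number of steps per branching state bound with the
  quadratic cost \<open>2 * L + 1\<close> of a step. In \<open>L\<close> the summand
  \<open>N\<close> accounts for the input, where \<open>k\<close> may be huge, and the quadratic one
  for all computed numbers.\<close>

lemma DOMINATING_SET_decides:
  fixes n k :: nat and E :: "nat set set"
  assumes G: "simple_graph {..<n} E"
  defines "N \<equiv> input_size (encode_instance n E k)"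
  shows "\<exists>t s. exec DOMINATING_SET (initial (encode_instance n E k)) t s \<and>
    t \<le> 50000 * (N + 2) ^ 5 * 3 ^ (degeneracy {..<n} E * k) \<and> (fst s 0 \<noteq> 0 \<longleftrightarrow> Dominating_Set {..<n} E k)"
proof -
  define L where "L = 20 * (n + 2) ^ 2 + N"
  define m where "m = snd (initial (encode_instance n E k))"
  have init: "initial (encode_instance n E k) = ((\<lambda>_. 0), m)" by (simp add: m_def initial_def)
  note m = initial_encode_instance[where n=n and E=E and k=k, folded m_def]
  have "(2::nat) ^ (20 * (n + 2) ^ 2) \<le> 2 ^ L" by (intro power_increasing) (auto simp: L_def)
  then have big: "2 + n * n + n + n + (n + 3) * ((n + 1) * 3 ^ (n * n)) * (n + 1) ^ (n + 1) < 2 ^ L"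
    using memory_bound[of n] by linarith
  have bounded: "bounded L ((\<lambda>_. 0), m)"
  proof -
    have "(2::nat) ^ N \<le> 2 ^ L" by (intro power_increasing) (auto simp: L_def)
    moreover have "m x < 2 ^ N" for x
      unfolding m_def initial_def N_def by (auto intro: entry_less_power_input_size)
    ultimately show ?thesis unfolding bounded_def by (auto intro: order.strict_trans2 simp del: power_increasing_iff)
  qed
  have vc: "vc L DOMINATING_SET (\<lambda>u (r', m'). u \<le> 1010 * (n + 1) ^ 3 * 3 ^ (degeneracy {..<n} E * k) \<and>
    (r' 0 \<noteq> 0 \<longleftrightarrow> Dominating_Set {..<n} E k)) ((\<lambda>_. 0), m)"
  proof -
    have "(1::nat) * 1 \<le> (n + 1) ^ 3 * 3 ^ (degeneracy {..<n} E * k)" by (intro mult_le_mono) auto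
    then have c: "10 \<le> 10 * ((n + 1) ^ 3 * 3 ^ (degeneracy {..<n} E * k))" by simp
    have slack: "u + 7 \<le> 1010 * (n + 1) ^ 3 * 3 ^ (degeneracy {..<n} E * k)"
      if "u \<le> 1000 * (n + 1) ^ 3 * 3 ^ (degeneracy {..<n} E * k)" for u
      using that c by (simp only: mult.assoc)
    have one: "Suc 0 < 2 ^ L" using big by simp
    show ?thesis
    proof (cases "k < n")
      case True
      interpret instance_layout n L "2 + n * n" "2 + n * n + n" "2 + n * n + n + n" E
        using G True big by unfold_locales auto
      have solve: "vc L SOLVE (\<lambda>u (r', m'). u \<le> 1000 * (n + 1) ^ 3 * 3 ^ (degeneracy {..<n} E * k) \<and>
          (r' 0 \<noteq> 0 \<longleftrightarrow> Dominating_Set {..<n} E k))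
          (r, m)" if "r 1 = k" "r 2 = n" "r 3 = 1" for r
        by (rule vc_SOLVE[OF that True m(3,4) big])
      show ?thesis
        unfolding DOMINATING_SET_def using True m(1,2) one
        apply simp
        apply (rule vc_mono[OF solve])
        subgoal by simp
        subgoal by simp
        subgoal by simp
        subgoal for u s using slack[of u] by (cases s) auto
        done
    next
      case False
      have "dominating_set {..<n} E {..<n}" by (auto simp: dominating_set_def)
      then have "Dominating_Set {..<n} E k" using False unfolding Dominating_Set_def
        by (intro exI[of _ "{..<n}"]) auto
      moreover have "8 \<le> 1010 * (n + 1) ^ 3 * 3 ^ (degeneracy {..<n} E * k)"
        using c slack[of 1] by (simp only: mult.assoc)
      ultimately show ?thesis unfolding DOMINATING_SET_def using False m one by simp
    qed
  qed
  obtain t s u where *: "exec DOMINATING_SET ((\<lambda>_. 0), m) t s" "t \<le> u * (2 * L + 1)"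
    "u \<le> 1010 * (n + 1) ^ 3 * 3 ^ (degeneracy {..<n} E * k)" "fst s 0 \<noteq> 0 \<longleftrightarrow> Dominating_Set {..<n} E k"
    using vc_imp_wp[OF vc] bounded unfolding wp_def by (auto split: prod.splits)
  have "n \<le> n * n" by (cases n) auto
  then have nN: "n + 2 \<le> N + 2" using n_le_input_size[of n E k] unfolding N_def by linarith
  have "u \<le> 1010 * (N + 2) ^ 3 * 3 ^ (degeneracy {..<n} E * k)"
    by (rule order.trans[OF *(3)]) (use nN in \<open>auto intro!: mult_le_mono power_mono\<close>)
  moreover have "2 * L + 1 \<le> 45 * (N + 2) ^ 2"
  proof -
    have "(n + 2) ^ 2 \<le> (N + 2) ^ 2" using nN by (intro power_mono) auto
    moreover have "2 * N + 1 \<le> 5 * (N + 2) ^ 2" by (simp add: power2_eq_square algebra_simps)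
    ultimately have "40 * (n + 2) ^ 2 + (2 * N + 1) \<le> 40 * (N + 2) ^ 2 + 5 * (N + 2) ^ 2"
      by (intro add_mono mult_le_mono2)
    then show ?thesis by (simp add: L_def)
  qed
  ultimately have "u * (2 * L + 1) \<le> 1010 * (N + 2) ^ 3 * 3 ^ (degeneracy {..<n} E * k) * (45 * (N + 2) ^ 2)"
    by (rule mult_le_mono)
  also have "\<dots> = 45450 * (N + 2) ^ (3 + 2) * 3 ^ (degeneracy {..<n} E * k)"
    by (simp only: power_add) simp
  also have "\<dots> \<le> 50000 * (N + 2) ^ 5 * 3 ^ (degeneracy {..<n} E * k)"
    by (intro mult_le_mono) auto
  finally have "t \<le> 50000 * (N + 2) ^ 5 * 3 ^ (degeneracy {..<n} E * k)" using *(2) by simp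
  then show ?thesis unfolding init using *(1,4) by blast
qed

theorem theorem10:
  "\<exists>(P :: ram) (g :: nat \<Rightarrow> real). g \<in> o(\<lambda>N. real N) \<and>
     solves_Dominating_Set_in_O_star P (\<lambda>d k. 3 powr (real (d * k) + g (d * k)))"
proof (intro exI conjI)
  show "(\<lambda>_. 0) \<in> o(\<lambda>N. real N)" by simp
  show "solves_Dominating_Set_in_O_star DOMINATING_SET (\<lambda>d k. 3 powr (real (d * k) + 0))"
    unfolding solves_Dominating_Set_in_O_star_def
  \<comment> \<open>\<open>[:2, 1:]\<close> is the polynomial \<open>x + 2\<close>, so the factor is
    \<open>50000 * (N + 2) ^ 5\<close> at the input size \<open>N\<close>.\<close>
  proof (intro exI[of _ "smult 50000 ([:2, 1:] ^ 5)"] allI impI, elim conjE)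
    fix n k d :: nat and E :: "nat set set"
    assume "simple_graph {..<n} E" and d: "degeneracy {..<n} E = d"
    from DOMINATING_SET_decides[OF this(1), of k] obtain t s where
      *: "exec DOMINATING_SET (initial (encode_instance n E k)) t s"
      "t \<le> 50000 * (input_size (encode_instance n E k) + 2) ^ 5 * 3 ^ (d * k)"
      "fst s 0 \<noteq> 0 \<longleftrightarrow> Dominating_Set {..<n} E k"
      unfolding d by blast
    have "real t \<le> real (50000 * (input_size (encode_instance n E k) + 2) ^ 5 * 3 ^ (d * k))"
      using *(2) by (simp only: of_nat_le_iff)
    also have "\<dots> = poly (smult 50000 ([:2, 1:] ^ 5)) (real (input_size (encode_instance n E k)))
        * 3 powr (real (d * k) + 0)"
      using powr_realpow[of 3 "d * k"] by (simp add: add.commute)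
    finally show "decides_in_time DOMINATING_SET (encode_instance n E k) (Dominating_Set {..<n} E k)
        (poly (smult 50000 ([:2, 1:] ^ 5)) (real (input_size (encode_instance n E k)))
          * 3 powr (real (d * k) + 0))"
      using * unfolding decides_in_time_def by blast
  qed
qed

end
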